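(* Let $p=5m+3$ be a prime with $m\ge\max\{5T(1/5),21\}$, let $n\ge1$, and let $(k,\ell)=(4,1)$ or $(3,2)$. If $A\subset\mathbb F_p^n$ is a nontrivial $(k,\ell)$-sum-free set with $|A|\ge mp^{n-1}$, then $A$ is either normal or of type 3 or of type 4.
   Context: Here $k+\ell=5$ and $p=(k+\ell)m+2+\lambda$ with $\lambda=1$. For a set $X$ in an abelian group and $h\ge1$, $hX=\{x_1+\dots+x_h:x_i\in X\}$. A nonempty $A\subseteq\mathbb F_p^n$ is $(k,\ell)$-sum-free if $kA\cap\ell A=\emptyset$. Subsets of $\mathbb F_p^n$ are isomorphic if an automorphism of the additive group $\mathbb F_p^n$ maps one onto the other. For $a,b\in\mathbb F_p$, $[a,b]=\{a,a+1,\dots,b\}\subseteq\mathbb F_p$ (cyclic interval). With $\lambda=1$, the only extremal cuboid is $A_{k,\ell,p,0}=[a_0,a_0+m]\times\mathbb F_p^{n-1}$, $a_0=-(km+1)(k-\ell)^{-1}\in\mathbb F_p$; a $(k,\ell)$-sum-free set is trivial if it is isomorphic to a subset of $A_{k,\ell,p,0}$, nontrivial otherwise. Types (for $A\subseteq\mathbb F_p^n$ with $|A|=mp^{n-1}$): type 1: $A$ is isomorphic to $[a,a+m-1]\times\mathbb F_p^{n-1}$ for some $a\in\mathbb F_p$ with $\ell a-k(a+m-1)\in[1,\ell]$ or $\in[\lambda+\ell+2,k]$ (latter only when $\lambda+\ell+2\le k$). Type 2: $\ell=1$, $n\ge2$, and $A$ is isomorphic to $(\{a\}\times(\mathbb F_p^{n-1}\setminus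 V))\sqcup([a+1,a+m-1]\times\mathbb F_p^{n-1})\sqcup(\{a+m\}\times V)$ with $a=mk(\ell-k)^{-1}$ and $V$ a proper subspace of $\mathbb F_p^{n-1}$. Normal means type 1 or type 2. Type 3: with $a=(\ell m+k-1)(k-\ell)^{-1}\in\mathbb F_p$, $A$ is isomorphic to $([a-1,a+m]\setminus\{a,a+m-1\})\times\mathbb F_p^{n-1}$. Type 4: $n\ge2$ and there is a proper subspace $V\subset\mathbb F_p^{n-1}$ such that $A$ is isomorphic to $(\{2m+1,3m+2\}\times V)\sqcup(\{2m+2,3m+1\}\times(\mathbb F_p^{n-1}\setminus V))\sqcup([2m+3,3m]\times\mathbb F_p^{n-1})$. The function $T$: a finite $X\subseteq\mathbb F_p$ has the covering property if it is contained in an arithmetic progression of length $|X+X|-|X|+1$. For $c\in(0,1)$, $\tau\in(0,1]$ is feasible for $c$ if (for every prime $p$) every $X\subseteq\mathbb F_p$ with $|X|\le cp$ and $|X+X|\le(2+\tau)|X|-3$ has the covering property; $\tau(c)$ is the supremum of feasible $\tau$ and $T(c)=1/\tau(c)$. *)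

theory Defs
  imports
    "HOL-Algebra.FiniteProduct"
    "HOL-Algebra.Product_Groups"
    "HOL-Number_Theory.Modular_Inverse"
    "HOL-Library.Extended_Nonnegative_Real"
begin

text \<open>
  Abelian groups are HOL-Algebra monoid records, so the group operation is written multiplicatively
  even where it is addition modulo \<open>p\<close>. The field \<open>F_p\<close> is represented by \<open>{0..<int p}\<close>.
\<close>

definition sumset_fold :: "('a, 'b) monoid_scheme \<Rightarrow> nat \<Rightarrow> 'a set \<Rightarrow> 'a set" where
  "sumset_fold G h X = {finprod G x {1..h} | x. x \<in> {1..h} \<rightarrow> X}"

definition sum_free :: "('a, 'b) monoid_scheme \<Rightarrow> nat \<Rightarrow> nat \<Rightarrow> 'a set \<Rightarrow> bool" where
  "sum_free G k l A \<longleftrightarrow>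
     A \<subseteq> carrier G \<and> A \<noteq> {} \<and> sumset_fold G k A \<inter> sumset_fold G l A = {}"

definition isomorphic_in :: "('a, 'b) monoid_scheme \<Rightarrow> 'a set \<Rightarrow> 'a set \<Rightarrow> bool" where
  "isomorphic_in G A B \<longleftrightarrow> (\<exists>f \<in> iso G G. f ` A = B)"

definition Fp_space :: "nat \<Rightarrow> nat \<Rightarrow> (nat \<Rightarrow> int) monoid" where
  "Fp_space p n = product_group {..<n} (\<lambda>_. integer_mod_group p)"

definition Fp_subspace :: "nat \<Rightarrow> nat \<Rightarrow> (nat \<Rightarrow> int) set \<Rightarrow> bool" where
  "Fp_subspace p n V \<longleftrightarrow>
     subgroup V (Fp_space p n) \<and>
     (\<forall>c \<in> {0..<int p}. \<forall>v \<in> V. (\<lambda>i\<in>{..<n}. c * v i mod int p) \<in> V)"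

definition proper_subspace :: "nat \<Rightarrow> nat \<Rightarrow> (nat \<Rightarrow> int) set \<Rightarrow> bool" where
  "proper_subspace p n V \<longleftrightarrow> Fp_subspace p n V \<and> V \<noteq> carrier (Fp_space p n)"

text \<open>
  The cyclic interval \<open>[a, b]\<close>; the integers \<open>a\<close> and \<open>b\<close> stand for their residue classes. It is never
  empty: if \<open>b\<close> is congruent to \<open>a - 1\<close>, it is all of \<open>F_p\<close>.
\<close>
definition cyc_interval :: "nat \<Rightarrow> int \<Rightarrow> int \<Rightarrow> int set" where
  "cyc_interval p a b = (\<lambda>i. (a + i) mod int p) ` {0..(b - a) mod int p}"

text \<open>
  The product \<open>X \<times> Y\<close> inside \<open>F_p^n = F_p \<times> F_p^(n-1)\<close> (for \<open>n \<ge> 1\<close>), where \<open>X\<close> is a set of residues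
  and \<open>Y\<close> a subset of \<open>F_p^(n-1)\<close>: coordinate 0 is split off and the others are shifted down by one.
\<close>
definition Fp_prod :: "nat \<Rightarrow> nat \<Rightarrow> int set \<Rightarrow> (nat \<Rightarrow> int) set \<Rightarrow> (nat \<Rightarrow> int) set" where
  "Fp_prod p n X Y =
     {x \<in> carrier (Fp_space p n). x 0 \<in> X \<and> (\<lambda>i\<in>{..<n-1}. x (Suc i)) \<in> Y}"

definition Fp_quot :: "nat \<Rightarrow> int \<Rightarrow> int \<Rightarrow> int" where
  "Fp_quot p u v = u * modular_inverse (int p) v mod int p"

text \<open>
  Throughout, \<open>p = (k + l) m + 2 + \<lambda>\<close> with \<open>\<lambda> = 1\<close>, so there is only one extremal cuboid.
\<close>

definition extremal_cuboid :: "nat \<Rightarrow> nat \<Rightarrow> nat \<Rightarrow> nat \<Rightarrow> nat \<Rightarrow> (nat \<Rightarrow> int) set" where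
  "extremal_cuboid p m n k l =
     (let a0 = Fp_quot p (- (int k * int m + 1)) (int k - int l)
      in Fp_prod p n (cyc_interval p a0 (a0 + int m)) (carrier (Fp_space p (n - 1))))"

definition trivial_set :: "nat \<Rightarrow> nat \<Rightarrow> nat \<Rightarrow> nat \<Rightarrow> nat \<Rightarrow> (nat \<Rightarrow> int) set \<Rightarrow> bool" where
  "trivial_set p m n k l A \<longleftrightarrow>
     (\<exists>B \<subseteq> extremal_cuboid p m n k l. isomorphic_in (Fp_space p n) A B)"

definition type1 :: "nat \<Rightarrow> nat \<Rightarrow> nat \<Rightarrow> nat \<Rightarrow> nat \<Rightarrow> (nat \<Rightarrow> int) set \<Rightarrow> bool" where
  "type1 p m n k l A \<longleftrightarrow>
     A \<subseteq> carrier (Fp_space p n) \<and> card A = m * p ^ (n - 1) \<and>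
     (\<exists>a \<in> {0..<int p}.
        (let d = (int l * a - int k * (a + int m - 1)) mod int p
         in d \<in> cyc_interval p 1 (int l) \<or>
            1 + l + 2 \<le> k \<and> d \<in> cyc_interval p (1 + int l + 2) (int k)) \<and>
        isomorphic_in (Fp_space p n) A
          (Fp_prod p n (cyc_interval p a (a + int m - 1)) (carrier (Fp_space p (n - 1)))))"

definition type2 :: "nat \<Rightarrow> nat \<Rightarrow> nat \<Rightarrow> nat \<Rightarrow> nat \<Rightarrow> (nat \<Rightarrow> int) set \<Rightarrow> bool" where
  "type2 p m n k l A \<longleftrightarrow>
     A \<subseteq> carrier (Fp_space p n) \<and> card A = m * p ^ (n - 1) \<and>
     l = 1 \<and> n \<ge> 2 \<and>
     (\<exists>V. proper_subspace p (n - 1) V \<and>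
        (let a = Fp_quot p (int m * int k) (int l - int k);
             W = carrier (Fp_space p (n - 1))
         in isomorphic_in (Fp_space p n) A
              (Fp_prod p n {a} (W - V)
               \<union> Fp_prod p n (cyc_interval p (a + 1) (a + int m - 1)) W
               \<union> Fp_prod p n {(a + int m) mod int p} V)))"

definition normal_set :: "nat \<Rightarrow> nat \<Rightarrow> nat \<Rightarrow> nat \<Rightarrow> nat \<Rightarrow> (nat \<Rightarrow> int) set \<Rightarrow> bool" where
  "normal_set p m n k l A \<longleftrightarrow> type1 p m n k l A \<or> type2 p m n k l A"

definition type3 :: "nat \<Rightarrow> nat \<Rightarrow> nat \<Rightarrow> nat \<Rightarrow> nat \<Rightarrow> (nat \<Rightarrow> int) set \<Rightarrow> bool" where
  "type3 p m n k l A \<longleftrightarrow>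
     A \<subseteq> carrier (Fp_space p n) \<and> card A = m * p ^ (n - 1) \<and>
     (let a = Fp_quot p (int l * int m + int k - 1) (int k - int l)
      in isomorphic_in (Fp_space p n) A
           (Fp_prod p n
              (cyc_interval p (a - 1) (a + int m) - {a, (a + int m - 1) mod int p})
              (carrier (Fp_space p (n - 1)))))"

text \<open>Only used for \<open>p = 5 m + 3\<close>, so that all integers below are at most \<open>p - 1\<close>.\<close>
definition type4 :: "nat \<Rightarrow> nat \<Rightarrow> nat \<Rightarrow> (nat \<Rightarrow> int) set \<Rightarrow> bool" where
  "type4 p m n A \<longleftrightarrow>
     A \<subseteq> carrier (Fp_space p n) \<and> card A = m * p ^ (n - 1) \<and>
     n \<ge> 2 \<and>
     (\<exists>V. proper_subspace p (n - 1) V \<and>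
        (let W = carrier (Fp_space p (n - 1))
         in isomorphic_in (Fp_space p n) A
              (Fp_prod p n {2 * int m + 1, 3 * int m + 2} V
               \<union> Fp_prod p n {2 * int m + 2, 3 * int m + 1} (W - V)
               \<union> Fp_prod p n (cyc_interval p (2 * int m + 3) (3 * int m)) W)))"

definition arith_prog :: "nat \<Rightarrow> int \<Rightarrow> int \<Rightarrow> nat \<Rightarrow> int set" where
  "arith_prog p a d L = {(a + int i * d) mod int p | i. i < L}"

definition covering_property :: "nat \<Rightarrow> int set \<Rightarrow> bool" where
  "covering_property p X \<longleftrightarrow>
     (\<exists>a \<in> {0..<int p}. \<exists>d \<in> {1..<int p}.
        X \<subseteq> arith_prog p a d (card (sumset_fold (integer_mod_group p) 2 X) + 1 - card X))"

definition feasible :: "real \<Rightarrow> real \<Rightarrow> bool" where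
  "feasible c t \<longleftrightarrow>
     0 < t \<and> t \<le> 1 \<and>
     (\<forall>p::nat. prime p \<longrightarrow>
        (\<forall>X \<subseteq> carrier (integer_mod_group p).
           real (card X) \<le> c * real p \<and>
           real (card (sumset_fold (integer_mod_group p) 2 X)) \<le> (2 + t) * real (card X) - 3 \<longrightarrow>
           covering_property p X))"

text \<open>
  In \<open>ennreal\<close> the supremum of the empty set is 0 and \<open>1 / 0 = \<infinity>\<close>, so \<open>T c = \<infinity>\<close> if no \<open>t\<close> is feasible
  for \<open>c\<close>.
\<close>
definition tau_sup :: "real \<Rightarrow> ennreal" where
  "tau_sup c = (SUP t \<in> {t. feasible c t}. ennreal t)"

definition T_fun :: "real \<Rightarrow> ennreal" where
  "T_fun c = 1 / tau_sup c"

end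

(*
Choose a line through the origin meeting A in at least m points and cut F_p^n into the columns
parallel to it. The part of A on that line is sum-free in F_p, so by the covering property or by
Vosper's theorem it lies in a progression of length m + 2; after rescaling, in a short interval. For
every u some signed sum of three large columns lies over u and contains an interval of length 3m -
2; as it has to avoid all differences between the columns over v and u + v, the relative position of
these is determined by u up to an error of m + 2. These displacements form a bounded cocycle, hence
agree up to a bounded error with a linear function g. Shearing by g moves all of A into a window [c,
c + H] x F_p^(n-1) with H <= m + 11.

Now cut the window into its slices S (c + i). Sum-freeness forbids five slices whose (signed)
positions sum to zero from being too large together, and double counting against |A| >= m p^(n-1)
leaves only H in {m - 1, m, m + 1} and a short list of values for c. In each case at most four
slices are not full; these are cosets of a subgroup V or complements of such cosets, and one more
shear moves them to V and its complement. The list of cases is invariant under x -> -x, which halves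
it.
*)

theory Submission
  imports Defs "HOL-Library.Set_Algebras" "HOL-Library.Function_Algebras"
begin

text \<open>The two conditions on \<open>m\<close> have different origins. From
  \<open>m >= 5 T(1/5)\<close> comes a feasible \<open>t\<close> with \<open>t m > 4\<close>; this
  is what the covering property needs when the chosen line carries exactly \<open>m\<close> points
  and their doubling is at most 2m + 1. From \<open>m >= 21\<close> it follows that a column with at
  least m - 2 points has at least 19, enough for a sum of three columns with holes to contain an
  interval as long as for three intervals. Its 3m - 2 residues leave 2m + 5 = 2 (m + 2) + 1 others,
  whence the error m + 2. The obstacle is that, apart from the base column, a single column may be
  small or empty. Only averages are available, so each step looks for two or three columns of at
  least average total size. For three of them the errors nearly cancel: 3 (m + 2) minus a total
  diameter of at least 3m - 3 is 9, and m + 11 is m + 2 + 9. As 9 does not grow with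
  \<open>m\<close>, the cocycle identity modulo \<open>p\<close> is an identity of integers and can
  be averaged.\<close>

text \<open>
  Subsets of \<open>F_p\<close> are encoded as \<open>p\<close>-periodic sets of integers, and \<open>rcard p X\<close> counts residue
  classes. For the pair \<open>(k, l) = (4, 1)\<close> or \<open>(3, 2)\<close> the equation to be avoided is
  \<open>x1 + x2 + x3 + sg b x4 = x5\<close>, where \<open>b\<close> tells whether \<open>k = 4\<close>.
\<close>

definition periodic :: "int \<Rightarrow> int set \<Rightarrow> bool" where
  "periodic p X \<longleftrightarrow> (\<forall>x. x + p \<in> X \<longleftrightarrow> x \<in> X)"

definition rcard :: "int \<Rightarrow> int set \<Rightarrow> int" where
  "rcard p X = int (card (X \<inter> {0..<p}))"

lemma periodic_add_mult:
  assumes "periodic p X"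
  shows "x + k * p \<in> X \<longleftrightarrow> x \<in> X"
proof -
  have nat: "y + int j * p \<in> X \<longleftrightarrow> y \<in> X" for y j
  proof (induction j)
    case (Suc j)
    have "y + int (Suc j) * p = (y + int j * p) + p" by (simp add: algebra_simps)
    then show ?case using Suc assms unfolding periodic_def by metis
  qed simp
  show ?thesis
  proof (cases "k \<ge> 0")
    case True
    then show ?thesis using nat[of x "nat k"] by simp
  next
    case False
    then show ?thesis using nat[of "x + k * p" "nat (- k)"] by simp
  qed
qed

lemma periodic_cong:
  assumes "periodic p X" "p dvd x - y"
  shows "x \<in> X \<longleftrightarrow> y \<in> X"
proof -
  obtain k where "x - y = p * k" using assms(2) by blast
  then have "x = y + k * p" by (simp add: algebra_simps)
  then show ?thesis using periodic_add_mult[OF assms(1)] by blast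
qed

text \<open>Congruences modulo \<open>q\<close> are derived throughout by naming the coefficients
  \<open>u\<close>, \<open>v\<close>, \<open>w\<close>; what remains is an identity of integers for
  ring normalisation.\<close>

lemma dvd_lincomb:
  fixes q :: int
  assumes "q dvd a" "q dvd b" "z = a * u + b * v + q * w"
  shows "q dvd z"
  unfolding assms(3) by (intro dvd_add dvd_mult2 dvd_triv_left assms(1,2))

lemma dvd_mod_diff: "p dvd x mod p - (x :: int)"
proof -
  have "x mod p - x = p * (- (x div p))" by (simp add: minus_div_mult_eq_mod[symmetric])
  then show ?thesis by (metis dvd_triv_left)
qed

lemma periodic_mod: "periodic p X \<Longrightarrow> x mod p \<in> X \<longleftrightarrow> x \<in> X"
  by (rule periodic_cong[OF _ dvd_mod_diff])

lemma periodicI: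
  assumes "\<And>x k. x \<in> X \<Longrightarrow> x + k * p \<in> X"
  shows "periodic p X"
  unfolding periodic_def
proof (intro allI iffI)
  fix x
  show "x \<in> X \<Longrightarrow> x + p \<in> X" using assms[of x 1] by simp
  show "x + p \<in> X \<Longrightarrow> x \<in> X" using assms[of "x + p" "-1"] by simp
qed

lemma periodic_Un: "periodic p X \<Longrightarrow> periodic p Y \<Longrightarrow> periodic p (X \<union> Y)"
  and periodic_Int: "periodic p X \<Longrightarrow> periodic p Y \<Longrightarrow> periodic p (X \<inter> Y)"
  and periodic_Diff: "periodic p X \<Longrightarrow> periodic p Y \<Longrightarrow> periodic p (X - Y)"
  and periodic_Compl: "periodic p X \<Longrightarrow> periodic p (- X)"
  by (auto simp: periodic_def)

lemma periodic_shift: "periodic p X \<Longrightarrow> periodic p {x. x + a \<in> X}"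
  by (simp add: periodic_def add.assoc add.commute[of p])
    (simp add: add.assoc[symmetric])

lemma periodic_residue: "periodic p {x. p dvd x - a}"
proof (rule periodicI)
  fix x k assume "x \<in> {x. p dvd x - a}"
  then have "p dvd (x - a) + k * p" by simp
  then show "x + k * p \<in> {x. p dvd x - a}" by (simp add: algebra_simps)
qed

lemma periodic_plus1: "periodic p X \<Longrightarrow> periodic p (X + Y)"
proof (rule periodicI)
  fix z k assume X: "periodic p X" and "z \<in> X + Y"
  then obtain x y where "x \<in> X" "y \<in> Y" "z = x + y" by (auto simp: set_plus_def)
  then show "z + k * p \<in> X + Y"
    using set_plus_intro[of "x + k * p" X y Y] periodic_add_mult[OF X] by (simp add: algebra_simps)
qed

lemma periodic_uminus: "periodic p X \<Longrightarrow> periodic p (uminus ` X)"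
proof (rule periodicI)
  fix z k assume X: "periodic p X" and "z \<in> uminus ` X"
  then obtain x where "x \<in> X" "z = - x" by auto
  moreover have "x + (- k) * p \<in> X"
    using \<open>x \<in> X\<close> periodic_add_mult[OF X] by blast
  ultimately have "z + k * p = - (x + (- k) * p)" "x + (- k) * p \<in> X" by simp_all
  then show "z + k * p \<in> uminus ` X" by blast
qed

section \<open>Counting residue classes modulo a prime\<close>

locale modulus =
  fixes p :: int
  assumes prime: "prime p"
begin

lemma p_pos: "p > 0" using prime by (simp add: prime_gt_0_int)
lemma p_gt_1: "p > 1" using prime by (simp add: prime_gt_1_int)

abbreviation "per \<equiv> periodic p"
abbreviation "N \<equiv> rcard p"

lemma N_nonneg: "N X \<ge> 0" by (simp add: rcard_def)

lemma N_le: "N X \<le> p"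
proof -
  have "card (X \<inter> {0..<p}) \<le> card {0..<p}" by (intro card_mono) auto
  then show ?thesis using p_pos by (simp add: rcard_def)
qed

lemma N_UNIV: "N UNIV = p" using p_pos by (simp add: rcard_def)

lemma N_mono: "X \<subseteq> Y \<Longrightarrow> N X \<le> N Y"
  unfolding rcard_def by (auto intro!: card_mono)

lemma N_Un_Int: "N (X \<union> Y) + N (X \<inter> Y) = N X + N Y"
proof -
  have "card (X \<inter> {0..<p}) + card (Y \<inter> {0..<p})
      = card ((X \<inter> {0..<p}) \<union> (Y \<inter> {0..<p})) + card ((X \<inter> {0..<p}) \<inter> (Y \<inter> {0..<p}))"
    by (intro card_Un_Int) auto
  moreover have "(X \<inter> {0..<p}) \<union> (Y \<inter> {0..<p}) = (X \<union> Y) \<inter> {0..<p}"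
    "(X \<inter> {0..<p}) \<inter> (Y \<inter> {0..<p}) = (X \<inter> Y) \<inter> {0..<p}" by auto
  ultimately show ?thesis by (simp add: rcard_def)
qed

lemma N_empty: "N {} = 0" by (simp add: rcard_def)

lemma N_disjoint: "X \<inter> Y = {} \<Longrightarrow> N (X \<union> Y) = N X + N Y"
  using N_Un_Int[of X Y] by (simp add: N_empty)

lemma N_Compl: "N (- X) = p - N X"
  using N_disjoint[of X "- X"] by (simp add: N_UNIV)

lemma N_eq_0: "per X \<Longrightarrow> N X = 0 \<longleftrightarrow> X = {}"
proof
  assume X: "per X" and "N X = 0"
  then have 0: "X \<inter> {0..<p} = {}" by (simp add: rcard_def)
  show "X = {}"
  proof (rule ccontr)
    assume "X \<noteq> {}"
    then obtain x where "x \<in> X" by auto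
    then have "x mod p \<in> X \<inter> {0..<p}" using periodic_mod[OF X] p_pos by auto
    then show False using 0 by auto
  qed
qed (simp add: N_empty)

lemma N_pos: "per X \<Longrightarrow> X \<noteq> {} \<Longrightarrow> N X \<ge> 1"
  using N_eq_0[of X] N_nonneg[of X] by linarith

lemma N_eq_p: "per X \<Longrightarrow> N X \<ge> p \<Longrightarrow> X = UNIV"
  using N_eq_0[of "- X"] N_Compl[of X] N_le[of X] periodic_Compl[of p X] by auto

lemma N_subset_eq: "per X \<Longrightarrow> per Y \<Longrightarrow> X \<subseteq> Y \<Longrightarrow> N Y \<le> N X \<Longrightarrow> X = Y"
proof -
  assume a: "per X" "per Y" "X \<subseteq> Y" "N Y \<le> N X"
  have "N (X \<union> (Y - X)) = N X + N (Y - X)" by (rule N_disjoint) auto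
  moreover have "X \<union> (Y - X) = Y" using a by auto
  ultimately have "N (Y - X) = 0" using a N_nonneg[of "Y - X"] by simp
  then have "Y - X = {}" using N_eq_0 periodic_Diff a by blast
  then show ?thesis using a by auto
qed

text \<open>The maps are inverse to each other only modulo \<open>p\<close>. As they respect
  congruence, following them by \<open>mod p\<close> gives a genuine bijection between the
  representatives in \<open>{0..<p}\<close>.\<close>

lemma N_bij:
  assumes "per X" "per Y"
    and f: "\<And>x. x \<in> X \<Longrightarrow> f x \<in> Y" and g: "\<And>y. y \<in> Y \<Longrightarrow> g y \<in> X"
    and "\<And>x. p dvd g (f x) - x" and "\<And>y. p dvd f (g y) - y"
    and "\<And>x y. p dvd x - y \<Longrightarrow> p dvd f x - f y" and "\<And>x y. p dvd x - y \<Longrightarrow> p dvd g x - g y"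
  shows "N X = N Y"
proof -
  note md = dvd_mod_diff[of p]
  have uniq: "x = y" if "p dvd x - y" "x \<in> {0..<p}" "y \<in> {0..<p}" for x y
    using that by (metis atLeastLessThan_iff mod_eq_dvd_iff mod_pos_pos_trivial)
  have "bij_betw (\<lambda>x. f x mod p) (X \<inter> {0..<p}) (Y \<inter> {0..<p})"
  proof (rule bij_betw_byWitness[where f' = "\<lambda>y. g y mod p"])
    show "\<forall>x\<in>X \<inter> {0..<p}. g (f x mod p) mod p = x"
    proof
      fix x assume x: "x \<in> X \<inter> {0..<p}"
      have "p dvd g (f x mod p) - g (f x)" using assms(8)[OF md] .
      then have "p dvd g (f x mod p) - x" by (rule dvd_lincomb[OF _ assms(5)[of x], of _ _ 1 1 0]) simp
      then have "p dvd g (f x mod p) mod p - x" by (rule dvd_lincomb[OF _ md[of "g (f x mod p)"], of _ _ 1 1 0]) simp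
      then show "g (f x mod p) mod p = x" using x p_pos by (intro uniq) auto
    qed
    show "\<forall>y\<in>Y \<inter> {0..<p}. f (g y mod p) mod p = y"
    proof
      fix x assume x: "x \<in> Y \<inter> {0..<p}"
      have "p dvd f (g x mod p) - f (g x)" using assms(7)[OF md] .
      then have "p dvd f (g x mod p) - x" by (rule dvd_lincomb[OF _ assms(6)[of x], of _ _ 1 1 0]) simp
      then have "p dvd f (g x mod p) mod p - x" by (rule dvd_lincomb[OF _ md[of "f (g x mod p)"], of _ _ 1 1 0]) simp
      then show "f (g x mod p) mod p = x" using x p_pos by (intro uniq) auto
    qed
    show "(\<lambda>x. f x mod p) ` (X \<inter> {0..<p}) \<subseteq> Y \<inter> {0..<p}"
      using f periodic_mod[OF assms(2)] p_pos by auto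
    show "(\<lambda>y. g y mod p) ` (Y \<inter> {0..<p}) \<subseteq> X \<inter> {0..<p}"
      using g periodic_mod[OF assms(1)] p_pos by auto
  qed
  then show ?thesis unfolding rcard_def by (simp add: bij_betw_same_card)
qed

lemma N_shift: "per X \<Longrightarrow> N {x. x + a \<in> X} = N X"
  by (rule N_bij[where f = "\<lambda>x. x + a" and g = "\<lambda>x. x - a"]) (simp_all add: periodic_shift)

lemma N_uminus: "per X \<Longrightarrow> N (uminus ` X) = N X"
proof (rule N_bij[where f = uminus and g = uminus])
  fix x y assume "p dvd x - y"
  then have "p dvd - (x - y)" by (simp only: dvd_minus_iff)
  then show "p dvd - x - - y" "p dvd - x - - y" by simp_all
qed (auto simp: periodic_uminus)

lemma N_residue: "N {x. p dvd x - a} = 1"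
proof -
  have "{x. p dvd x - a} \<inter> {0..<p} = {a mod p}"
  proof (intro Set.set_eqI iffI)
    fix x assume x: "x \<in> {x. p dvd x - a} \<inter> {0..<p}"
    then have "x mod p = a mod p" by (intro iffD2[OF mod_eq_dvd_iff]) simp
    moreover have "x mod p = x" using x by simp
    ultimately show "x \<in> {a mod p}" by simp
  next
    fix x assume "x \<in> {a mod p}"
    then show "x \<in> {x. p dvd x - a} \<inter> {0..<p}" using p_pos dvd_mod_diff[of p a] by simp
  qed
  then show ?thesis by (simp add: rcard_def)
qed

text \<open>A nonzero residue generates the additive group: with \<open>e\<close> inverse to
  \<open>d\<close>, the class of \<open>y\<close> is reached from \<open>x\<close> after
  \<open>e * (y - x)\<close> steps modulo \<open>p\<close>.\<close>

lemma invariant_UNIV: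
  assumes X: "per X" "X \<noteq> {}" and d: "\<not> p dvd d" and inv: "\<And>x. x \<in> X \<Longrightarrow> x + d \<in> X"
  shows "X = UNIV"
proof -
  obtain x where x: "x \<in> X" using X by auto
  have iter: "x + int j * d \<in> X" for j
  proof (induction j)
    case (Suc j)
    then show ?case using inv[OF Suc] by (simp add: algebra_simps)
  qed (use x in simp)
  have "y \<in> X" for y
  proof -
    have "coprime d p" using prime_imp_coprime[OF prime d] by (simp add: ac_simps)
    then obtain e where e: "[d * e = 1] (mod p)" using cong_solve_coprime_int by blast
    define j where "j = nat ((e * (y - x)) mod p)"
    have "int j = (e * (y - x)) mod p" using p_pos by (simp add: j_def)
    then have "[int j * d = (e * (y - x)) * d] (mod p)" by (simp add: cong_def mod_mult_left_eq)
    also have "[(e * (y - x)) * d = (y - x) * (d * e)] (mod p)" by (simp add: algebra_simps)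
    also have "[(y - x) * (d * e) = (y - x) * 1] (mod p)" using e by (rule cong_scalar_left)
    finally have "p dvd (x + int j * d) - y" by (simp add: cong_iff_dvd_diff algebra_simps)
    then show ?thesis using periodic_cong[OF X(1)] iter by blast
  qed
  then show ?thesis by auto
qed

subsection \<open>The theorems of Cauchy--Davenport and Vosper\<close>

text \<open>Dyson's transform: for a shift \<open>e\<close>, replace \<open>X\<close> by its union
  with \<open>Y + e\<close> and \<open>Y\<close> by its intersection with \<open>X - e\<close>. The
  total size is kept, the sumset does not grow, and a suitable \<open>e\<close> makes
  \<open>Y\<close> strictly smaller.\<close>

lemma Cauchy_Davenport:
  assumes "per X" "per Y" "X \<noteq> {}" "Y \<noteq> {}"
  shows "N (X + Y) \<ge> min p (N X + N Y - 1)"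
  using assms
proof (induction "nat (N Y)" arbitrary: X Y rule: less_induct)
  case less
  note pX = less.prems(1) and pY = less.prems(2) and neX = less.prems(3) and neY = less.prems(4)
  obtain y where y: "y \<in> Y" using neY by auto
  have shift: "N {x. x - y \<in> X} = N X" using N_shift[OF pX, of "- y"] by simp
  have sub: "{x. x - y \<in> X} \<subseteq> X + Y"
    using y set_plus_intro[of _ X y Y] by fastforce
  show ?case
  proof (cases "N Y \<le> 1 \<or> X = UNIV")
    case True
    then show ?thesis
    proof
      assume "N Y \<le> 1"
      then show ?thesis using N_mono[OF sub] shift by simp
    next
      assume "X = UNIV"
      then show ?thesis using N_mono[OF sub] N_UNIV by simp
    qed
  next
    case False
    have "\<exists>y'\<in>Y. \<not> p dvd y' - y"
    proof (rule ccontr)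
      assume "\<not> ?thesis"
      then have "N Y \<le> N {x. p dvd x - y}" by (intro N_mono) auto
      then show False using False N_residue by simp
    qed
    then obtain y' where y': "y' \<in> Y" "\<not> p dvd y' - y" by auto
    \<comment> \<open>As \<open>X\<close> is not invariant under \<open>y' - y\<close>, some shift
      \<open>x - y\<close> keeps \<open>y\<close> in the new \<open>Y\<close> and expels
      \<open>y'\<close>.\<close>
    have "\<exists>x\<in>X. x + (y' - y) \<notin> X"
      using invariant_UNIV[OF pX neX y'(2)] False by auto
    then obtain x where x: "x \<in> X" "x + (y' - y) \<notin> X" by auto
    define e where "e = x - y"
    define Y1 where "Y1 = Y \<inter> {z. z + e \<in> X}"
    define X1 where "X1 = X \<union> {z. z - e \<in> Y}"
    have per1: "per Y1" "per X1"
      unfolding Y1_def X1_def using periodic_shift[OF pX, of e] periodic_shift[OF pY, of "- e"] pX pY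
      by (auto intro: periodic_Int periodic_Un)
    have yY1: "y \<in> Y1" using x y by (auto simp: Y1_def e_def)
    have "y' \<notin> Y1" using x by (auto simp: Y1_def e_def algebra_simps)
    then have "Y1 \<noteq> Y" using y' by auto
    then have lt: "N Y1 < N Y" using N_subset_eq[OF per1(1) pY] by (auto simp: Y1_def)
    have "N {z. z - e \<in> Y \<inter> {z. z + e \<in> X}} = N Y1"
      using N_shift[OF per1(1), of "- e"] by (simp add: Y1_def)
    moreover have "{z. z - e \<in> Y \<inter> {z. z + e \<in> X}} = X \<inter> {z. z - e \<in> Y}" by auto
    moreover have "N {z. z - e \<in> Y} = N Y" using N_shift[OF pY, of "- e"] by simp
    ultimately have sum: "N X1 + N Y1 = N X + N Y"
      using N_Un_Int[of X "{z. z - e \<in> Y}"] by (simp add: X1_def)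
    have "X1 + Y1 \<subseteq> X + Y"
    proof
      fix z assume "z \<in> X1 + Y1"
      then obtain a b where ab: "a \<in> X1" "b \<in> Y1" "z = a + b" by (auto simp: set_plus_def)
      show "z \<in> X + Y"
      proof (cases "a \<in> X")
        case True
        then show ?thesis using ab by (auto simp: Y1_def)
      next
        case False
        then have "a - e \<in> Y" "b + e \<in> X" using ab by (auto simp: X1_def Y1_def)
        then have "(b + e) + (a - e) \<in> X + Y" by (rule set_plus_intro[rotated])
        then show ?thesis using ab by (simp add: algebra_simps)
      qed
    qed
    then have "N (X1 + Y1) \<le> N (X + Y)" by (rule N_mono)
    moreover have "N (X1 + Y1) \<ge> min p (N X1 + N Y1 - 1)"
      using lt N_nonneg[of Y1] per1 neX yY1 by (intro less.hyps) (auto simp: X1_def)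
    ultimately show ?thesis using sum by simp
  qed
qed

text \<open>Four uses of \<open>Cauchy_Davenport\<close> cost 4, and a periodic sumset that omits 0
  has at most p - 1 classes; together p + 3.\<close>

lemma sum_five_bound:
  assumes "per X1" "per X2" "per X3" "per X4" "per X5"
    "X1 \<noteq> {}" "X2 \<noteq> {}" "X3 \<noteq> {}" "X4 \<noteq> {}" "X5 \<noteq> {}"
    and "0 \<notin> X1 + X2 + X3 + X4 + X5"
  shows "N X1 + N X2 + N X3 + N X4 + N X5 \<le> p + 3"
proof -
  have ne: "A + B \<noteq> {}" if "A \<noteq> {}" "B \<noteq> {}" for A B :: "int set"
    using that by (auto simp: set_plus_def)
  have pos: "N X1 \<ge> 1" "N X2 \<ge> 1" "N X3 \<ge> 1" "N X4 \<ge> 1" "N X5 \<ge> 1"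
    using assms by (auto intro: N_pos)
  have "N (X1 + X2) \<ge> min p (N X1 + N X2 - 1)"
    using assms by (intro Cauchy_Davenport)
  moreover have "N (X1 + X2 + X3) \<ge> min p (N (X1 + X2) + N X3 - 1)"
    using assms by (intro Cauchy_Davenport ne periodic_plus1)
  moreover have "N (X1 + X2 + X3 + X4) \<ge> min p (N (X1 + X2 + X3) + N X4 - 1)"
    using assms by (intro Cauchy_Davenport ne periodic_plus1)
  moreover have "N (X1 + X2 + X3 + X4 + X5) \<ge> min p (N (X1 + X2 + X3 + X4) + N X5 - 1)"
    using assms by (intro Cauchy_Davenport ne periodic_plus1)
  moreover have "N (X1 + X2 + X3 + X4 + X5) \<noteq> p"
    using N_eq_p[of "X1 + X2 + X3 + X4 + X5"] assms(1,11) by (metis UNIV_I order_refl periodic_plus1)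
  ultimately show ?thesis using N_le[of "X1 + X2 + X3 + X4 + X5"] pos by linarith
qed

section \<open>Arithmetic progressions modulo p and Vosper's theorem\<close>

definition is_AP :: "int \<Rightarrow> int \<Rightarrow> int set \<Rightarrow> bool" where
  "is_AP d k X \<longleftrightarrow> \<not> p dvd d \<and> (\<exists>a. X = {x. \<exists>i\<in>{0..<k}. p dvd x - (a + i * d)})"

lemma unit_inverse:
  assumes "\<not> p dvd d"
  obtains e where "p dvd d * e - 1" "\<not> p dvd e"
proof -
  have "coprime d p" using prime_imp_coprime[OF prime assms] by (simp add: ac_simps)
  then obtain e where e: "[d * e = 1] (mod p)" using cong_solve_coprime_int by blast
  then have dv: "p dvd d * e - 1" by (simp add: cong_iff_dvd_diff)
  moreover have "\<not> p dvd e"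
  proof
    assume "p dvd e"
    then have "p dvd d * e - (d * e - 1)" using dv by (meson dvd_diff dvd_mult)
    then show False using p_gt_1 by simp
  qed
  ultimately show ?thesis using that by blast
qed

lemma periodic_dilate: "per X \<Longrightarrow> per {x. d * x \<in> X}"
proof (rule periodicI)
  fix x k assume "per X" "x \<in> {x. d * x \<in> X}"
  then show "x + k * p \<in> {x. d * x \<in> X}"
    using periodic_add_mult[of p X "d * x" "d * k"] by (simp add: algebra_simps)
qed

lemma dvd_diff_mult: "p dvd d * e - 1 \<Longrightarrow> p dvd d * (e * x) - x"
  by (rule dvd_lincomb[of p "d * e - 1" "0" _ x 0 0]) (simp_all add: algebra_simps)

lemma N_dilate: assumes "per X" "\<not> p dvd d" shows "N {x. d * x \<in> X} = N X"
proof -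
  obtain e where e: "p dvd d * e - 1" using unit_inverse[OF assms(2)] .
  then have e': "p dvd e * d - 1" by (simp add: mult.commute)
  show ?thesis
  proof (rule N_bij[where f = "\<lambda>x. d * x" and g = "\<lambda>x. e * x"])
    show "per {x. d * x \<in> X}" by (rule periodic_dilate) fact
    show "e * y \<in> {x. d * x \<in> X}" if "y \<in> X" for y
      using periodic_cong[OF assms(1) dvd_diff_mult[OF e]] that by simp
    show "p dvd e * (d * x) - x" for x using dvd_diff_mult[OF e'] .
    show "p dvd d * (e * x) - x" for x using dvd_diff_mult[OF e] .
    show "p dvd d * x - d * y" if "p dvd x - y" for x y
      by (rule dvd_lincomb[OF that dvd_0_right, of _ d 0 0]) (simp add: algebra_simps)
    show "p dvd e * x - e * y" if "p dvd x - y" for x y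
      by (rule dvd_lincomb[OF that dvd_0_right, of _ e 0 0]) (simp add: algebra_simps)
  qed (use assms in auto)
qed

lemma AP_periodic: "is_AP d k X \<Longrightarrow> per X"
proof -
  assume "is_AP d k X"
  then obtain a where X: "X = {x. \<exists>i\<in>{0..<k}. p dvd x - (a + i * d)}" by (auto simp: is_AP_def)
  show ?thesis
  proof (rule periodicI)
    fix x j assume "x \<in> X"
    then obtain i where i: "i \<in> {0..<k}" "p dvd x - (a + i * d)" using X by auto
    then have "p dvd (x - (a + i * d)) + j * p" by simp
    then have "p dvd (x + j * p) - (a + i * d)" by (simp add: algebra_simps)
    then show "x + j * p \<in> X" using X i by blast
  qed
qed

text \<open>Division by the unit \<open>d\<close> turns difference \<open>d\<close> into difference
  1, so critical pairs need to be studied for intervals only.\<close>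

lemma AP_dilate_iff:
  assumes X: "per X" and d: "\<not> p dvd d"
  shows "is_AP 1 k {x. d * x \<in> X} \<longleftrightarrow> is_AP d k X"
proof
  obtain e where e: "p dvd d * e - 1" using unit_inverse[OF d] .
  have inj: "p dvd x - y" if "p dvd d * x - d * y" for x y
  proof -
    have "p dvd d * (x - y)" using that by (simp add: right_diff_distrib)
    then show ?thesis using d prime prime_dvd_mult_iff by blast
  qed
  assume "is_AP 1 k {x. d * x \<in> X}"
  then obtain a where a: "{x. d * x \<in> X} = {x. \<exists>i\<in>{0..<k}. p dvd x - (a + i)}"
    by (auto simp: is_AP_def)
  have "x \<in> X \<longleftrightarrow> (\<exists>i\<in>{0..<k}. p dvd x - (d * a + i * d))" for x
  proof -
    have "x \<in> X \<longleftrightarrow> d * (e * x) \<in> X" using periodic_cong[OF X dvd_diff_mult[OF e]] by simp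
    also have "\<dots> \<longleftrightarrow> (\<exists>i\<in>{0..<k}. p dvd e * x - (a + i))" using a by blast
    also have "\<dots> \<longleftrightarrow> (\<exists>i\<in>{0..<k}. p dvd x - (d * a + i * d))"
    proof (intro bex_cong refl)
      fix i
      have 1: "p dvd d * (e * x) - x" using dvd_diff_mult[OF e] .
      show "p dvd e * x - (a + i) \<longleftrightarrow> p dvd x - (d * a + i * d)"
      proof
        assume "p dvd e * x - (a + i)"
        then show "p dvd x - (d * a + i * d)"
          by (rule dvd_lincomb[OF _ 1, of _ _ d "-1" 0]) (simp add: algebra_simps)
      next
        assume "p dvd x - (d * a + i * d)"
        then have "p dvd d * (e * x) - d * (a + i)"
          by (rule dvd_lincomb[OF _ 1, of _ _ 1 1 0]) (simp add: algebra_simps)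
        then show "p dvd e * x - (a + i)" by (rule inj)
      qed
    qed
    finally show ?thesis .
  qed
  then show "is_AP d k X" using d unfolding is_AP_def by blast
next
  obtain e where e: "p dvd d * e - 1" using unit_inverse[OF d] .
  assume "is_AP d k X"
  then obtain a where a: "X = {x. \<exists>i\<in>{0..<k}. p dvd x - (a + i * d)}" by (auto simp: is_AP_def)
  have "d * x \<in> X \<longleftrightarrow> (\<exists>i\<in>{0..<k}. p dvd x - (e * a + i * 1))" for x
  proof -
    have "p dvd d * x - (a + i * d) \<longleftrightarrow> p dvd x - (e * a + i * 1)" for i
    proof -
      have 1: "p dvd d * (e * a) - a" using dvd_diff_mult[OF e] .
      have "p dvd d * x - (a + i * d) \<longleftrightarrow> p dvd d * (x - (e * a + i * 1))"
      proof
        assume "p dvd d * x - (a + i * d)"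
        then show "p dvd d * (x - (e * a + i * 1))"
          by (rule dvd_lincomb[OF _ 1, of _ _ 1 "-1" 0]) (simp add: algebra_simps)
      next
        assume "p dvd d * (x - (e * a + i * 1))"
        then show "p dvd d * x - (a + i * d)"
          by (rule dvd_lincomb[OF _ 1, of _ _ 1 1 0]) (simp add: algebra_simps)
      qed
      then show ?thesis using d prime prime_dvd_mult_iff by blast
    qed
    then show ?thesis using a by blast
  qed
  moreover have "\<not> p dvd 1" using p_gt_1 by simp
  ultimately show "is_AP 1 k {x. d * x \<in> X}" unfolding is_AP_def by blast
qed

lemma interval_eq: "{x. \<exists>i\<in>{0..<k}. p dvd x - (a + i * 1)} = {x. p dvd x - a} + {0..<k}"
proof (intro Set.set_eqI iffI)
  fix x assume "x \<in> {x. \<exists>i\<in>{0..<k}. p dvd x - (a + i * 1)}"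
  then obtain i where i: "i \<in> {0..<k}" "p dvd (x - i) - a" by (auto simp: algebra_simps)
  then show "x \<in> {x. p dvd x - a} + {0..<k}"
    using set_plus_intro[of "x - i" "{x. p dvd x - a}" i "{0..<k}"] by simp
next
  fix x assume "x \<in> {x. p dvd x - a} + {0..<k}"
  then obtain y i where i: "i \<in> {0..<k}" "p dvd y - a" "x = y + i" by (auto simp: set_plus_def)
  then have "p dvd x - (a + i * 1)" by (simp add: algebra_simps)
  then show "x \<in> {x. \<exists>i\<in>{0..<k}. p dvd x - (a + i * 1)}" using i by blast
qed

text \<open>The elements of \<open>Y\<close> whose successor is not in \<open>Y\<close> are counted by \<open>N (Y + {0, 1}) - N Y\<close>; a single
  such residue class makes \<open>Y\<close> an interval.\<close>

lemma interval_summand: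
  assumes X: "is_AP 1 k X" "k \<ge> 2" and Y: "per Y" "Y \<noteq> {}"
    and le: "N (X + Y) \<le> k + N Y - 1" and lt: "k + N Y - 1 < p"
  shows "is_AP 1 (N Y) Y"
proof -
  obtain a where "X = {x. \<exists>i\<in>{0..<k}. p dvd x - (a + i * 1)}"
    using X(1) unfolding is_AP_def by blast
  then have a: "X = {x. p dvd x - a} + {0..<k}" unfolding interval_eq .
  define E where "E = {y. y \<in> Y \<and> y + 1 \<notin> Y}"
  have perE: "per E"
  proof -
    have "E = Y \<inter> (- {y. y + 1 \<in> Y})" by (auto simp: E_def)
    then show ?thesis by (simp only:) (intro periodic_Int periodic_Compl periodic_shift Y(1))
  qed
  define Z where "Z = Y \<union> {y. y - 1 \<in> Y}"
  have perZ: "per Z" using Y periodic_shift[of p Y "-1"] by (auto simp: Z_def intro: periodic_Un)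
  have NZ: "N Z = N Y + N E"
  proof -
    have "Z = Y \<union> {y. y - 1 \<in> E}" by (auto simp: Z_def E_def)
    moreover have "Y \<inter> {y. y - 1 \<in> E} = {}" by (auto simp: E_def)
    moreover have "N {y. y - 1 \<in> E} = N E" using N_shift[OF perE, of "-1"] by simp
    ultimately show ?thesis using N_disjoint[of Y "{y. y - 1 \<in> E}"] by simp
  qed
  \<comment> \<open>\<open>I\<close> is \<open>X\<close> without its last term. So
    \<open>I + {0, 1}\<close> stays inside \<open>X\<close>, \<open>I + Z\<close> stays inside
    \<open>X + Y\<close>, and Cauchy-Davenport for \<open>I + Z\<close> leaves room for at most one
    class in \<open>E\<close>.\<close>
  define I where "I = {x. p dvd x - a} + {0..<k - 1}"
  have perI: "per I" unfolding I_def by (intro periodic_plus1 periodic_residue)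
  have "a \<in> I" using set_plus_intro[of a "{x. p dvd x - a}" 0 "{0..<k-1}"] X(2) by (simp add: I_def)
  have card_int: "N ({x. p dvd x - a} + {0..<j}) \<ge> j" if "1 \<le> j" "j \<le> p" for j
  proof -
    have "(\<lambda>i. (a + i) mod p) ` {0..<j} \<subseteq> ({x. p dvd x - a} + {0..<j}) \<inter> {0..<p}"
    proof
      fix z assume "z \<in> (\<lambda>i. (a + i) mod p) ` {0..<j}"
      then obtain i where i: "i \<in> {0..<j}" "z = (a + i) mod p" by auto
      have "p dvd z - (a + i)" unfolding i(2) by (rule dvd_mod_diff)
      then have "p dvd (z - i) - a" by (simp add: algebra_simps)
      then have "(z - i) + i \<in> {x. p dvd x - a} + {0..<j}" using i by (intro set_plus_intro) auto
      then show "z \<in> ({x. p dvd x - a} + {0..<j}) \<inter> {0..<p}" using i p_pos by simp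
    qed
    then have "card ((\<lambda>i. (a + i) mod p) ` {0..<j}) \<le> card (({x. p dvd x - a} + {0..<j}) \<inter> {0..<p})"
      by (intro card_mono) auto
    moreover have "inj_on (\<lambda>i. (a + i) mod p) {0..<j}"
    proof (rule inj_onI)
      fix x y assume xy: "x \<in> {0..<j}" "y \<in> {0..<j}" "(a + x) mod p = (a + y) mod p"
      then have "p dvd x - y" by (simp add: mod_eq_dvd_iff)
      moreover have "\<bar>x - y\<bar> < p" using xy that by auto
      ultimately show "x = y" using dvd_imp_le_int[of "x - y" p] p_pos by auto
    qed
    ultimately show ?thesis using that unfolding rcard_def by (simp add: card_image)
  qed
  have NYpos: "N Y \<ge> 1" using N_pos Y by blast
  have XY: "I + Z \<subseteq> X + Y"
  proof
    fix z assume "z \<in> I + Z"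
    then obtain u i y where u: "p dvd u - a" "i \<in> {0..<k-1}" "y \<in> Z" "z = u + i + y"
      by (auto simp: I_def set_plus_def)
    show "z \<in> X + Y"
    proof (cases "y \<in> Y")
      case True
      have "u + i \<in> X" unfolding a using u by (intro set_plus_intro) auto
      then show ?thesis using True u by (auto intro: set_plus_intro)
    next
      case False
      then have "y - 1 \<in> Y" using u by (auto simp: Z_def)
      moreover have "u + (i + 1) \<in> X" unfolding a using u by (intro set_plus_intro) auto
      ultimately have "(u + (i + 1)) + (y - 1) \<in> X + Y" by (intro set_plus_intro)
      then show ?thesis using u by (simp add: algebra_simps)
    qed
  qed
  have "N (I + Z) \<ge> min p (N I + N Z - 1)"
    using perI perZ \<open>a \<in> I\<close> Y by (intro Cauchy_Davenport) (auto simp: Z_def)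
  moreover have "N I \<ge> k - 1" unfolding I_def using X(2) lt NYpos by (intro card_int) auto
  ultimately have "N E \<le> 1" using N_mono[OF XY] le lt NZ by linarith
  have "Y \<noteq> UNIV" using lt X(2) N_UNIV by auto
  have "E \<noteq> {}"
  proof
    assume "E = {}"
    then have "\<And>x. x \<in> Y \<Longrightarrow> x + 1 \<in> Y" by (auto simp: E_def)
    then have "Y = UNIV" using invariant_UNIV[of Y 1] Y p_gt_1 by auto
    then show False using \<open>Y \<noteq> UNIV\<close> by simp
  qed
  then obtain y where y: "y \<in> Y" "y + 1 \<notin> Y" by (auto simp: E_def)
  have uniq: "p dvd z - y" if "z \<in> E" for z
  proof -
    have sub: "{x. p dvd x - y} \<subseteq> E"
      using periodic_cong[OF perE] y unfolding E_def by blast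
    have "E = {x. p dvd x - y}"
      using N_subset_eq[OF periodic_residue perE sub] N_residue[of y] \<open>N E \<le> 1\<close> by simp
    then show ?thesis using that by blast
  qed
  have "\<exists>j. y - int j \<notin> Y"
  proof (rule ccontr)
    assume "\<not> ?thesis"
    then have all: "y - int j \<in> Y" for j by auto
    have "Y = UNIV"
    proof -
      have "z \<in> Y" for z
      proof -
        have "y - int (nat ((y - z) mod p)) \<in> Y" by (rule all)
        moreover have "(y - (y - z) mod p) - z = -((y - z) mod p - (y - z))" by simp
        then have "p dvd (y - (y - z) mod p) - z" by (simp only: dvd_minus_iff dvd_mod_diff)
        ultimately show ?thesis using periodic_cong[OF Y(1)] p_pos by auto
      qed
      then show ?thesis by auto
    qed
    then show False using \<open>Y \<noteq> UNIV\<close> by simp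
  qed
  \<comment> \<open>Going down from the only right end \<open>y\<close>, the first gap is at
    \<open>y - j\<close>; so \<open>Y\<close> has to be the interval of \<open>j\<close> classes
    that ends at \<open>y\<close>.\<close>
  then obtain j where j: "y - int j \<notin> Y" "\<And>i. i < j \<Longrightarrow> y - int i \<in> Y"
    using exists_least_iff[of "\<lambda>j. y - int j \<notin> Y"] by auto
  have "Y = {x. \<exists>i\<in>{0..<int j}. p dvd x - ((y - int j + 1) + i * 1)}" (is "_ = ?R")
  proof (intro Set.set_eqI iffI)
    fix x assume "x \<in> ?R"
    then obtain i where i: "i \<in> {0..<int j}" "p dvd x - ((y - int j + 1) + i * 1)" by blast
    have "y - int (nat (int j - 1 - i)) \<in> Y" using i by (intro j) auto
    then have "(y - int j + 1) + i * 1 \<in> Y" using i by (simp add: algebra_simps)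
    then show "x \<in> Y" using periodic_cong[OF Y(1) i(2)] by blast
  next
    fix x assume x: "x \<in> Y"
    define r where "r = (y - x) mod p"
    have r: "0 \<le> r" "r < p" using p_pos by (auto simp: r_def)
    have "p dvd r - (y - x)" unfolding r_def by (rule dvd_mod_diff)
    then have dv: "p dvd (y - r) - x"
    proof -
      have "(y - r) - x = - (r - (y - x))" by simp
      then show ?thesis using \<open>p dvd r - (y - x)\<close> by (simp only: dvd_minus_iff)
    qed
    then have yr: "y - r \<in> Y" using periodic_cong[OF Y(1)] x by blast
    have "r < int j"
    proof (rule ccontr)
      assume "\<not> r < int j"
      with j(1) yr have rj: "r > int j" by (metis linorder_neqE_linordered_idom)
      \<comment> \<open>An element \<open>y - r\<close> below the gap would start a run in
        \<open>Y\<close> that ends before \<open>y - j\<close>. The last element of this run lies in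
        \<open>E\<close>, but is too close to \<open>y\<close> to be congruent to it.\<close>
      have "\<exists>i. y - r + int i \<notin> Y \<and> i \<le> nat (r - int j)"
        using j(1) rj by (intro exI[of _ "nat (r - int j)"]) auto
      then obtain i where i: "y - r + int i \<notin> Y" "i \<le> nat (r - int j)"
        "\<And>i'. i' < i \<Longrightarrow> \<not> (y - r + int i' \<notin> Y \<and> i' \<le> nat (r - int j))"
        using exists_least_iff[of "\<lambda>i. y - r + int i \<notin> Y \<and> i \<le> nat (r - int j)"] by auto
      have "i \<noteq> 0" using i(1) yr by (intro notI) simp
      then have "y - r + int (i - 1) \<in> E"
      proof -
        have "y - r + int (i - 1) \<in> Y" using \<open>i \<noteq> 0\<close> i(2) i(3)[of "i - 1"] by auto
        moreover have "y - r + int (i - 1) + 1 = y - r + int i" using \<open>i \<noteq> 0\<close> by (simp add: of_nat_diff)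
        ultimately show ?thesis using i(1) unfolding E_def mem_Collect_eq by (simp only:) blast
      qed
      then have "p dvd (y - r + int (i - 1)) - y" by (rule uniq)
      then have "p dvd r - int (i - 1)"
        by (rule dvd_lincomb[OF _ dvd_0_right, of _ _ _ "-1" 0 0]) simp
      moreover have "0 < r - int (i - 1)" "r - int (i - 1) < p" using i(2) rj r by auto
      ultimately show False by (meson zdvd_not_zless)
    qed
    moreover have "p dvd x - ((y - int j + 1) + (int j - 1 - r) * 1)"
    proof -
      have "x - ((y - int j + 1) + (int j - 1 - r) * 1) = - ((y - r) - x)" by simp
      then show ?thesis using dv by (simp only: dvd_minus_iff)
    qed
    ultimately show "x \<in> ?R" using r by (intro CollectI bexI[of _ "int j - 1 - r"]) auto
  qed
  moreover have "N Y = int j"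
  proof -
    have j0: "j \<noteq> 0" using j(1) y by (intro notI) simp
    have Yeq: "Y = {x. p dvd x - (y - int j + 1)} + {0..<int j}"
      using calculation unfolding interval_eq .
    have jle: "int j \<le> N Y"
    proof (cases "int j \<le> p")
      case True
      have "card ((\<lambda>i. (y - int i) mod p) ` {0..<j}) \<le> card (Y \<inter> {0..<p})"
        using j(2) periodic_mod[OF Y(1)] p_pos by (intro card_mono) auto
      moreover have "inj_on (\<lambda>i. (y - int i) mod p) {0..<j}"
      proof (rule inj_onI)
        fix u v assume uv: "u \<in> {0..<j}" "v \<in> {0..<j}" "(y - int u) mod p = (y - int v) mod p"
        then have "p dvd int v - int u" by (simp add: mod_eq_dvd_iff)
        moreover have "\<bar>int v - int u\<bar> < p" using uv True by auto
        ultimately show "u = v" using dvd_imp_le_int[of "int v - int u" p] p_pos by auto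
      qed
      ultimately show ?thesis by (simp add: rcard_def card_image)
    next
      case False
      have "Y = UNIV"
      proof -
        have "z \<in> Y" for z
        proof -
          have "y - int (nat ((y - z) mod p)) \<in> Y"
            using False p_pos pos_mod_bound[of p "y - z"] by (intro j) linarith
          moreover have "(y - (y - z) mod p) - z = -((y - z) mod p - (y - z))" by simp
          then have "p dvd (y - (y - z) mod p) - z" by (simp only: dvd_minus_iff dvd_mod_diff)
          ultimately show ?thesis using periodic_cong[OF Y(1)] p_pos by auto
        qed
        then show ?thesis by auto
      qed
      then show ?thesis using \<open>Y \<noteq> UNIV\<close> by simp
    qed
    have "Y \<inter> {0..<p} \<subseteq> (\<lambda>i. (y - int i) mod p) ` {0..<j}"
    proof
      fix x assume x: "x \<in> Y \<inter> {0..<p}"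
      then obtain i where i: "i \<in> {0..<int j}" "p dvd x - ((y - int j + 1) + i * 1)"
        using calculation by blast
      then have "p dvd x - (y - int (nat (int j - 1 - i)))" by (simp add: algebra_simps)
      then have "x mod p = (y - int (nat (int j - 1 - i))) mod p" by (simp only: mod_eq_dvd_iff)
      then have "x = (y - int (nat (int j - 1 - i))) mod p" using x by simp
      then show "x \<in> (\<lambda>i. (y - int i) mod p) ` {0..<j}"
        using i by (intro image_eqI[of _ _ "nat (int j - 1 - i)"]) (simp_all only: atLeastLessThan_iff, linarith)
    qed
    then have "card (Y \<inter> {0..<p}) \<le> card ((\<lambda>i. (y - int i) mod p) ` {0..<j})" by (intro card_mono) auto
    also have "\<dots> \<le> j" using card_image_le[of "{0..<j}"] by simp
    finally show ?thesis using jle by (simp add: rcard_def)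
  qed
  ultimately show ?thesis using p_gt_1 unfolding is_AP_def by auto
qed

lemma dilate_plus:
  assumes "per X" "per Y" "\<not> p dvd d"
  shows "{x. d * x \<in> X} + {x. d * x \<in> Y} = {x. d * x \<in> X + Y}"
proof (intro Set.set_eqI iffI)
  fix z assume "z \<in> {x. d * x \<in> X} + {x. d * x \<in> Y}"
  then obtain a b where "d * a \<in> X" "d * b \<in> Y" "z = a + b" by (auto simp: set_plus_def)
  then show "z \<in> {x. d * x \<in> X + Y}" using set_plus_intro[of "d * a" X "d * b" Y] by (simp add: distrib_left)
next
  obtain e where e: "p dvd d * e - 1" using unit_inverse[OF assms(3)] .
  fix z assume "z \<in> {x. d * x \<in> X + Y}"
  then obtain x y where xy: "x \<in> X" "y \<in> Y" "d * z = x + y" by (auto simp: set_plus_def)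
  have "d * (e * x) \<in> X" using periodic_cong[OF assms(1) dvd_diff_mult[OF e]] xy by blast
  moreover have "d * (z - e * x) \<in> Y"
  proof -
    have "p dvd - (d * (e * x) - x)" using dvd_diff_mult[OF e] by (simp only: dvd_minus_iff)
    then have "p dvd d * (z - e * x) - y" using xy(3) by (simp add: algebra_simps)
    then show ?thesis using periodic_cong[OF assms(2)] xy by blast
  qed
  ultimately show "z \<in> {x. d * x \<in> X} + {x. d * x \<in> Y}"
    using set_plus_intro[of "e * x" "{x. d * x \<in> X}" "z - e * x" "{x. d * x \<in> Y}"] by simp
qed

lemma AP_summand:
  assumes X: "is_AP d k X" "k \<ge> 2" and Y: "per Y" "Y \<noteq> {}"
    and le: "N (X + Y) \<le> k + N Y - 1" and lt: "k + N Y - 1 < p"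
  shows "is_AP d (N Y) Y"
proof -
  have d: "\<not> p dvd d" using X by (simp add: is_AP_def)
  have pX: "per X" using AP_periodic X by blast
  have ne: "{x. d * x \<in> Y} \<noteq> {}"
  proof
    assume "{x. d * x \<in> Y} = {}"
    then show False using N_dilate[OF Y(1) d] N_pos[OF Y] N_empty by simp
  qed
  have "is_AP 1 (N {x. d * x \<in> Y}) {x. d * x \<in> Y}"
  proof (rule interval_summand)
    show "is_AP 1 k {x. d * x \<in> X}" using AP_dilate_iff[OF pX d] X by simp
    show "N ({x. d * x \<in> X} + {x. d * x \<in> Y}) \<le> k + N {x. d * x \<in> Y} - 1"
      using le dilate_plus[OF pX Y(1) d] N_dilate[OF periodic_plus1[OF pX] d] N_dilate[OF Y(1) d] by simp
  qed (use X ne lt N_dilate[OF Y(1) d] periodic_dilate[OF Y(1)] in auto)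
  then show ?thesis using AP_dilate_iff[OF Y(1) d] N_dilate[OF Y(1) d] by simp
qed

lemma AP_uminus: "is_AP d k X \<Longrightarrow> is_AP d k (uminus ` X)"
proof -
  assume "is_AP d k X"
  then obtain a where d: "\<not> p dvd d" and X: "X = {x. \<exists>i\<in>{0..<k}. p dvd x - (a + i * d)}"
    by (auto simp: is_AP_def)
  have key: "p dvd (- x) - ((- a - (k - 1) * d) + (k - 1 - i) * d)" if "p dvd x - (a + i * d)" for x i
  proof -
    have "(- x) - ((- a - (k - 1) * d) + (k - 1 - i) * d) = - (x - (a + i * d))"
      by (simp add: algebra_simps)
    then show ?thesis using that by (simp only: dvd_minus_iff)
  qed
  have key2: "p dvd (- x) - (a + (k - 1 - i) * d)" if "p dvd x - ((- a - (k - 1) * d) + i * d)" for x i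
  proof -
    have "(- x) - (a + (k - 1 - i) * d) = - (x - ((- a - (k - 1) * d) + i * d))"
      by (simp add: algebra_simps)
    then show ?thesis using that by (simp only: dvd_minus_iff)
  qed
  have "uminus ` X = {x. \<exists>i\<in>{0..<k}. p dvd x - ((- a - (k - 1) * d) + i * d)}"
  proof (intro Set.set_eqI iffI)
    fix z assume "z \<in> uminus ` X"
    then obtain x i where "z = - x" "i \<in> {0..<k}" "p dvd x - (a + i * d)" using X by auto
    then show "z \<in> {x. \<exists>i\<in>{0..<k}. p dvd x - ((- a - (k - 1) * d) + i * d)}"
      using key[of x i] by (intro CollectI bexI[of _ "k - 1 - i"]) auto
  next
    fix z assume "z \<in> {x. \<exists>i\<in>{0..<k}. p dvd x - ((- a - (k - 1) * d) + i * d)}"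
    then obtain i where "i \<in> {0..<k}" "p dvd z - ((- a - (k - 1) * d) + i * d)" by blast
    then have "- z \<in> X" unfolding X using key2[of z i] by (intro CollectI bexI[of _ "k - 1 - i"]) auto
    then show "z \<in> uminus ` X" by (metis image_eqI minus_minus)
  qed
  then show ?thesis using d by (auto simp: is_AP_def)
qed

lemma AP_plus:
  assumes "is_AP d k X" "is_AP d l Y" "k \<ge> 1" "l \<ge> 1"
  shows "is_AP d (k + l - 1) (X + Y)"
proof -
  obtain a where X: "X = {x. \<exists>i\<in>{0..<k}. p dvd x - (a + i * d)}" using assms(1) by (auto simp: is_AP_def)
  obtain b where Y: "Y = {x. \<exists>i\<in>{0..<l}. p dvd x - (b + i * d)}" using assms(2) by (auto simp: is_AP_def)
  have "X + Y = {x. \<exists>i\<in>{0..<k + l - 1}. p dvd x - ((a + b) + i * d)}"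
  proof (intro Set.set_eqI iffI)
    fix z assume "z \<in> X + Y"
    then obtain x y where "x \<in> X" "y \<in> Y" "z = x + y" by (auto simp: set_plus_def)
    then obtain i j where ij: "i \<in> {0..<k}" "j \<in> {0..<l}"
      "p dvd x - (a + i * d)" "p dvd y - (b + j * d)" using X Y by auto
    have "p dvd z - ((a + b) + (i + j) * d)"
      by (rule dvd_lincomb[OF ij(3,4), of _ 1 1 0]) (simp add: \<open>z = x + y\<close> algebra_simps)
    then show "z \<in> {x. \<exists>i\<in>{0..<k + l - 1}. p dvd x - ((a + b) + i * d)}"
      using ij by (intro CollectI bexI[of _ "i + j"]) auto
  next
    fix z assume "z \<in> {x. \<exists>i\<in>{0..<k + l - 1}. p dvd x - ((a + b) + i * d)}"
    then obtain i where i: "i \<in> {0..<k + l - 1}" "p dvd z - ((a + b) + i * d)" by auto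
    define j where "j = min i (k - 1)"
    have j: "j \<in> {0..<k}" "i - j \<in> {0..<l}" using i assms by (auto simp: j_def)
    have "a + j * d \<in> X" unfolding X using j by (intro CollectI bexI[of _ j]) auto
    moreover have "z - (a + j * d) \<in> Y" unfolding Y
    proof (intro CollectI bexI[of _ "i - j"])
      show "p dvd z - (a + j * d) - (b + (i - j) * d)" using i(2) by (simp add: algebra_simps)
    qed (use j in auto)
    ultimately show "z \<in> X + Y" using set_plus_intro[of "a + j * d" X "z - (a + j * d)" Y] by simp
  qed
  then show ?thesis using assms(1) by (auto simp: is_AP_def)
qed

text \<open>Steps of a unit \<open>d\<close> run through all \<open>p\<close> classes before
  repeating, so the classes left over by the first \<open>k\<close> terms are the next
  \<open>p - k\<close> ones, starting at \<open>a + k * d\<close>.\<close>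

lemma AP_Compl:
  assumes "is_AP d k X" "0 \<le> k" "k \<le> p"
  shows "is_AP d (p - k) (- X)"
proof -
  have d: "\<not> p dvd d" and pX: "per X" using assms AP_periodic by (auto simp: is_AP_def)
  obtain a where X: "X = {x. \<exists>i\<in>{0..<k}. p dvd x - (a + i * d)}" using assms(1) by (auto simp: is_AP_def)
  obtain e where e: "p dvd d * e - 1" using unit_inverse[OF d] .
  have "- X = {x. \<exists>i\<in>{0..<p - k}. p dvd x - ((a + k * d) + i * d)}"
  proof (intro Set.set_eqI iffI)
    fix x assume x: "x \<in> - X"
    define r where "r = (e * (x - a)) mod p"
    have r: "0 \<le> r" "r < p" using p_pos by (auto simp: r_def)
    have "p dvd r - e * (x - a)" unfolding r_def by (rule dvd_mod_diff)
    then have *: "p dvd x - (a + r * d)"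
      by (rule dvd_lincomb[OF _ e, of _ _ "- d" "- (x - a)" 0]) (simp add: algebra_simps)
    have "\<not> r < k" using x * r X by auto
    then show "x \<in> {x. \<exists>i\<in>{0..<p - k}. p dvd x - ((a + k * d) + i * d)}"
      using * r by (intro CollectI bexI[of _ "r - k"]) (auto simp: algebra_simps)
  next
    fix x assume "x \<in> {x. \<exists>i\<in>{0..<p - k}. p dvd x - ((a + k * d) + i * d)}"
    then obtain i where i: "i \<in> {0..<p - k}" "p dvd x - ((a + k * d) + i * d)" by auto
    show "x \<in> - X"
    proof
      assume "x \<in> X"
      then obtain j where j: "j \<in> {0..<k}" "p dvd x - (a + j * d)" using X by auto
      have "p dvd (k + i - j) * d"
        by (rule dvd_lincomb[OF i(2) j(2), of _ "-1" 1 0]) (simp add: algebra_simps)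
      then have "p dvd k + i - j" using d prime prime_dvd_mult_iff by blast
      then show False using zdvd_not_zless[of "k + i - j" p] i(1) j(1) by auto
    qed
  qed
  then show ?thesis using d by (auto simp: is_AP_def)
qed

lemma AP_pair:
  assumes "y' \<in> Y" "y \<in> Y" "\<not> p dvd y' - y" "per Y" "N Y = 2"
  shows "is_AP (y' - y) 2 Y"
proof -
  define R where "R = {x. p dvd x - y} \<union> {x. p dvd x - y'}"
  have "{x. p dvd x - y} \<inter> {x. p dvd x - y'} = {}"
  proof -
    have False if "p dvd x - y" "p dvd x - y'" for x
      using assms(3) dvd_lincomb[OF that, of "y' - y" 1 "-1" 0] by simp
    then show ?thesis by auto
  qed
  then have "N R = 2" using N_disjoint[of "{x. p dvd x - y}"] N_residue by (simp add: R_def)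
  moreover have "per R" unfolding R_def by (intro periodic_Un periodic_residue)
  moreover have "R \<subseteq> Y" using assms periodic_cong[OF assms(4)] by (auto simp: R_def)
  ultimately have "R = Y" using N_subset_eq assms by simp
  moreover have "R = {x. \<exists>i\<in>{0..<2}. p dvd x - (y + i * (y' - y))}"
  proof -
    have "{0..<2::int} = {0, 1}" by auto
    then show ?thesis by (auto simp: R_def)
  qed
  ultimately show ?thesis using assms(3) by (auto simp: is_AP_def)
qed

text \<open>Passing from \<open>X + Y\<close> to its complement \<open>D\<close> turns the critical pair \<open>(X, Y)\<close> into \<open>(D, - Y)\<close>.\<close>

lemma Vosper_AP_sum:
  assumes X: "per X" "X \<noteq> {}" and Y: "per Y" "N Y \<ge> 2"
    and le: "N (X + Y) \<le> N X + N Y - 1" "N X + N Y - 1 \<le> p - 2"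
    and AP: "is_AP d (N X + N Y - 1) (X + Y)"
  shows "is_AP d (N X) X \<and> is_AP d (N Y) Y"
proof -
  have NX: "N X \<ge> 1" using N_pos X by blast
  define D where "D = - (X + Y)"
  have D: "is_AP d (p - (N X + N Y - 1)) D"
    unfolding D_def using AP le NX Y by (intro AP_Compl) auto
  have "N (X + Y) = N X + N Y - 1"
    using le N_UNIV Cauchy_Davenport[OF X(1) Y(1) X(2)] Y N_empty by fastforce
  then have ND: "N D = p - (N X + N Y - 1)" unfolding D_def by (simp add: N_Compl)
  have Yn: "per (uminus ` Y)" "uminus ` Y \<noteq> {}" using periodic_uminus Y N_empty by auto
  have "D + uminus ` Y \<subseteq> - X"
  proof
    fix z assume "z \<in> D + uminus ` Y"
    then obtain u y where u: "u \<in> D" "y \<in> Y" "z = u - y" by (auto simp: set_plus_def)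
    show "z \<in> - X"
    proof
      assume "z \<in> X"
      then have "u \<in> X + Y" using u set_plus_intro[of z X y Y] by simp
      then show False using u by (simp add: D_def)
    qed
  qed
  then have "N (D + uminus ` Y) \<le> p - N X" using N_mono N_Compl by metis
  then have "is_AP d (N (uminus ` Y)) (uminus ` Y)"
    using le NX ND N_uminus[OF Y(1)] by (intro AP_summand[OF D _ Yn]) auto
  then have "is_AP d (N Y) (uminus ` uminus ` Y)" using N_uminus[OF Y(1)] AP_uminus by simp
  then have APY: "is_AP d (N Y) Y" by (simp add: image_image)
  have "is_AP d (N X) X"
    using le Y by (intro AP_summand[OF APY _ X]) (auto simp: add.commute[of Y X])
  then show ?thesis using APY by simp
qed

text \<open>Induction by the transform of \<open>Cauchy_Davenport\<close>, now with the demand that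
  the new \<open>Y\<close> keeps at least two classes. Equality in Cauchy-Davenport shows that the
  transformed pair has the same sumset, so \<open>X + Y\<close> is a progression and
  \<open>Vosper_AP_sum\<close> descends to the summands. The base is \<open>N Y = 2\<close>, as two
  classes always form a progression.\<close>

theorem Vosper:
  assumes "per X" "per Y" "N X \<ge> 2" "N Y \<ge> 2"
    and "N (X + Y) \<le> N X + N Y - 1" "N X + N Y - 1 \<le> p - 2"
  shows "\<exists>d. is_AP d (N X) X \<and> is_AP d (N Y) Y"
  using assms
proof (induction "nat (N Y)" arbitrary: X Y rule: less_induct)
  case less
  note pX = less.prems(1) and pY = less.prems(2) and NX = less.prems(3) and NY = less.prems(4)
    and le = less.prems(5) and lt = less.prems(6)
  have neX: "X \<noteq> {}" and neY: "Y \<noteq> {}" using NX NY N_empty by auto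
  obtain y where y: "y \<in> Y" using neY by auto
  have "\<exists>y'\<in>Y. \<not> p dvd y' - y"
  proof (rule ccontr)
    assume "\<not> ?thesis"
    then have "N Y \<le> N {x. p dvd x - y}" by (intro N_mono) auto
    then show False using NY N_residue by simp
  qed
  then obtain y' where y': "y' \<in> Y" "\<not> p dvd y' - y" by auto
  show ?case
  proof (cases "N Y = 2")
    case True
    then have "is_AP (y' - y) 2 Y" using AP_pair y y' pY by blast
    moreover have "is_AP (y' - y) (N X) X"
      using le lt True by (intro AP_summand[OF calculation _ pX neX]) (auto simp: add.commute[of Y X])
    ultimately show ?thesis using True by auto
  next
    case False
    define Yx where "Yx x = Y \<inter> {z. z + (x - y) \<in> X}" for x
    have perYx: "per (Yx x)" for x unfolding Yx_def by (intro periodic_Int pY periodic_shift pX)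
    have "\<exists>x\<in>X. Yx x \<noteq> Y \<and> N (Yx x) \<ge> 2"
    proof (rule ccontr)
      assume "\<not> ?thesis"
      then have small: "Yx x = Y \<or> N (Yx x) \<le> 1" if "x \<in> X" for x using that by force
      \<comment> \<open>\<open>Z\<close> collects the shifts that cut \<open>Y\<close> down to the
        class of \<open>y\<close>. The other ones carry \<open>Y\<close> into \<open>X\<close>, so
        \<open>(X - Z) + Y\<close> is inside the translate \<open>X + y\<close>; unless
        \<open>Z = X\<close>, Cauchy-Davenport then gives \<open>N Z >= N Y - 1\<close>, which is at
        least 2.\<close>
      define Z where "Z = {x \<in> X. Yx x \<noteq> Y}"
      have Yx_cong: "Yx x = Yx x'" if "p dvd x - x'" for x x'
      proof -
        have "z + (x - y) \<in> X \<longleftrightarrow> z + (x' - y) \<in> X" for z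
          using that by (intro periodic_cong[OF pX]) (simp add: algebra_simps)
        then show ?thesis by (simp add: Yx_def)
      qed
      have perZ: "per Z"
      proof (rule periodicI)
        fix x k assume "x \<in> Z"
        then show "x + k * p \<in> Z"
          using periodic_add_mult[OF pX] Yx_cong[of "x + k * p" x] by (simp add: Z_def)
      qed
      have NZ: "N Z \<ge> 2"
      proof (cases "X - Z = {}")
        case True
        then have "Z = X" by (auto simp: Z_def)
        then show ?thesis using NX by simp
      next
        case ne: False
        have "(X - Z) + Y \<subseteq> {x. x - y \<in> X}"
        proof
          fix u assume "u \<in> (X - Z) + Y"
          then obtain x v where xv: "x \<in> X" "x \<notin> Z" "v \<in> Y" "u = x + v" by (auto simp: set_plus_def)
          then have "v \<in> Yx x" by (auto simp: Z_def)
          then have "v + (x - y) \<in> X" by (simp add: Yx_def)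
          then show "u \<in> {x. x - y \<in> X}" using xv by (simp add: algebra_simps)
        qed
        from N_mono[OF this] have "N ((X - Z) + Y) \<le> N X" using N_shift[OF pX, of "- y"] by simp
        moreover have "N ((X - Z) + Y) \<ge> min p (N (X - Z) + N Y - 1)"
          using ne neY pX pY perZ by (intro Cauchy_Davenport periodic_Diff)
        moreover have "N Z + N (X - Z) = N X"
        proof -
          have "N (Z \<union> (X - Z)) = N Z + N (X - Z)" by (rule N_disjoint) auto
          moreover have "Z \<union> (X - Z) = X" by (auto simp: Z_def)
          ultimately show ?thesis by simp
        qed
        ultimately show ?thesis using False NY lt by linarith
      qed
      \<comment> \<open>Sums of \<open>Z\<close> and the rest of \<open>Y\<close> avoid
        \<open>X + y\<close>, so they have to fit into the at most \<open>N Y - 1\<close> classes of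
        \<open>X + Y\<close> outside it. Cauchy-Davenport with \<open>N Z >= 2\<close> yields at
        least \<open>N Y\<close> of them.\<close>
      define Y0 where "Y0 = Y - {x. p dvd x - y}"
      have NY0: "N Y0 = N Y - 1"
      proof -
        have "N (Y0 \<union> {x. p dvd x - y}) = N Y0 + N {x. p dvd x - y}" by (rule N_disjoint) (auto simp: Y0_def)
        moreover have "Y0 \<union> {x. p dvd x - y} = Y" using y periodic_cong[OF pY] by (auto simp: Y0_def)
        ultimately show ?thesis using N_residue by simp
      qed
      have perY0: "per Y0" unfolding Y0_def by (intro periodic_Diff pY periodic_residue)
      have "Z + Y0 \<subseteq> (X + Y) - {x. x - y \<in> X}"
      proof
        fix u assume "u \<in> Z + Y0"
        then obtain x v where xv: "x \<in> Z" "v \<in> Y0" "u = x + v" by (auto simp: set_plus_def)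
        have "u - y \<notin> X"
        proof
          assume "u - y \<in> X"
          then have "v \<in> Yx x" using xv by (auto simp: Yx_def Y0_def algebra_simps)
          moreover have "y \<in> Yx x" using xv y by (auto simp: Yx_def Z_def)
          moreover have "N (Yx x) \<le> 1" using small xv by (auto simp: Z_def)
          moreover have "{x. p dvd x - y} = Yx x"
          proof (rule N_subset_eq[OF periodic_residue perYx])
            show "{x. p dvd x - y} \<subseteq> Yx x" using periodic_cong[OF perYx] calculation(2) by blast
          qed (use calculation N_residue in simp)
          ultimately show False using xv by (auto simp: Y0_def)
        qed
        then show "u \<in> (X + Y) - {x. x - y \<in> X}" using xv by (auto simp: Z_def Y0_def intro: set_plus_intro)
      qed
      then have "N (Z + Y0) \<le> N ((X + Y) - {x. x - y \<in> X})" by (rule N_mono)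
      also have "\<dots> = N (X + Y) - N X"
      proof -
        have sub: "{x. x - y \<in> X} \<subseteq> X + Y" using y set_plus_intro[of _ X y Y] by fastforce
        have "N (((X + Y) - {x. x - y \<in> X}) \<union> {x. x - y \<in> X}) = N ((X + Y) - {x. x - y \<in> X}) + N {x. x - y \<in> X}"
          by (rule N_disjoint) auto
        moreover have "((X + Y) - {x. x - y \<in> X}) \<union> {x. x - y \<in> X} = X + Y" using sub by auto
        ultimately show ?thesis using N_shift[OF pX, of "- y"] by simp
      qed
      finally have "N (Z + Y0) \<le> N Y - 1" using le by linarith
      moreover have "N (Z + Y0) \<ge> min p (N Z + N Y0 - 1)"
      proof (rule Cauchy_Davenport[OF perZ perY0])
        show "Z \<noteq> {}" "Y0 \<noteq> {}" using NZ NY0 NY N_empty by auto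
      qed
      ultimately show False using NZ NY0 lt NX by linarith
    qed
    then obtain x where x: "x \<in> X" "Yx x \<noteq> Y" "N (Yx x) \<ge> 2" by auto
    define e where "e = x - y"
    define Y1 where "Y1 = Yx x"
    define X1 where "X1 = X \<union> {z. z - e \<in> Y}"
    have Y1: "Y1 = Y \<inter> {z. z + e \<in> X}" by (simp add: Y1_def Yx_def e_def)
    have per1: "per Y1" "per X1"
      unfolding X1_def Y1_def using perYx pX periodic_shift[OF pY, of "- e"] by (auto intro: periodic_Un)
    have "Y1 \<subseteq> Y" "Y1 \<noteq> Y" using x by (auto simp: Y1_def Yx_def)
    then have lt1: "N Y1 < N Y" using N_subset_eq[OF per1(1) pY] by force
    have "N {z. z - e \<in> Y \<inter> {z. z + e \<in> X}} = N Y1"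
      using N_shift[OF per1(1), of "- e"] by (simp add: Y1)
    moreover have "{z. z - e \<in> Y \<inter> {z. z + e \<in> X}} = X \<inter> {z. z - e \<in> Y}" by auto
    moreover have "N {z. z - e \<in> Y} = N Y" using N_shift[OF pY, of "- e"] by simp
    ultimately have sum: "N X1 + N Y1 = N X + N Y"
      using N_Un_Int[of X "{z. z - e \<in> Y}"] by (simp add: X1_def)
    have sub: "X1 + Y1 \<subseteq> X + Y"
    proof
      fix z assume "z \<in> X1 + Y1"
      then obtain a b where ab: "a \<in> X1" "b \<in> Y1" "z = a + b" by (auto simp: set_plus_def)
      show "z \<in> X + Y"
      proof (cases "a \<in> X")
        case True
        then show ?thesis using ab by (auto simp: Y1 intro: set_plus_intro)
      next
        case False
        then have "a - e \<in> Y" "b + e \<in> X" using ab by (auto simp: X1_def Y1)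
        then have "(b + e) + (a - e) \<in> X + Y" by (rule set_plus_intro[rotated])
        then show ?thesis using ab by (simp add: algebra_simps)
      qed
    qed
    have NX1: "N X1 \<ge> N X" by (rule N_mono) (auto simp: X1_def)
    have le1: "N (X1 + Y1) \<le> N X1 + N Y1 - 1" using N_mono[OF sub] le sum by simp
    have "\<exists>d. is_AP d (N X1) X1 \<and> is_AP d (N Y1) Y1"
      using lt1 N_nonneg[of Y1] per1 NX1 NX x(3) le1 lt sum by (intro less.hyps) (auto simp: Y1_def)
    then obtain d where d: "is_AP d (N X1) X1" "is_AP d (N Y1) Y1" by auto
    have "N (X1 + Y1) \<ge> min p (N X1 + N Y1 - 1)"
    proof (rule Cauchy_Davenport[OF per1(2,1)])
      show "X1 \<noteq> {}" "Y1 \<noteq> {}" using neX x(3) N_empty by (auto simp: X1_def Y1_def)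
    qed
    then have "X1 + Y1 = X + Y"
      using le lt sum by (intro N_subset_eq periodic_plus1 per1 pX sub) auto
    moreover have "is_AP d (N X1 + N Y1 - 1) (X1 + Y1)"
      using d NX1 NX x(3) by (intro AP_plus) (auto simp: Y1_def)
    ultimately have "is_AP d (N X + N Y - 1) (X + Y)" using sum by simp
    then show ?thesis using Vosper_AP_sum[OF pX neX pY NY le lt] by blast
  qed
qed

end

subsection \<open>Sum-free sets on a line\<close>

definition sg :: "bool \<Rightarrow> 'a \<Rightarrow> 'a :: ab_group_add" where
  "sg b x = (if b then x else - x)"

lemma sg_add: "sg b (x + y) = sg b x + sg b y"
  and sg_uminus: "sg b (- x) = - sg b x"
  and sg_sg: "sg b (sg b x) = x"
  and sg_0: "sg b 0 = 0"
  by (simp_all add: sg_def)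

context modulus
begin

lemma periodic_sg: "per X \<Longrightarrow> per (sg b ` X)"
  and N_sg: "per X \<Longrightarrow> N (sg b ` X) = N X"
  and AP_sg: "is_AP d k X \<Longrightarrow> is_AP d k (sg b ` X)"
  by (cases b; simp add: sg_def[abs_def] periodic_uminus N_uminus AP_uminus)+

text \<open>With \<open>Y = X + X\<close> and its signed copy \<open>Z\<close>, the hypothesis
  separates the signed copy of \<open>X\<close> from \<open>Y + Z\<close>. Two uses of
  Cauchy-Davenport give \<open>N X <= m + 1\<close>. If \<open>N X = m + 1\<close> then
  \<open>X + X\<close> is critical, if \<open>N X = m\<close> and \<open>N Y = 2 m + 2\<close> then
  \<open>Y + Z\<close> is, and Vosper's theorem applies; \<open>cover\<close> handles the remaining
  \<open>N X = m\<close>, \<open>N Y <= 2 m + 1\<close>.\<close>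

lemma sum_free_line_in_AP:
  assumes p: "p = 5 * m + 3" and m: "m \<ge> 2" and X: "per X" "N X \<ge> m"
    and free: "\<And>x1 x2 x3 x4 x5. x1 \<in> X \<Longrightarrow> x2 \<in> X \<Longrightarrow> x3 \<in> X \<Longrightarrow> x4 \<in> X \<Longrightarrow> x5 \<in> X \<Longrightarrow>
      x1 + x2 + x3 + sg b x4 \<noteq> x5"
    and cover: "N X = m \<Longrightarrow> N (X + X) \<le> 2 * m + 1 \<Longrightarrow>
      \<exists>d a. \<not> p dvd d \<and> X \<subseteq> {x. \<exists>i\<in>{0..<m + 2}. p dvd x - (a + i * d)}"
  shows "\<exists>d a. \<not> p dvd d \<and> X \<subseteq> {x. \<exists>i\<in>{0..<m + 2}. p dvd x - (a + i * d)}"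
proof -
  have AP: ?thesis if ap: "is_AP d k X'" "X \<subseteq> X'" "k \<le> m + 2" for d k X'
  proof -
    obtain a where "\<not> p dvd d" "X' = {x. \<exists>i\<in>{0..<k}. p dvd x - (a + i * d)}"
      using ap(1) unfolding is_AP_def by blast
    moreover have "{x. \<exists>i\<in>{0..<k}. p dvd x - (a + i * d)} \<subseteq> {x. \<exists>i\<in>{0..<m + 2}. p dvd x - (a + i * d)}"
      using ap(3) by (auto intro!: bexI)
    ultimately show ?thesis using ap(2) by blast
  qed
  have neX: "X \<noteq> {}" using X m N_empty by auto
  define Y where "Y = X + X"
  define Z where "Z = sg b ` Y"
  have "per Y" unfolding Y_def using X(1) by (rule periodic_plus1)
  moreover have "Y \<noteq> {}" using neX by (auto simp: Y_def set_plus_def)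
  ultimately have Y: "per Y" "Y \<noteq> {}" by auto
  have Z: "per Z" "Z \<noteq> {}" "N Z = N Y" using Y by (auto simp: Z_def N_sg intro: periodic_sg)
  have disj: "sg b ` X \<subseteq> - (Y + Z)"
  proof
    fix z assume "z \<in> sg b ` X"
    then obtain x5 where x5: "x5 \<in> X" "z = sg b x5" by auto
    show "z \<in> - (Y + Z)"
    proof
      assume "z \<in> Y + Z"
      then obtain x1 x2 x3 x4 where x: "x1 \<in> X" "x2 \<in> X" "x3 \<in> X" "x4 \<in> X" "z = x1 + x2 + sg b (x3 + x4)"
        by (auto simp: Y_def Z_def set_plus_def)
      show False
      proof (cases b)
        case True
        then show ?thesis using free[of x1 x2 x3 x4 x5] x x5 by (simp add: sg_def)
      next
        case False
        then have "x1 + x2 + x5 + sg b x3 = x4" using x(5) x5(2) by (simp add: sg_def)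
        then show ?thesis using free[of x1 x2 x5 x3 x4] x x5 by blast
      qed
    qed
  qed
  have "N (sg b ` X) \<le> N (- (Y + Z))" by (rule N_mono[OF disj])
  then have YZ: "N (Y + Z) \<le> p - N X" using N_sg[OF X(1), of b] by (simp add: N_Compl)
  have "N (Y + Z) \<ge> min p (N Y + N Z - 1)" using Y Z by (intro Cauchy_Davenport)
  then have NY: "2 * N Y \<le> p - N X + 1" using YZ X m Z(3) by linarith
  have "N Y \<ge> min p (2 * N X - 1)" using Cauchy_Davenport[OF X(1) X(1) neX neX] by (simp add: Y_def)
  then have NX: "N X \<le> m + 1" using NY p X m N_le[of X] by linarith
  show ?thesis
  proof (cases "N X = m + 1")
    case True
    have "N (X + X) \<le> N X + N X - 1" using NY p True unfolding Y_def by linarith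
    then obtain d where "is_AP d (N X) X" using Vosper[OF X(1) X(1)] True m p by auto
    then show ?thesis using AP True by auto
  next
    case False
    then have Nm: "N X = m" using NX X by simp
    show ?thesis
    proof (cases "N Y \<le> 2 * m + 1")
      case True
      then show ?thesis using cover Nm by (simp add: Y_def)
    next
      case False
      then have NY': "N Y = 2 * m + 2" using NY Nm p by linarith
      obtain d where d: "is_AP d (N Y) Y" "is_AP d (N Z) Z"
        using Vosper[OF Y(1) Z(1)] NY' Z(3) YZ Nm m p by auto
      \<comment> \<open>This progression has 4m + 3 terms, so its complement is one of only
        \<open>m\<close> terms; a signed copy of it contains \<open>X\<close>.\<close>
      have "is_AP d (N Y + N Z - 1) (Y + Z)" using d NY' Z(3) m by (intro AP_plus) auto
      then have "is_AP d (p - (N Y + N Z - 1)) (- (Y + Z))" using NY' Z(3) m p by (intro AP_Compl) auto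
      then have "is_AP d m (sg b ` (- (Y + Z)))" using NY' Z(3) p AP_sg by simp
      moreover have "X \<subseteq> sg b ` (- (Y + Z))"
      proof
        fix x assume "x \<in> X"
        then have "sg b x \<in> - (Y + Z)" using disj by auto
        then show "x \<in> sg b ` (- (Y + Z))" by (metis image_eqI sg_sg)
      qed
      ultimately show ?thesis using AP by auto
    qed
  qed
qed

end

subsection \<open>Intervals in sumsets of dense sets\<close>

text \<open>Let \<open>s\<close> be the last integer below \<open>M\<close> that is missing. As 0 is
  in \<open>Y\<close>, no \<open>s - x\<close> with \<open>x\<close> in \<open>X\<close> can lie in
  \<open>P\<close>; so reflection at \<open>s\<close> injects the part of \<open>X\<close> up to
  \<open>s\<close> into the holes of \<open>P\<close>, and likewise for \<open>Y\<close>. Then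
  \<open>\<sigma> = s + 1\<close>.\<close>

lemma sumset_low_end:
  fixes P X Y :: "int set"
  assumes "0 \<in> P" "0 \<in> X" "0 \<in> Y" "M \<ge> 0"
  obtains \<sigma> where "0 \<le> \<sigma>" "\<sigma> \<le> M" "{\<sigma>..<M} \<subseteq> P + X + Y"
    "card (X \<inter> {0..<\<sigma>}) \<le> card ({0..<\<sigma>} - P)" "card (Y \<inter> {0..<\<sigma>}) \<le> card ({0..<\<sigma>} - P)"
proof (cases "{0..<M} \<subseteq> P + X + Y")
  case True
  then show ?thesis using that[of 0] assms by simp
next
  case False
  define B where "B = {0..<M} - (P + X + Y)"
  have B: "finite B" "B \<noteq> {}" using False by (auto simp: B_def)
  define s where "s = Max B"
  have s: "s \<in> B" "\<And>t. t \<in> B \<Longrightarrow> t \<le> s" using B by (auto simp: s_def)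
  have inj: "card (U \<inter> {0..<s + 1}) \<le> card ({0..<s + 1} - P)"
    if "\<And>x y. x \<in> P \<Longrightarrow> y \<in> U \<Longrightarrow> x + y \<in> P + X + Y" for U
  proof (rule card_inj_on_le[where f = "\<lambda>x. s - x"])
    show "(\<lambda>x. s - x) ` (U \<inter> {0..<s + 1}) \<subseteq> {0..<s + 1} - P"
    proof
      fix z assume "z \<in> (\<lambda>x. s - x) ` (U \<inter> {0..<s + 1})"
      then obtain x where x: "x \<in> U" "0 \<le> x" "x \<le> s" "z = s - x" by auto
      have "z \<notin> P"
      proof
        assume "z \<in> P"
        then have "s \<in> P + X + Y" using that[of z x] x by simp
        then show False using s by (simp add: B_def)
      qed
      then show "z \<in> {0..<s + 1} - P" using x by auto
    qed
  qed (auto simp: inj_on_def)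
  show ?thesis
  proof (rule that[of "s + 1"])
    show "{s + 1..<M} \<subseteq> P + X + Y"
    proof
      fix t assume t: "t \<in> {s + 1..<M}"
      show "t \<in> P + X + Y"
      proof (rule ccontr)
        assume "t \<notin> P + X + Y"
        then have "t \<in> B" using t s(1) by (auto simp: B_def)
        then show False using s(2) t by fastforce
      qed
    qed
    show "card (X \<inter> {0..<s + 1}) \<le> card ({0..<s + 1} - P)"
    proof (rule inj)
      fix x y assume "x \<in> P" "y \<in> X"
      then show "x + y \<in> P + X + Y" using set_plus_intro[OF set_plus_intro[of x P y X] assms(3)] by simp
    qed
    show "card (Y \<inter> {0..<s + 1}) \<le> card ({0..<s + 1} - P)"
    proof (rule inj)
      fix x y assume "x \<in> P" "y \<in> Y"
      then show "x + y \<in> P + X + Y" using set_plus_intro[OF set_plus_intro[of x P 0 X], of y Y] assms(2) by simp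
    qed
  qed (use s(1) in \<open>auto simp: B_def\<close>)
qed

lemma reflect_set:
  fixes X :: "int set"
  assumes "X \<subseteq> {0..a}" "0 \<in> X" "a \<in> X"
  shows "(\<lambda>x. a - x) ` X \<subseteq> {0..a}" "0 \<in> (\<lambda>x. a - x) ` X" "a \<in> (\<lambda>x. a - x) ` X"
  using assms by (auto simp: image_iff)

text \<open>The interval found is \<open>{\<sigma>..M + a + b - \<tau>}\<close>: its ends come from
  \<open>sumset_low_end\<close> and a reflection, its middle from the pigeonhole principle. What is
  lost at an end is paid for by the missing elements of \<open>X\<close> and \<open>Y\<close>, which
  have there at most as many elements as \<open>P\<close> has holes; so the length is at least that
  for three intervals of the same sizes. The base column has at most 2 holes, a large column at most
  5.\<close>

lemma interval_in_sumset_normalized: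
  fixes P X Y :: "int set"
  assumes P: "P \<subseteq> {0..M}" "0 \<in> P" "M \<in> P" and X: "X \<subseteq> {0..a}" "0 \<in> X" "a \<in> X"
    and Y: "Y \<subseteq> {0..b}" "0 \<in> Y" "b \<in> Y"
    and cP: "int (card P) \<ge> 19" "M + 1 - int (card P) \<le> 2"
    and cX: "int (card X) \<ge> 19" "a + 1 - int (card X) \<le> 5"
    and cY: "int (card Y) \<ge> 19" "b + 1 - int (card Y) \<le> 5"
  shows "\<exists>j. {j..j + int (card P) + int (card X) + int (card Y) - 3} \<subseteq> P + X + Y"
proof -
  have fin: "finite P" "finite X" "finite Y" using P X Y by (meson finite_atLeastAtMost_int finite_subset)+
  have nn: "M \<ge> 0" "a \<ge> 0" "b \<ge> 0" using P X Y by auto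
  obtain \<sigma> where s: "0 \<le> \<sigma>" "\<sigma> \<le> M" "{\<sigma>..<M} \<subseteq> P + X + Y"
    "card (X \<inter> {0..<\<sigma>}) \<le> card ({0..<\<sigma>} - P)" "card (Y \<inter> {0..<\<sigma>}) \<le> card ({0..<\<sigma>} - P)"
    using sumset_low_end[OF P(2) X(2) Y(2) nn(1)] .
  define P' where "P' = (\<lambda>x. M - x) ` P"
  define X' where "X' = (\<lambda>x. a - x) ` X"
  define Y' where "Y' = (\<lambda>x. b - x) ` Y"
  note r = reflect_set[OF P, folded P'_def] reflect_set[OF X, folded X'_def] reflect_set[OF Y, folded Y'_def]
  obtain \<tau> where t: "0 \<le> \<tau>" "\<tau> \<le> M" "{\<tau>..<M} \<subseteq> P' + X' + Y'"
    "card (X' \<inter> {0..<\<tau>}) \<le> card ({0..<\<tau>} - P')" "card (Y' \<inter> {0..<\<tau>}) \<le> card ({0..<\<tau>} - P')"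
    using sumset_low_end[OF r(2) r(5) r(8) nn(1)] .
  define \<eta> where "\<eta> = int (card ({0..<\<sigma>} - P))"
  define \<theta> where "\<theta> = int (card ({0..<\<tau>} - P'))"
  have holes: "int (card ({0..c} - S)) = c + 1 - int (card S)" if "S \<subseteq> {0..c}" "c \<ge> 0" for S :: "int set" and c
    using that card_Diff_subset[OF finite_subset[OF that(1)] that(1)] card_mono[OF _ that(1)] by (simp add: of_nat_diff)
  have cP': "card P' = card P" unfolding P'_def by (intro card_image inj_onI) simp
  have cX': "card X' = card X" unfolding X'_def by (intro card_image inj_onI) simp
  have cY': "card Y' = card Y" unfolding Y'_def by (intro card_image inj_onI) simp
  have eta2: "\<eta> \<le> 2"
  proof -
    have "card ({0..<\<sigma>} - P) \<le> card ({0..M} - P)" using s by (intro card_mono) auto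
    then show ?thesis using holes[OF P(1) nn(1)] cP by (simp add: \<eta>_def)
  qed
  have theta2: "\<theta> \<le> 2"
  proof -
    have "card ({0..<\<tau>} - P') \<le> card ({0..M} - P')" using t by (intro card_mono) auto
    then show ?thesis using holes[OF r(1) nn(1)] cP cP' by (simp add: \<theta>_def)
  qed
  \<comment> \<open>At most 2 elements of \<open>S\<close> and at most 5 holes make at most 7
    places.\<close>
  have small: "\<rho> \<le> 7" if "S \<subseteq> {0..c}" "c \<ge> 0" "int (card S) \<ge> 19" "c + 1 - int (card S) \<le> 5"
    "int (card (S \<inter> {0..<\<rho>})) \<le> 2" "\<rho> \<ge> 0" for S :: "int set" and c \<rho>
  proof -
    have fS: "finite S" using that(1) finite_subset by blast
    have le: "\<rho> \<le> c + 1"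
    proof (rule ccontr)
      assume "\<not> ?thesis"
      then have "S \<inter> {0..<\<rho>} = S" using that(1) by auto
      then show False using that by simp
    qed
    have "card {0..<\<rho>} \<le> card ((S \<inter> {0..<\<rho>}) \<union> ({0..c} - S))"
      using le fS by (intro card_mono) auto
    also have "\<dots> \<le> card (S \<inter> {0..<\<rho>}) + card ({0..c} - S)" by (rule card_Un_le)
    finally show ?thesis using that holes[OF that(1,2)] by simp
  qed
  have s7: "\<sigma> \<le> 7" using small[OF X(1) nn(2) cX] s eta2 by (simp add: \<eta>_def)
  have t7: "\<tau> \<le> 7" using small[OF r(4) nn(2)] cX cX' t theta2 by (simp add: \<theta>_def)
  have count: "int (card S) \<le> u + v + (c + 1 - \<sigma> - \<tau>)"
    if S: "S \<subseteq> {0..c}" "c \<ge> 0" "c \<ge> 14" "int (card (S \<inter> {0..<\<sigma>})) \<le> u"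
      "int (card ((\<lambda>x. c - x) ` S \<inter> {0..<\<tau>})) \<le> v" for S :: "int set" and c u v
  proof -
    have fS: "finite S" using that(1) finite_subset by blast
    have "card ((\<lambda>x. c - x) ` (S \<inter> {c - \<tau><..c})) = card (S \<inter> {c - \<tau><..c})"
      by (intro card_image inj_onI) simp
    moreover have "(\<lambda>x. c - x) ` (S \<inter> {c - \<tau><..c}) = (\<lambda>x. c - x) ` S \<inter> {0..<\<tau>}" using S(1) by auto
    ultimately have top: "int (card (S \<inter> {c - \<tau><..c})) \<le> v" using S by simp
    have "card S \<le> card ((S \<inter> {0..<\<sigma>}) \<union> (S \<inter> {c - \<tau><..c}) \<union> {\<sigma>..c - \<tau>})"
      using S(1) fS by (intro card_mono) auto
    also have "\<dots> \<le> card ((S \<inter> {0..<\<sigma>}) \<union> (S \<inter> {c - \<tau><..c})) + card {\<sigma>..c - \<tau>}" by (rule card_Un_le)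
    also have "\<dots> \<le> card (S \<inter> {0..<\<sigma>}) + card (S \<inter> {c - \<tau><..c}) + card {\<sigma>..c - \<tau>}"
      by (intro add_right_mono card_Un_le)
    finally show ?thesis using S top s7 t7 by simp
  qed
  have len: "M \<ge> 18" "a \<ge> 18" "b \<ge> 18"
    using cP cX cY card_mono[OF _ P(1)] card_mono[OF _ X(1)] card_mono[OF _ Y(1)] nn by auto
  have low: "int (card (P \<inter> {0..<\<sigma>})) = \<sigma> - \<eta>"
  proof -
    have "card {0..<\<sigma>} = card (({0..<\<sigma>} - P) \<union> (P \<inter> {0..<\<sigma>}))" by (rule arg_cong[of _ _ card]) auto
    also have "\<dots> = card ({0..<\<sigma>} - P) + card (P \<inter> {0..<\<sigma>})" by (rule card_Un_disjoint) auto
    finally show ?thesis using s by (simp add: \<eta>_def)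
  qed
  have top: "int (card (P' \<inter> {0..<\<tau>})) = \<tau> - \<theta>"
  proof -
    have "card {0..<\<tau>} = card (({0..<\<tau>} - P') \<union> (P' \<inter> {0..<\<tau>}))" by (rule arg_cong[of _ _ card]) auto
    also have "\<dots> = card ({0..<\<tau>} - P') + card (P' \<inter> {0..<\<tau>})" by (rule card_Un_disjoint) auto
    finally show ?thesis using t by (simp add: \<theta>_def)
  qed
  have c1: "int (card P) \<le> (\<sigma> - \<eta>) + (\<tau> - \<theta>) + (M + 1 - \<sigma> - \<tau>)"
    using len low top by (intro count[OF P(1) nn(1)]) (auto simp: P'_def)
  have c2: "int (card X) \<le> \<eta> + \<theta> + (a + 1 - \<sigma> - \<tau>)"
    using len s t by (intro count[OF X(1) nn(2)]) (auto simp: X'_def \<eta>_def \<theta>_def)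
  have c3: "int (card Y) \<le> \<eta> + \<theta> + (b + 1 - \<sigma> - \<tau>)"
    using len s t by (intro count[OF Y(1) nn(3)]) (auto simp: Y'_def \<eta>_def \<theta>_def)
  have "\<eta> \<le> \<sigma>" "\<theta> \<le> \<tau>" using low top by linarith+
  have mid: "u \<in> P + X + Y" if u: "M \<le> u" "u \<le> a + b" for u
  proof -
    \<comment> \<open>\<open>Z\<close> lies in \<open>X + Y\<close>, as 0 is in \<open>Y\<close> and
      \<open>a\<close> is in \<open>X\<close>. It has at most 5 + 5 holes in
      \<open>{0..a + b}\<close>, too few for the at least 19 points \<open>u - x\<close> with
      \<open>x\<close> in \<open>P\<close>.\<close>
    define Z where "Z = X \<union> (\<lambda>y. a + y) ` Y"
    have "{0..a + b} - Z \<subseteq> ({0..a} - X) \<union> (\<lambda>y. a + y) ` ({0..b} - Y)"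
    proof
      fix z assume z: "z \<in> {0..a + b} - Z"
      show "z \<in> ({0..a} - X) \<union> (\<lambda>y. a + y) ` ({0..b} - Y)"
      proof (cases "z \<le> a")
        case True
        then show ?thesis using z by (auto simp: Z_def)
      next
        case False
        then have "z = a + (z - a)" "z - a \<in> {0..b} - Y" using z by (auto simp: Z_def image_iff)
        then show ?thesis by blast
      qed
    qed
    then have "card ({0..a + b} - Z) \<le> card (({0..a} - X) \<union> (\<lambda>y. a + y) ` ({0..b} - Y))"
      by (intro card_mono) auto
    also have "\<dots> \<le> card ({0..a} - X) + card ((\<lambda>y. a + y) ` ({0..b} - Y))" by (rule card_Un_le)
    also have "\<dots> \<le> card ({0..a} - X) + card ({0..b} - Y)" by (simp add: card_image_le)
    finally have hZ: "int (card ({0..a + b} - Z)) \<le> 10"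
      using holes[OF X(1) nn(2)] holes[OF Y(1) nn(3)] cX cY by simp
    have "(\<lambda>x. u - x) ` P \<inter> Z \<noteq> {}"
    proof
      assume "(\<lambda>x. u - x) ` P \<inter> Z = {}"
      then have "(\<lambda>x. u - x) ` P \<subseteq> {0..a + b} - Z" using P(1) u by auto
      then have "card ((\<lambda>x. u - x) ` P) \<le> card ({0..a + b} - Z)" by (intro card_mono) auto
      moreover have "card ((\<lambda>x. u - x) ` P) = card P" by (intro card_image inj_onI) simp
      ultimately show False using hZ cP by simp
    qed
    then obtain x where x: "x \<in> P" "u - x \<in> Z" by auto
    show ?thesis
    proof (cases "u - x \<in> X")
      case True
      then show ?thesis using set_plus_intro[OF set_plus_intro[OF x(1) True] Y(2)] by simp
    next
      case False
      then obtain y where "y \<in> Y" "u - x = a + y" using x by (auto simp: Z_def)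
      then show ?thesis using set_plus_intro[OF set_plus_intro[OF x(1) X(3)], of y Y] by (simp add: algebra_simps)
    qed
  qed
  have "{\<sigma>..M + a + b - \<tau>} \<subseteq> P + X + Y"
  proof
    fix u assume u: "u \<in> {\<sigma>..M + a + b - \<tau>}"
    consider "u < M" | "M \<le> u" "u \<le> a + b" | "u > a + b" by linarith
    then show "u \<in> P + X + Y"
    proof cases
      case 1
      then show ?thesis using s(3) u by auto
    next
      case 2
      then show ?thesis by (rule mid)
    next
      case 3
      then have "M + a + b - u \<in> P' + X' + Y'" using t(3) u by auto
      then obtain x y z where "x \<in> P" "y \<in> X" "z \<in> Y" "M + a + b - u = (M - x) + (a - y) + (b - z)"
        by (auto simp: set_plus_def P'_def X'_def Y'_def)
      then show ?thesis using set_plus_intro[OF set_plus_intro[of x P y X], of z Y] by (simp add: algebra_simps)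
    qed
  qed
  moreover have "\<sigma> + int (card P) + int (card X) + int (card Y) - 3 \<le> M + a + b - \<tau>"
    using c1 c2 c3 \<open>\<eta> \<le> \<sigma>\<close> \<open>\<theta> \<le> \<tau>\<close> by linarith
  ultimately show ?thesis by (intro exI[of _ \<sigma>]) auto
qed

lemma interval_in_sumset:
  fixes P X Y :: "int set"
  assumes P: "P \<subseteq> {p0..p1}" "p0 \<in> P" "p1 \<in> P" and X: "X \<subseteq> {x0..x1}" "x0 \<in> X" "x1 \<in> X"
    and Y: "Y \<subseteq> {y0..y1}" "y0 \<in> Y" "y1 \<in> Y"
    and cP: "int (card P) \<ge> 19" "p1 - p0 + 1 - int (card P) \<le> 2"
    and cX: "int (card X) \<ge> 19" "x1 - x0 + 1 - int (card X) \<le> 5"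
    and cY: "int (card Y) \<ge> 19" "y1 - y0 + 1 - int (card Y) \<le> 5"
  shows "\<exists>j. {j..j + int (card P) + int (card X) + int (card Y) - 3} \<subseteq> P + X + Y"
proof -
  have sh: "(\<lambda>x. x - c) ` S \<subseteq> {0..d - c}" "0 \<in> (\<lambda>x. x - c) ` S" "d - c \<in> (\<lambda>x. x - c) ` S"
    "card ((\<lambda>x. x - c) ` S) = card S" if "S \<subseteq> {c..d}" "c \<in> S" "d \<in> S" for S :: "int set" and c d
    using that by (auto simp: image_iff intro!: card_image inj_onI)
  obtain j where j: "{j..j + int (card P) + int (card X) + int (card Y) - 3}
      \<subseteq> (\<lambda>x. x - p0) ` P + (\<lambda>x. x - x0) ` X + (\<lambda>x. x - y0) ` Y"
    using interval_in_sumset_normalized[OF sh(1-3)[OF P] sh(1-3)[OF X] sh(1-3)[OF Y]]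
      cP cX cY sh(4)[OF P] sh(4)[OF X] sh(4)[OF Y] by auto
  have "{j + p0 + x0 + y0..(j + p0 + x0 + y0) + int (card P) + int (card X) + int (card Y) - 3} \<subseteq> P + X + Y"
  proof
    fix u assume "u \<in> {j + p0 + x0 + y0..(j + p0 + x0 + y0) + int (card P) + int (card X) + int (card Y) - 3}"
    then have "u - p0 - x0 - y0 \<in> (\<lambda>x. x - p0) ` P + (\<lambda>x. x - x0) ` X + (\<lambda>x. x - y0) ` Y"
      by (intro subsetD[OF j]) auto
    then obtain x y z where "x \<in> P" "y \<in> X" "z \<in> Y" "u - p0 - x0 - y0 = (x - p0) + (y - x0) + (z - y0)"
      by (auto simp: set_plus_def)
    then show "u \<in> P + X + Y" using set_plus_intro[OF set_plus_intro[of x P y X], of z Y] by (simp add: algebra_simps)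
  qed
  then show ?thesis by blast
qed

subsection \<open>Columns of a sum-free set\<close>

context modulus
begin

definition near :: "int \<Rightarrow> int \<Rightarrow> bool" where
  "near D x \<longleftrightarrow> (\<exists>k. \<bar>x - k * p\<bar> \<le> D)"

lemma nearE: assumes "near D x" obtains k where "\<bar>x - k * p\<bar> \<le> D"
  using assms by (auto simp: near_def)

lemma mult_p_small: "\<bar>k * p\<bar> < p \<Longrightarrow> k = 0"
  using p_pos by (simp add: abs_mult)

lemma near_small:
  assumes "near D x" "\<bar>x\<bar> < p - D"
  shows "\<bar>x\<bar> \<le> D"
proof -
  obtain k where k: "\<bar>x - k * p\<bar> \<le> D" using assms(1) by (rule nearE)
  then have "k = 0" using assms(2) by (intro mult_p_small) linarith
  then show ?thesis using k by simp
qed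

lemma near_add_mult: "near D (x + k * p) \<longleftrightarrow> near D x"
proof -
  have "near D (x + k * p)" if nx: "near D x" for x k
  proof -
    obtain j where "\<bar>x - j * p\<bar> \<le> D" using nx by (rule nearE)
    then have "\<bar>(x + k * p) - (j + k) * p\<bar> \<le> D" by (simp add: algebra_simps)
    then show ?thesis by (auto simp: near_def)
  qed
  from this[of x k] this[of "x + k * p" "- k"] show ?thesis by auto
qed

lemma near_cong: "p dvd x - y \<Longrightarrow> near D x \<longleftrightarrow> near D y"
proof -
  assume "p dvd x - y"
  then obtain k where "x - y = p * k" by blast
  then have "x = y + k * p" by (simp add: algebra_simps)
  then show ?thesis using near_add_mult by simp
qed

lemma near_add:
  assumes "near D x" "\<bar>h\<bar> \<le> c"
  shows "near (D + c) (x + h)"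
proof -
  obtain k where "\<bar>x - k * p\<bar> \<le> D" using assms(1) by (rule nearE)
  then have "\<bar>(x + h) - k * p\<bar> \<le> D + c" using assms(2) by linarith
  then show ?thesis by (auto simp: near_def)
qed

lemma N_window: assumes "per X" shows "N X = int (card (X \<inter> {c..<c + p}))"
proof -
  have "bij_betw (\<lambda>x. x mod p) (X \<inter> {c..<c + p}) (X \<inter> {0..<p})"
  proof (rule bij_betw_byWitness[where f' = "\<lambda>y. c + (y - c) mod p"])
    show "\<forall>x\<in>X \<inter> {c..<c + p}. c + (x mod p - c) mod p = x"
      by (auto simp: mod_diff_left_eq)
    show "\<forall>y\<in>X \<inter> {0..<p}. (c + (y - c) mod p) mod p = y"
      by (auto simp: mod_add_right_eq)
    show "(\<lambda>x. x mod p) ` (X \<inter> {c..<c + p}) \<subseteq> X \<inter> {0..<p}"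
      using periodic_mod[OF assms] p_pos by auto
    show "(\<lambda>y. c + (y - c) mod p) ` (X \<inter> {0..<p}) \<subseteq> X \<inter> {c..<c + p}"
    proof
      fix z assume "z \<in> (\<lambda>y. c + (y - c) mod p) ` (X \<inter> {0..<p})"
      then obtain y where y: "y \<in> X" "z = c + (y - c) mod p" by auto
      have "p dvd z - y"
        by (rule dvd_lincomb[OF dvd_mod_diff[of p "y - c"] dvd_0_right, of _ 1 0 0]) (simp add: y)
      then have "z \<in> X" using periodic_cong[OF assms] y by blast
      then show "z \<in> X \<inter> {c..<c + p}" using y p_pos by auto
    qed
  qed
  then show ?thesis unfolding rcard_def by (simp add: bij_betw_same_card)
qed

text \<open>Lift every element to within \<open>D\<close> of one fixed \<open>x0\<close>. Two lifts
  differ by at most \<open>2 * D < p - D\<close>, so closeness modulo \<open>p\<close> becomes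
  closeness of integers, and the least and the greatest lift bound all of them.\<close>

lemma hull:
  assumes X: "per X" "X \<noteq> {}" and D: "3 * D < p"
    and near: "\<And>x y. x \<in> X \<Longrightarrow> y \<in> X \<Longrightarrow> near D (x - y)"
  obtains a b where "a \<in> X" "b \<in> X" "a \<le> b" "b - a \<le> D" "\<And>x. x \<in> X \<Longrightarrow> \<exists>k. x + k * p \<in> {a..b}"
    "N X = int (card (X \<inter> {a..b}))"
proof -
  obtain x0 where x0: "x0 \<in> X" using X by auto
  define F where "F = X \<inter> {x0 - D..x0 + D}"
  have D0: "D \<ge> 0" using near[OF x0 x0] by (auto simp: near_def)
  have F: "finite F" "F \<noteq> {}" using x0 D0 by (auto simp: F_def)
  have F_near: "\<bar>x - y\<bar> \<le> D" if "x \<in> F" "y \<in> F" for x y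
  proof -
    have "near D (x - y)" using near that by (auto simp: F_def)
    moreover have "\<bar>x - y\<bar> < p - D" using that D by (auto simp: F_def)
    ultimately show ?thesis by (rule near_small)
  qed
  define a where "a = Min F"
  define b where "b = Max F"
  have ab: "a \<in> F" "b \<in> F" "\<And>x. x \<in> F \<Longrightarrow> a \<le> x \<and> x \<le> b" using F by (auto simp: a_def b_def)
  have rep: "\<exists>k. x + k * p \<in> F" if xX: "x \<in> X" for x
  proof -
    obtain k where "\<bar>(x - x0) - k * p\<bar> \<le> D" using near[OF xX x0] by (rule nearE)
    then have "x + (- k) * p \<in> F" using periodic_add_mult[OF X(1), of x "- k"] xX by (auto simp: F_def)
    then show ?thesis by blast
  qed
  show ?thesis
  proof (rule that)
    show "a \<in> X" "b \<in> X" using ab by (auto simp: F_def)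
    show "a \<le> b" using ab by blast
    show "b - a \<le> D" using F_near[OF ab(2,1)] by simp
    show "\<exists>k. x + k * p \<in> {a..b}" if "x \<in> X" for x using rep[OF that] ab(3) by fastforce
    have "X \<inter> {a..<a + p} = X \<inter> {a..b}"
    proof (intro Set.set_eqI iffI)
      fix x assume x: "x \<in> X \<inter> {a..<a + p}"
      then obtain k where k: "x + k * p \<in> F" using rep by blast
      then have "k = 0" using x ab(3)[OF k] \<open>b - a \<le> D\<close> D D0
        by (intro mult_p_small) auto
      then show "x \<in> X \<inter> {a..b}" using k ab(3) x by auto
    next
      fix x assume "x \<in> X \<inter> {a..b}"
      then show "x \<in> X \<inter> {a..<a + p}" using \<open>b - a \<le> D\<close> D D0 by auto
    qed
    then show "N X = int (card (X \<inter> {a..b}))" using N_window[OF X(1), of a] by simp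
  qed
qed

end

text \<open>A finite quotient group given by representatives: the group laws remain those of the
  type, and only sums over the quotient refer to \<open>W\<close>. The law \<open>red_add\<close>
  makes equality of \<open>red\<close> values a congruence.\<close>

locale quotient_map =
  fixes red :: "'w :: ab_group_add \<Rightarrow> 'w"
  assumes finite_range: "finite (range red)"
    and red_add: "red (red a + b) = red (a + b)"
begin

abbreviation "W \<equiv> range red"
abbreviation "P \<equiv> int (card W)"

lemma red_red: "red (red a) = red a"
  using red_add[of a 0] by simp

lemma red_cong_add: "red a = red b \<Longrightarrow> red (a + c) = red (b + c)"
  using red_add[of a c] red_add[of b c] by simp

lemma red_cong_uminus: "red a = red b \<Longrightarrow> red (- a) = red (- b)"
  using red_cong_add[of a b "- a - b"] by simp

lemma red_cong_diff: "red a = red b \<Longrightarrow> red (c - a) = red (c - b)"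
  using red_cong_add[OF red_cong_uminus[of a b], of c] by (simp add: add.commute)

lemma P_pos: "P \<ge> 1"
proof -
  have "card W > 0" using finite_range by (simp add: card_gt_0_iff)
  then show ?thesis by simp
qed

lemma red_W: "w \<in> W \<Longrightarrow> red w = w"
  using red_red by auto

lemma sum_bij:
  assumes F: "\<And>v. F (red v) = F v"
    and f: "\<And>a b. red a = red b \<Longrightarrow> red (f a) = red (f b)" "\<And>a b. red a = red b \<Longrightarrow> red (g a) = red (g b)"
      "\<And>v. f (g v) = v" "\<And>v. g (f v) = v"
  shows "(\<Sum>w\<in>W. F (f w)) = (\<Sum>w\<in>W. F w)"
proof (rule sum.reindex_bij_witness[where i = "\<lambda>w. red (g w)" and j = "\<lambda>w. red (f w)"])
  fix a assume a: "a \<in> W"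
  show "red (g (red (f a))) = a" using f(2)[OF red_red, of "f a"] f(4) red_W[OF a] by simp
  show "F (red (f a)) = F (f a)" by (rule F)
next
  fix b assume b: "b \<in> W"
  show "red (f (red (g b))) = b" using f(1)[OF red_red, of "g b"] f(3) red_W[OF b] by simp
qed auto

lemma sum_shift: "(\<And>v. F (red v) = F v) \<Longrightarrow> (\<Sum>w\<in>W. F (w + u)) = (\<Sum>w\<in>W. F w)"
  by (rule sum_bij[where f = "\<lambda>w. w + u" and g = "\<lambda>w. w - u"])
    (auto intro: red_cong_add simp: diff_conv_add_uminus simp del: add_uminus_conv_diff)

lemma sum_reflect: "(\<And>v. F (red v) = F v) \<Longrightarrow> (\<Sum>w\<in>W. F (u - w)) = (\<Sum>w\<in>W. F w)"
  by (rule sum_bij[where f = "\<lambda>w. u - w" and g = "\<lambda>w. u - w"]) (auto intro: red_cong_diff)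

end

text \<open>
  \<open>W = range red\<close> plays the part of \<open>F_p^(n-1)\<close>, with \<open>red\<close> choosing representatives, and \<open>B v\<close>
  is the column over \<open>v\<close>.
\<close>

locale columns = modulus p + quotient_map red
  for p :: int and red :: "'w :: ab_group_add \<Rightarrow> 'w" +
  fixes m :: int and pos :: bool and B :: "'w \<Rightarrow> int set" and a0 :: int
  assumes p_eq: "p = 5 * m + 3" and m_ge: "m \<ge> 21"
    and torsion: "red (((+) v ^^ nat p) 0) = red 0"
    and B_red: "B (red v) = B v"
    and per_B: "per (B v)"
    and free: "t1 \<in> B v1 \<Longrightarrow> t2 \<in> B v2 \<Longrightarrow> t3 \<in> B v3 \<Longrightarrow> t4 \<in> B v4 \<Longrightarrow> t5 \<in> B (v1 + v2 + v3 + sg pos v4) \<Longrightarrow>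
      t1 + t2 + t3 + sg pos t4 \<noteq> t5"
    and mass: "(\<Sum>v\<in>W. N (B v)) \<ge> m * P"
    and base: "N (B 0) \<ge> m" "B 0 \<subseteq> {x. \<exists>i\<in>{0..<m + 2}. p dvd x - (a0 + i)}"
begin

lemma B_cong: "red v = red w \<Longrightarrow> B v = B w"
  using B_red[of v] B_red[of w] by simp

lemma N_B_red: "N (B (red v)) = N (B v)"
  by (simp add: B_red)

lemma B0_nonempty: "B 0 \<noteq> {}"
  using base m_ge N_empty by auto

lemma five_columns:
  assumes "B v1 \<noteq> {}" "B v2 \<noteq> {}" "B v3 \<noteq> {}" "B v4 \<noteq> {}" "B (v1 + v2 + v3 + sg pos v4) \<noteq> {}"
  shows "N (B v1) + N (B v2) + N (B v3) + N (B v4) + N (B (v1 + v2 + v3 + sg pos v4)) \<le> 5 * m + 6"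
proof -
  have "0 \<notin> B v1 + B v2 + B v3 + sg pos ` B v4 + uminus ` B (v1 + v2 + v3 + sg pos v4)"
  proof
    assume "0 \<in> B v1 + B v2 + B v3 + sg pos ` B v4 + uminus ` B (v1 + v2 + v3 + sg pos v4)"
    then obtain t1 t2 t3 t4 t5 where t: "t1 \<in> B v1" "t2 \<in> B v2" "t3 \<in> B v3" "t4 \<in> B v4"
      "t5 \<in> B (v1 + v2 + v3 + sg pos v4)" "0 = t1 + t2 + t3 + sg pos t4 + - t5"
      by (auto simp: set_plus_def)
    then show False using free[OF t(1-5)] by simp
  qed
  then have "N (B v1) + N (B v2) + N (B v3) + N (sg pos ` B v4) + N (uminus ` B (v1 + v2 + v3 + sg pos v4)) \<le> p + 3"
    using assms by (intro sum_five_bound per_B periodic_sg periodic_uminus) auto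
  then show ?thesis using N_sg[OF per_B] N_uminus[OF per_B] p_eq by simp
qed

lemma N_B_le3: "N (B v) \<le> m + 3"
proof (cases "B v = {}")
  case True
  then show ?thesis using m_ge N_empty by simp
next
  case False
  then show ?thesis using five_columns[of v 0 0 0] B0_nonempty base by (simp add: sg_0)
qed

text \<open>Three copies of \<open>B v\<close> and the columns over \<open>w\<close> and
  \<open>w + c\<close> fit the equation. On average over \<open>w\<close> the latter two have joint
  size at least 2m, which leaves \<open>3 * N (B v) <= 3 * m + 6\<close>. The cruder
  \<open>N_B_le3\<close> serves for empty columns, to which \<open>five_columns\<close> does not
  apply.\<close>

lemma N_B_le2: "N (B v) \<le> m + 2"
proof (cases "B v = {}")
  case True
  then show ?thesis using m_ge N_empty by simp
next
  case False
  define c where "c = v + v + sg pos v"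
  have "N (B w) + N (B (w + c)) \<le> 5 * m + 6 - 3 * N (B v)" for w
  proof (cases "B w = {} \<or> B (w + c) = {}")
    case True
    then show ?thesis using N_B_le3[of w] N_B_le3[of "w + c"] N_B_le3[of v] N_empty m_ge by auto
  next
    case ne: False
    then show ?thesis using five_columns[of w v v v] False by (simp add: c_def algebra_simps)
  qed
  then have "(\<Sum>w\<in>W. N (B w) + N (B (w + c))) \<le> (\<Sum>w\<in>W. 5 * m + 6 - 3 * N (B v))" by (rule sum_mono)
  moreover have "(\<Sum>w\<in>W. N (B (w + c))) = (\<Sum>w\<in>W. N (B w))" by (rule sum_shift) (rule N_B_red)
  ultimately have "2 * (m * P) \<le> P * (5 * m + 6 - 3 * N (B v))" using mass by (simp add: sum.distrib)
  then have "P * (2 * m) \<le> P * (5 * m + 6 - 3 * N (B v))" by (simp add: algebra_simps)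
  then have "2 * m \<le> 5 * m + 6 - 3 * N (B v)" using P_pos by (simp only: mult_le_cancel_left)
  then show ?thesis by linarith
qed

text \<open>In effect \<open>f\<close> permutes the quotient, so both summands average at least
  \<open>m\<close>.\<close>

lemma exists_large_sum:
  assumes f: "\<And>F. (\<And>v. F (red v) = F v) \<Longrightarrow> (\<Sum>w\<in>W. F (f w) :: int) = (\<Sum>w\<in>W. F w)"
  shows "\<exists>w. N (B w) + N (B (f w)) \<ge> 2 * m"
proof (rule ccontr)
  assume "\<not> ?thesis"
  then have "N (B w) + N (B (f w)) \<le> 2 * m - 1" for w by (metis not_le zle_diff1_eq)
  then have "(\<Sum>w\<in>W. N (B w) + N (B (f w))) \<le> (\<Sum>w\<in>W. 2 * m - 1)" by (rule sum_mono)
  moreover have "(\<Sum>w\<in>W. N (B (f w))) = (\<Sum>w\<in>W. N (B w))" by (rule f) (rule N_B_red)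
  ultimately have "2 * (m * P) \<le> P * (2 * m - 1)" using mass by (simp add: sum.distrib)
  then show False using P_pos by (simp add: algebra_simps)
qed

lemma exists_large_pair: "\<exists>b c. b + sg pos c = u \<and> N (B b) + N (B c) \<ge> 2 * m"
proof -
  have "\<exists>b. N (B b) + N (B (sg pos (u - b))) \<ge> 2 * m"
  proof (rule exists_large_sum)
    fix F :: "'w \<Rightarrow> int" assume F: "\<And>v. F (red v) = F v"
    have "F (sg pos (red v)) = F (sg pos v)" for v
      using F red_cong_uminus[OF red_red, of v] by (metis sg_def)
    then have "(\<Sum>b\<in>W. F (sg pos (u - b))) = (\<Sum>b\<in>W. F (sg pos b))" by (intro sum_reflect)
    also have "\<dots> = (\<Sum>b\<in>W. F b)"
      using sum_reflect[of F 0, OF F] by (cases pos) (simp_all add: sg_def)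
    finally show "(\<Sum>b\<in>W. F (sg pos (u - b))) = (\<Sum>b\<in>W. F b)" .
  qed
  then obtain b where "N (B b) + N (B (sg pos (u - b))) \<ge> 2 * m" by blast
  moreover have "b + sg pos (sg pos (u - b)) = u" by (simp add: sg_sg)
  ultimately show ?thesis by blast
qed

text \<open>The classes left for \<open>z\<close> are those of j + 3m - 2, ..., j + 5m + 2: these
  are 2m + 5 consecutive ones, the ball of radius m + 2 about j + 4m.\<close>

lemma avoid_interval:
  assumes "\<And>q. q \<in> {j..j + 3 * m - 3} \<Longrightarrow> \<not> p dvd z - q"
  shows "near (m + 2) (- z - (- j - 4 * m))"
proof -
  define r where "r = (z - j) mod p"
  have r: "0 \<le> r" "r < p" using p_pos by (auto simp: r_def)
  have dv: "p dvd r - (z - j)" unfolding r_def by (rule dvd_mod_diff)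
  have "\<not> r \<le> 3 * m - 3"
  proof
    assume "r \<le> 3 * m - 3"
    then have "\<not> p dvd z - (j + r)" using r by (intro assms) auto
    moreover have "p dvd z - (j + r)"
      by (rule dvd_lincomb[OF dv dvd_0_right, of _ "-1" 0 0]) simp
    ultimately show False by simp
  qed
  then have "\<bar>- (r - 4 * m)\<bar> \<le> m + 2" using r p_eq by linarith
  then have "near (m + 2) (- (r - 4 * m))" unfolding near_def by (intro exI[of _ 0]) simp
  moreover have "p dvd (- z - (- j - 4 * m)) - (- (r - 4 * m))"
    by (rule dvd_lincomb[OF dv dvd_0_right, of _ 1 0 0]) simp
  ultimately show ?thesis using near_cong by blast
qed

text \<open>For \<open>t\<close> over \<open>w\<close> and \<open>t'\<close> over
  \<open>u + w\<close>, adding to \<open>t'\<close> an element \<open>q\<close> of the threefold sum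
  leads back over \<open>w\<close>, so the result is not \<open>t\<close>. The centre of the
  remaining differences depends on \<open>j\<close> only, hence one \<open>d\<close> serves all
  \<open>w\<close>.\<close>

lemma difference_window:
  assumes Q: "{j..j + 3 * m - 3} \<subseteq> B 0 + B b + sg pos ` B c" and u: "b + sg pos c = - u"
  shows "\<exists>d. \<forall>w. \<forall>t\<in>B w. \<forall>t'\<in>B (u + w). near (m + 2) (t' - t - d)"
proof (intro exI allI ballI)
  fix w t t' assume t: "t \<in> B w" "t' \<in> B (u + w)"
  have "near (m + 2) (- (t - t') - (- j - 4 * m))"
  proof (rule avoid_interval)
    fix q assume "q \<in> {j..j + 3 * m - 3}"
    then obtain q1 q2 q3 where q: "q1 \<in> B 0" "q2 \<in> B b" "q3 \<in> B c" "q = q1 + q2 + sg pos q3"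
      using Q by (auto simp: set_plus_def subset_iff)
    show "\<not> p dvd (t - t') - q"
    proof
      assume "p dvd (t - t') - q"
      then have "t' + q \<in> B w" using periodic_cong[OF per_B, of t "t' + q" w] t by (simp add: algebra_simps)
      moreover have "(u + w) + 0 + b + sg pos c = w + (u + (b + sg pos c))" by (simp add: algebra_simps)
      then have "(u + w) + 0 + b + sg pos c = w" unfolding u by simp
      ultimately have "t' + q \<in> B ((u + w) + 0 + b + sg pos c)" by (simp only:)
      from free[OF t(2) q(1,2,3) this] show False using q(4) by (simp add: algebra_simps)
    qed
  qed
  then show "near (m + 2) (t' - t - (- j - 4 * m))" by (simp add: algebra_simps)
qed

lemma base_window:
  obtains F a b where "F \<subseteq> B 0" "F \<subseteq> {a..b}" "a \<in> F" "b \<in> F" "int (card F) \<ge> m" "b - a + 1 - int (card F) \<le> 2"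
proof -
  define F where "F = B 0 \<inter> {a0..a0 + m + 1}"
  have "B 0 \<inter> {a0..<a0 + p} = F"
  proof (intro Set.set_eqI iffI)
    fix x assume x: "x \<in> B 0 \<inter> {a0..<a0 + p}"
    then obtain i where i: "i \<in> {0..<m + 2}" "p dvd x - (a0 + i)" using base(2) by auto
    then obtain k where k: "x - (a0 + i) = p * k" by blast
    then have "x - (a0 + i) = k * p" by (simp add: mult.commute)
    moreover have "\<bar>x - (a0 + i)\<bar> < p" using x i p_eq m_ge by auto
    ultimately have "k = 0" using mult_p_small[of k] by simp
    then show "x \<in> F" using k x i by (auto simp: F_def)
  qed (use p_eq m_ge in \<open>auto simp: F_def\<close>)
  then have cF: "int (card F) = N (B 0)" using N_window[OF per_B, of 0 a0] by simp
  have F: "finite F" "F \<noteq> {}" using cF base m_ge by (auto simp: F_def)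
  show ?thesis
  proof (rule that[of F "Min F" "Max F"])
    have "Max F \<le> a0 + m + 1" "Min F \<ge> a0" using F Max_in[OF F] Min_in[OF F] by (auto simp: F_def)
    then show "Max F - Min F + 1 - int (card F) \<le> 2" using cF base by linarith
    show "F \<subseteq> B 0" by (auto simp: F_def)
    show "F \<subseteq> {Min F..Max F}" using F by auto
    show "Min F \<in> F" "Max F \<in> F" using F by auto
    show "int (card F) \<ge> m" using cF base by simp
  qed
qed

lemma sg_window:
  fixes F :: "int set"
  assumes "F \<subseteq> {a..b}" "a \<in> F" "b \<in> F"
  obtains a' b' where "sg pos ` F \<subseteq> {a'..b'}" "a' \<in> sg pos ` F" "b' \<in> sg pos ` F" "b' - a' = b - a"
    "card (sg pos ` F) = card F"
proof (cases pos)
  case True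
  then have "sg pos ` F = F" by (simp add: sg_def)
  then show ?thesis using that[of a b] assms by simp
next
  case False
  then have "sg pos ` F = uminus ` F" by (simp add: sg_def image_def)
  moreover have "card (uminus ` F) = card F" by (intro card_image inj_onI) simp
  ultimately show ?thesis using assms by (intro that[of "- b" "- a"]) (auto simp: image_iff subset_iff)
qed

text \<open>This is displacement 0, with the base column in all three places of the sum. It gives
  one \<open>d\<close> close to all differences within a column, and since these come in opposite
  pairs, \<open>d\<close> can be replaced by 0.\<close>

lemma column_diameter: "t \<in> B w \<Longrightarrow> t' \<in> B w \<Longrightarrow> near (m + 2) (t' - t)"
proof -
  obtain F a b where F: "F \<subseteq> B 0" "F \<subseteq> {a..b}" "a \<in> F" "b \<in> F" "int (card F) \<ge> m" "b - a + 1 - int (card F) \<le> 2"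
    by (rule base_window)
  obtain a' b' where F': "sg pos ` F \<subseteq> {a'..b'}" "a' \<in> sg pos ` F" "b' \<in> sg pos ` F" "b' - a' = b - a"
    "card (sg pos ` F) = card F" using sg_window[OF F(2-4)] .
  have "\<exists>j. {j..j + int (card F) + int (card F) + int (card (sg pos ` F)) - 3} \<subseteq> F + F + sg pos ` F"
    using F F' m_ge by (intro interval_in_sumset[OF F(2-4) F(2-4) F'(1-3)]) auto
  then obtain j where j: "{j..j + int (card F) + int (card F) + int (card (sg pos ` F)) - 3} \<subseteq> F + F + sg pos ` F"
    by blast
  have "{j..j + 3 * m - 3} \<subseteq> B 0 + B 0 + sg pos ` B 0"
  proof -
    have "{j..j + 3 * m - 3} \<subseteq> {j..j + int (card F) + int (card F) + int (card (sg pos ` F)) - 3}"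
      using F F' by auto
    also note j
    also have "F + F + sg pos ` F \<subseteq> B 0 + B 0 + sg pos ` B 0" using F(1) by (intro set_plus_mono2 image_mono)
    finally show ?thesis .
  qed
  then have "\<exists>d. \<forall>w. \<forall>t\<in>B w. \<forall>t'\<in>B (0 + w). near (m + 2) (t' - t - d)"
    by (rule difference_window) (simp add: sg_0)
  then obtain d where d: "\<And>w t t'. t \<in> B w \<Longrightarrow> t' \<in> B (0 + w) \<Longrightarrow> near (m + 2) (t' - t - d)" by blast
  assume t: "t \<in> B w" "t' \<in> B w"
  obtain k1 where k1: "\<bar>(t' - t - d) - k1 * p\<bar> \<le> m + 2" using d[of t w t'] t by (auto elim: nearE)
  obtain k2 where k2: "\<bar>(t - t' - d) - k2 * p\<bar> \<le> m + 2" using d[of t' w t] t by (auto elim: nearE)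
  obtain k3 where k3: "\<bar>(t - t - d) - k3 * p\<bar> \<le> m + 2" using d[of t w t] t by (auto elim: nearE)
  \<comment> \<open>Subtracting the first two estimates shows \<open>2 * (t' - t)\<close> to be near
    \<open>(k1 - k2) * p\<close>, and halving needs an even multiple of \<open>p\<close>. The
    trivial difference \<open>t - t\<close> supplies the parity through
    \<open>k1 + k2 = 2 * k3\<close>.\<close>
  have "\<bar>(k1 + k2 - 2 * k3) * p\<bar> \<le> 4 * (m + 2)"
    using k1 k2 k3 by (simp add: algebra_simps)
  moreover have "4 * (m + 2) < p" using p_eq m_ge by (simp add: algebra_simps)
  ultimately have "k1 + k2 - 2 * k3 = 0" by (intro mult_p_small) (rule le_less_trans)
  then have k2eq: "k2 * p = 2 * (k3 * p) - k1 * p"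
  proof -
    assume "k1 + k2 - 2 * k3 = 0"
    then have k2: "k2 = 2 * k3 - k1" by simp
    show ?thesis unfolding k2 by (simp add: left_diff_distrib)
  qed
  have "\<bar>(t' - t) - (k1 - k3) * p\<bar> \<le> m + 2"
    using k1 k2 k2eq by (simp add: left_diff_distrib)
  then show ?thesis unfolding near_def by blast
qed

lemma column_hull:
  assumes "B v \<noteq> {}"
  obtains a b where "a \<in> B v" "b \<in> B v" "a \<le> b" "b - a \<le> m + 2" "\<And>x. x \<in> B v \<Longrightarrow> \<exists>k. x + k * p \<in> {a..b}"
    "N (B v) = int (card (B v \<inter> {a..b}))" "b - a \<ge> N (B v) - 1"
proof -
  obtain a b where ab: "a \<in> B v" "b \<in> B v" "a \<le> b" "b - a \<le> m + 2" "\<And>x. x \<in> B v \<Longrightarrow> \<exists>k. x + k * p \<in> {a..b}"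
    "N (B v) = int (card (B v \<inter> {a..b}))"
    using hull[OF per_B assms, of "m + 2"] column_diameter p_eq m_ge by auto
  have "card (B v \<inter> {a..b}) \<le> card {a..b}" by (intro card_mono) auto
  then have "b - a \<ge> N (B v) - 1" using ab by simp
  then show ?thesis using that ab by blast
qed

text \<open>Averaging provides two columns with signed sum over \<open>- u\<close> and joint size at
  least 2m. As no column exceeds m + 2, each has at least m - 2 classes, and its hull of at most m +
  3 places has at most 5 holes. The base column is the summand with at most 2 holes, and the sum
  contains 3m - 2 consecutive integers.\<close>

lemma exists_displacement: "\<exists>d. \<forall>w. \<forall>t\<in>B w. \<forall>t'\<in>B (u + w). near (m + 2) (t' - t - d)"
proof -
  obtain F a b where F: "F \<subseteq> B 0" "F \<subseteq> {a..b}" "a \<in> F" "b \<in> F" "int (card F) \<ge> m" "b - a + 1 - int (card F) \<le> 2"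
    by (rule base_window)
  obtain x y where xy: "x + sg pos y = - u" "N (B x) + N (B y) \<ge> 2 * m" using exists_large_pair by blast
  have N: "N (B x) \<ge> m - 2" "N (B y) \<ge> m - 2" using N_B_le2[of x] N_B_le2[of y] xy(2) by linarith+
  then have ne: "B x \<noteq> {}" "B y \<noteq> {}" using m_ge N_empty by auto
  obtain xa xb where X: "xa \<in> B x" "xb \<in> B x" "xa \<le> xb" "xb - xa \<le> m + 2" "N (B x) = int (card (B x \<inter> {xa..xb}))"
    using column_hull[OF ne(1)] by metis
  obtain ya yb where Y: "ya \<in> B y" "yb \<in> B y" "ya \<le> yb" "yb - ya \<le> m + 2" "N (B y) = int (card (B y \<inter> {ya..yb}))"
    using column_hull[OF ne(2)] by metis
  define FX where "FX = B x \<inter> {xa..xb}"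
  define FY where "FY = B y \<inter> {ya..yb}"
  have FX: "FX \<subseteq> {xa..xb}" "xa \<in> FX" "xb \<in> FX" using X by (auto simp: FX_def)
  have FY: "FY \<subseteq> {ya..yb}" "ya \<in> FY" "yb \<in> FY" using Y by (auto simp: FY_def)
  obtain a' b' where F': "sg pos ` FY \<subseteq> {a'..b'}" "a' \<in> sg pos ` FY" "b' \<in> sg pos ` FY" "b' - a' = yb - ya"
    "card (sg pos ` FY) = card FY" using sg_window[OF FY] .
  have "\<exists>j. {j..j + int (card F) + int (card FX) + int (card (sg pos ` FY)) - 3} \<subseteq> F + FX + sg pos ` FY"
    using F F' X Y N m_ge unfolding FX_def[symmetric] FY_def[symmetric]
    by (intro interval_in_sumset[OF F(2-4) FX F'(1-3)]) auto
  then obtain j where j: "{j..j + int (card F) + int (card FX) + int (card (sg pos ` FY)) - 3} \<subseteq> F + FX + sg pos ` FY"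
    by blast
  have "{j..j + 3 * m - 3} \<subseteq> B 0 + B x + sg pos ` B y"
  proof -
    have "{j..j + 3 * m - 3} \<subseteq> {j..j + int (card F) + int (card FX) + int (card (sg pos ` FY)) - 3}"
      using F F' X(5) Y(5) xy(2) unfolding FX_def[symmetric] FY_def[symmetric] by auto
    also note j
    also have "F + FX + sg pos ` FY \<subseteq> B 0 + B x + sg pos ` B y"
      using F(1) by (intro set_plus_mono2 image_mono) (auto simp: FX_def FY_def)
    finally show ?thesis .
  qed
  then show ?thesis using difference_window xy(1) by blast
qed

subsection \<open>Displacements of columns\<close>

text \<open>Formed from \<open>red u\<close>, so that the choice depends only on the class of
  \<open>u\<close>.\<close>

definition disp :: "'w \<Rightarrow> int" where
  "disp u = (SOME d. \<forall>w. \<forall>t\<in>B w. \<forall>t'\<in>B (red u + w). near (m + 2) (t' - t - d))"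

lemma disp: "t \<in> B w \<Longrightarrow> t' \<in> B (u + w) \<Longrightarrow> near (m + 2) (t' - t - disp u)"
proof -
  assume t: "t \<in> B w" "t' \<in> B (u + w)"
  have "\<forall>w. \<forall>t\<in>B w. \<forall>t'\<in>B (red u + w). near (m + 2) (t' - t - disp u)"
    unfolding disp_def by (rule someI_ex) (rule exists_displacement)
  moreover have "t' \<in> B (red u + w)" using t(2) B_cong[OF red_add[of u w]] by simp
  ultimately show ?thesis using t(1) by blast
qed

lemma disp_cong: "red u = red v \<Longrightarrow> disp u = disp v"
  by (simp add: disp_def)

lemma exists_large_triple: "\<exists>w. N (B w) + N (B (v + w)) + N (B (u + (v + w))) \<ge> 3 * m"
proof (rule ccontr)
  assume "\<not> ?thesis"
  then have "N (B w) + N (B (w + v)) + N (B (w + (u + v))) \<le> 3 * m - 1" for w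
    by (metis (no_types, lifting) add.commute add.assoc not_le zle_diff1_eq)
  then have "(\<Sum>w\<in>W. N (B w) + N (B (w + v)) + N (B (w + (u + v)))) \<le> (\<Sum>w\<in>W. 3 * m - 1)"
    by (rule sum_mono)
  moreover have "(\<Sum>w\<in>W. N (B (w + v))) = (\<Sum>w\<in>W. N (B w))" by (rule sum_shift) (rule N_B_red)
  moreover have "(\<Sum>w\<in>W. N (B (w + (u + v)))) = (\<Sum>w\<in>W. N (B w))" by (rule sum_shift) (rule N_B_red)
  ultimately have "3 * (m * P) \<le> P * (3 * m - 1)" using mass by (simp add: sum.distrib)
  then show False using P_pos by (simp add: algebra_simps)
qed

lemma same_lift:
  assumes "\<bar>x - d - k * p\<bar> \<le> m + 2" "\<bar>y - d - l * p\<bar> \<le> m + 2" "0 \<le> x - y" "x - y \<le> 2 * m + 4"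
  shows "k = l"
proof -
  have "\<bar>(k - l) * p\<bar> \<le> 4 * m + 8" using assms by (simp add: left_diff_distrib)
  moreover have "4 * m + 8 < p" using p_eq m_ge by simp
  ultimately have "k - l = 0" by (intro mult_p_small) (rule le_less_trans)
  then show ?thesis by simp
qed

text \<open>A displacement is within m + 2 of the largest and of the smallest difference between two
  columns, so a suitable lift lies in an interval of length 2 (m + 2) minus both diameters. Take
  columns over \<open>w\<close>, \<open>v + w\<close>, \<open>u + (v + w)\<close> of total size at
  least 3m: the endpoints cancel in the sum, and 3 (m + 2) - (3m - 3) = 9 remains.\<close>

lemma disp_defect: "\<exists>e. \<bar>e\<bar> \<le> 9 \<and> p dvd (disp u + disp v - disp (u + v)) - e"
proof -
  obtain w where w: "N (B w) + N (B (v + w)) + N (B (u + (v + w))) \<ge> 3 * m"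
    using exists_large_triple by blast
  have "N (B w) \<ge> 1" "N (B (v + w)) \<ge> 1" "N (B (u + (v + w))) \<ge> 1"
    using w N_B_le2[of w] N_B_le2[of "v + w"] N_B_le2[of "u + (v + w)"] m_ge by linarith+
  then have ne: "B w \<noteq> {}" "B (v + w) \<noteq> {}" "B (u + (v + w)) \<noteq> {}" using N_empty by auto
  obtain a0 b0 where h0: "a0 \<in> B w" "b0 \<in> B w" "a0 \<le> b0" "b0 - a0 \<le> m + 2" "b0 - a0 \<ge> N (B w) - 1"
    using column_hull[OF ne(1)] by metis
  obtain a1 b1 where h1: "a1 \<in> B (v + w)" "b1 \<in> B (v + w)" "a1 \<le> b1" "b1 - a1 \<le> m + 2" "b1 - a1 \<ge> N (B (v + w)) - 1"
    using column_hull[OF ne(2)] by metis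
  obtain a2 b2 where h2: "a2 \<in> B (u + (v + w))" "b2 \<in> B (u + (v + w))" "a2 \<le> b2" "b2 - a2 \<le> m + 2"
    "b2 - a2 \<ge> N (B (u + (v + w))) - 1" using column_hull[OF ne(3)] by metis
  have h2': "a2 \<in> B ((u + v) + w)" "b2 \<in> B ((u + v) + w)" using h2 by (simp_all add: add.assoc)
  obtain k1 where k1: "\<bar>b1 - a0 - disp v - k1 * p\<bar> \<le> m + 2" using disp[OF h0(1) h1(2)] by (rule nearE)
  obtain k2 where k2: "\<bar>a1 - b0 - disp v - k2 * p\<bar> \<le> m + 2" using disp[OF h0(2) h1(1)] by (rule nearE)
  obtain k3 where k3: "\<bar>b2 - a1 - disp u - k3 * p\<bar> \<le> m + 2" using disp[OF h1(1) h2(2)] by (rule nearE)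
  obtain k4 where k4: "\<bar>a2 - b1 - disp u - k4 * p\<bar> \<le> m + 2" using disp[OF h1(2) h2(1)] by (rule nearE)
  obtain k5 where k5: "\<bar>b2 - a0 - disp (u + v) - k5 * p\<bar> \<le> m + 2" using disp[OF h0(1) h2'(2)] by (rule nearE)
  obtain k6 where k6: "\<bar>a2 - b0 - disp (u + v) - k6 * p\<bar> \<le> m + 2" using disp[OF h0(2) h2'(1)] by (rule nearE)
  have e1: "k1 = k2" using h0 h1 by (intro same_lift[OF k1 k2]) linarith+
  have e2: "k3 = k4" using h1 h2 by (intro same_lift[OF k3 k4]) linarith+
  have e3: "k5 = k6" using h0 h2 by (intro same_lift[OF k5 k6]) linarith+
  define e where "e = (disp v + k1 * p) + (disp u + k3 * p) - (disp (u + v) + k5 * p)"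
  note up = abs_le_D1[OF k1] abs_le_D1[OF k3] abs_le_D1[OF k5]
  note down = abs_le_D2[OF k2[folded e1]] abs_le_D2[OF k4[folded e2]] abs_le_D2[OF k6[folded e3]]
  have "e \<le> 9" "- e \<le> 9"
    using up down w h0(5) h1(5) h2(5) unfolding e_def by linarith+
  then have "\<bar>e\<bar> \<le> 9" by (rule abs_leI)
  moreover have "p dvd (disp u + disp v - disp (u + v)) - e"
    by (rule dvdI[of _ _ "k5 - k1 - k3"]) (simp add: e_def algebra_simps)
  ultimately show ?thesis by blast
qed

text \<open>By \<open>disp_defect\<close> the defect has a representative in \<open>{-9..9}\<close>;
  shifting by 9 around \<open>mod p\<close> selects it.\<close>

definition dfc :: "'w \<Rightarrow> 'w \<Rightarrow> int" where
  "dfc u v = (disp u + disp v - disp (u + v) + 9) mod p - 9"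

lemma dfc: "\<bar>dfc u v\<bar> \<le> 9" "p dvd (disp u + disp v - disp (u + v)) - dfc u v"
proof -
  let ?x = "disp u + disp v - disp (u + v)"
  have "p dvd (?x + 9) mod p - (?x + 9)" by (rule dvd_mod_diff)
  then show dv: "p dvd ?x - dfc u v"
    by (rule dvd_lincomb[OF _ dvd_0_right, of _ _ _ "-1" 0 0]) (simp add: dfc_def)
  obtain e where e: "\<bar>e\<bar> \<le> 9" "p dvd ?x - e" using disp_defect by blast
  have "p dvd (?x + 9) - (e + 9)" using e(2) by simp
  then have "(?x + 9) mod p = (e + 9) mod p" by (simp only: mod_eq_dvd_iff)
  also have "\<dots> = e + 9" using e(1) p_eq m_ge by (intro mod_pos_pos_trivial) auto
  finally show "\<bar>dfc u v\<bar> \<le> 9" using e(1) by (simp add: dfc_def)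
qed

lemma dfc_cong: "red u = red u' \<Longrightarrow> red v = red v' \<Longrightarrow> dfc u v = dfc u' v'"
proof -
  assume a: "red u = red u'" "red v = red v'"
  have "red (u + v) = red (u' + v')"
    using red_cong_add[OF a(1), of v] red_cong_add[OF a(2), of u'] by (simp add: add.commute)
  then show ?thesis using disp_cong a by (metis dfc_def)
qed

text \<open>Modulo \<open>p\<close> this holds for every coboundary. Both sides are at most 18 in
  absolute value, so they differ by less than \<open>p\<close> and the identity holds in the
  integers.\<close>

lemma dfc_cocycle: "dfc u v + dfc (u + v) t = dfc v t + dfc u (v + t)"
proof -
  let ?y = "(dfc u v + dfc (u + v) t) - (dfc v t + dfc u (v + t))"
  have 1: "p dvd (disp u + disp v - disp (u + v)) - dfc u v" by (rule dfc)
  have 2: "p dvd (disp (u + v) + disp t - disp (u + (v + t))) - dfc (u + v) t"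
    using dfc(2)[of "u + v" t] by (simp add: add.assoc)
  have 3: "p dvd (disp v + disp t - disp (v + t)) - dfc v t" by (rule dfc)
  have 4: "p dvd (disp u + disp (v + t) - disp (u + (v + t))) - dfc u (v + t)" by (rule dfc)
  have "p dvd ((disp v + disp t - disp (v + t)) - dfc v t) + ((disp u + disp (v + t) - disp (u + (v + t))) - dfc u (v + t))
      - (((disp u + disp v - disp (u + v)) - dfc u v) + ((disp (u + v) + disp t - disp (u + (v + t))) - dfc (u + v) t))"
    by (intro dvd_diff dvd_add 1 2 3 4)
  then have "p dvd ?y" by (simp add: algebra_simps)
  moreover have "\<bar>?y\<bar> < p"
    using dfc(1)[of u v] dfc(1)[of "u + v" t] dfc(1)[of v t] dfc(1)[of u "v + t"] p_eq m_ge by linarith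
  ultimately have "?y = 0" using p_pos dvd_imp_le_int[of ?y p] by auto
  then show ?thesis by simp
qed

text \<open>A bounded integer cocycle is the coboundary of its average. As \<open>p\<close> times every element of the
  quotient is zero, the average is an integer and the corrected displacement is additive modulo \<open>p\<close>.\<close>

theorem linear_displacement:
  shows "\<exists>g. (\<forall>u. g (red u) = g u) \<and> (\<forall>u v. p dvd g (u + v) - g u - g v) \<and>
    (\<forall>v w. \<forall>t\<in>B v. \<forall>t'\<in>B w. near (m + 11) ((t' - g w) - (t - g v)))"
proof -
  define E where "E u = (\<Sum>v\<in>W. dfc u v)" for u
  \<comment> \<open>\<open>G u / P\<close> is the displacement minus the average defect. Keeping the
    factor \<open>P\<close> avoids fractions, at the price of working modulo
    \<open>p * P\<close>.\<close>
  define G where "G u = P * disp u - E u" for u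
  have E_cong: "E u = E v" if "red u = red v" for u v
    unfolding E_def using dfc_cong[OF that refl] by simp
  have G_cong: "G u = G v" if "red u = red v" for u v
    using E_cong[OF that] disp_cong[OF that] by (simp add: G_def)
  have E_add: "E u + E v - E (u + v) = P * dfc u v" for u v
  proof -
    have "(\<Sum>t\<in>W. dfc u v + dfc (u + v) t) = (\<Sum>t\<in>W. dfc v t + dfc u (t + v))"
      using dfc_cocycle[of u v] by (simp add: add.commute)
    moreover have "(\<Sum>t\<in>W. dfc u (t + v)) = E u"
      unfolding E_def by (rule sum_shift) (rule dfc_cong[OF refl red_red])
    ultimately show ?thesis by (simp add: sum.distrib E_def)
  qed
  have G_add: "p * P dvd G (u + v) - G u - G v" for u v
  proof -
    have "G (u + v) - G u - G v = - (P * ((disp u + disp v - disp (u + v)) - dfc u v))"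
      using E_add[of u v] by (simp add: G_def algebra_simps)
    moreover have "P * p dvd P * ((disp u + disp v - disp (u + v)) - dfc u v)"
      using dfc(2) by (rule mult_dvd_mono[OF dvd_refl])
    ultimately show ?thesis by (simp add: mult.commute)
  qed
  have G0: "p * P dvd G 0" using G_add[of 0 0] by simp
  have G_iter: "p * P dvd G (((+) u ^^ j) 0) - int j * G u" for u j
  proof (induction j)
    case (Suc j)
    have "p * P dvd (G (u + ((+) u ^^ j) 0) - G u - G (((+) u ^^ j) 0)) + (G (((+) u ^^ j) 0) - int j * G u)"
      using G_add Suc by (rule dvd_add)
    moreover have "(G (u + ((+) u ^^ j) 0) - G u - G (((+) u ^^ j) 0)) + (G (((+) u ^^ j) 0) - int j * G u)
      = G (((+) u ^^ Suc j) 0) - int (Suc j) * G u" by (simp add: distrib_right)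
    ultimately show ?case by (simp only:)
  qed (use G0 in simp)
  have P_dvd: "P dvd G u" for u
  proof -
    have "p * P dvd G (((+) u ^^ nat p) 0) - p * G u" using G_iter[where u = u and j = "nat p"] p_pos by simp
    moreover have "G (((+) u ^^ nat p) 0) = G 0" using torsion by (rule G_cong)
    ultimately have "p * P dvd G 0 - (G 0 - p * G u)" using G0 by (simp only: dvd_diff)
    then show ?thesis using p_pos by simp
  qed
  define g where "g u = G u div P" for u
  have g: "P * g u = G u" for u using P_dvd by (simp add: g_def)
  have g_add: "p dvd g (u + v) - g u - g v" for u v
  proof -
    have "P * (g (u + v) - g u - g v) = G (u + v) - G u - G v" by (simp only: right_diff_distrib g)
    then have "P * p dvd P * (g (u + v) - g u - g v)" using G_add[of u v] by (simp only: mult.commute[of P p])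
    then show ?thesis using P_pos by simp
  qed
  \<comment> \<open>The correction is an average of \<open>P\<close> numbers of absolute value at
    most 9, which turns the error m + 2 into m + 11.\<close>
  have h: "\<bar>disp u - g u\<bar> \<le> 9" for u
  proof -
    have "\<bar>E u\<bar> \<le> (\<Sum>v\<in>W. \<bar>dfc u v\<bar>)" unfolding E_def by (rule sum_abs)
    also have "\<dots> \<le> (\<Sum>v\<in>W. 9)" by (intro sum_mono dfc)
    finally have "\<bar>P * (disp u - g u)\<bar> \<le> P * 9" using g[of u] by (simp add: G_def right_diff_distrib)
    then show ?thesis using P_pos by (simp add: abs_mult)
  qed
  show ?thesis
  proof (intro exI[of _ g] conjI allI ballI)
    show "g (red u) = g u" for u using G_cong[OF red_red] by (simp add: g_def)
    show "p dvd g (u + v) - g u - g v" for u v by (rule g_add)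
    fix v w t t' assume t: "t \<in> B v" "t' \<in> B w"
    have "near (m + 2) (t' - t - disp (w - v))" using t by (intro disp[of t v]) simp_all
    then have "near (m + 2 + 9) ((t' - t - disp (w - v)) + (disp (w - v) - g (w - v)))"
      using h by (rule near_add)
    moreover have "m + 2 + 9 = m + 11" by simp
    moreover have "p dvd ((t' - g w) - (t - g v)) - ((t' - t - disp (w - v)) + (disp (w - v) - g (w - v)))"
      using g_add[of "w - v" v] by (rule dvd_lincomb[OF _ dvd_0_right, of _ _ _ "-1" 0 0]) simp
    ultimately show "near (m + 11) ((t' - g w) - (t - g v))" using near_cong by (simp only:)
  qed
qed

end

subsection \<open>Slices of a sum-free set in a window\<close>

text \<open>\<open>S x\<close> is the slice at first coordinate \<open>x\<close>; \<open>diameter\<close> and \<open>mass\<close> come from the columns.\<close>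

locale slices = modulus p + quotient_map red
  for p :: int and red :: "'w :: ab_group_add \<Rightarrow> 'w" +
  fixes m :: int and pos :: bool and S :: "int \<Rightarrow> 'w set" and c H :: int
  assumes p_eq: "p = 5 * m + 3" and m_ge: "m \<ge> 21"
    and torsion: "red (((+) v ^^ nat p) 0) = red 0"
    and S_red: "red v \<in> S x \<longleftrightarrow> v \<in> S x"
    and S_cong: "p dvd x - y \<Longrightarrow> S x = S y"
    and free: "p dvd x1 + x2 + x3 + sg pos x4 - x5 \<Longrightarrow> v1 \<in> S x1 \<Longrightarrow> v2 \<in> S x2 \<Longrightarrow> v3 \<in> S x3 \<Longrightarrow> v4 \<in> S x4 \<Longrightarrow>
      v1 + v2 + v3 + sg pos v4 \<notin> S x5"
    and support: "S x \<noteq> {} \<Longrightarrow> \<exists>k. x + k * p \<in> {c..c + H}"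
    and ends: "S c \<noteq> {}" "S (c + H) \<noteq> {}"
    and H_bounds: "0 \<le> H" "H \<le> m + 11"
    and diameter: "v \<in> S (c + i) \<Longrightarrow> v \<in> S (c + j) \<Longrightarrow> 0 \<le> i \<Longrightarrow> i \<le> j \<Longrightarrow> j \<le> H \<Longrightarrow> j - i \<le> m + 2"
    and mass: "(\<Sum>i\<in>{0..H}. (\<Sum>w\<in>W. of_bool (w \<in> S (c + i)))) \<ge> m * P"
begin

definition sz :: "int \<Rightarrow> int" where
  "sz x = (\<Sum>w\<in>W. of_bool (w \<in> S x))"

abbreviation "A i \<equiv> sz (c + i)"

lemma S_add_red: "red w + u \<in> S x \<longleftrightarrow> w + u \<in> S x"
  using S_red[of "red w + u" x] S_red[of "w + u" x] by (simp add: red_add)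

lemma sz_shift: "(\<Sum>w\<in>W. of_bool (w + u \<in> S x)) = sz x"
  unfolding sz_def by (rule sum_shift) (simp add: S_red)

lemma sz_reflect: "(\<Sum>w\<in>W. of_bool (u - w \<in> S x)) = sz x"
  unfolding sz_def by (rule sum_reflect) (simp add: S_red)

lemma sz_le: "sz x \<le> P"
proof -
  have "sz x \<le> (\<Sum>w\<in>W. 1)" unfolding sz_def by (intro sum_mono) simp
  then show ?thesis by simp
qed

lemma sz_full: "sz x \<ge> P \<Longrightarrow> S x = UNIV"
proof (rule ccontr)
  assume le: "sz x \<ge> P" and "S x \<noteq> UNIV"
  then obtain v where v: "v \<notin> S x" by auto
  have "sz x < (\<Sum>w\<in>W. 1)" unfolding sz_def
    using finite_range v S_red[of v x] by (intro sum_strict_mono_ex1) (auto intro!: bexI[of _ "red v"])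
  then show False using le by simp
qed

text \<open>One element from each of three slices is enough: their signed sum translates
  \<open>S x1\<close> off \<open>S x5\<close>, so both sizes fit into one copy of the
  quotient.\<close>

lemma sz_pair:
  assumes "p dvd x1 + x2 + x3 + sg pos x4 - x5" "S x2 \<noteq> {}" "S x3 \<noteq> {}" "S x4 \<noteq> {}"
  shows "sz x1 + sz x5 \<le> P"
proof -
  obtain v2 v3 v4 where v: "v2 \<in> S x2" "v3 \<in> S x3" "v4 \<in> S x4" using assms by blast
  define u where "u = v2 + v3 + sg pos v4"
  have "of_bool (w \<in> S x1) + of_bool (w + u \<in> S x5) \<le> (1::int)" for w
    using free[OF assms(1), of w v2 v3 v4] v by (auto simp: u_def add.assoc)
  then have "(\<Sum>w\<in>W. of_bool (w \<in> S x1) + of_bool (w + u \<in> S x5)) \<le> (\<Sum>w\<in>W. (1::int))" by (rule sum_mono)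
  then show ?thesis using sz_shift[of u x5] by (simp add: sum.distrib sz_def[symmetric])
qed

text \<open>
  Write positions in the window as \<open>c + a\<close> when they enter \<open>x1 + x2 + x3 + sg pos x4 - x5\<close> with a plus
  sign and as \<open>c + H - a\<close> otherwise. The sum vanishes modulo \<open>p\<close> iff the five numbers \<open>a\<close> add up to
  \<open>offset\<close>.
\<close>

definition offset :: int where
  "offset = (if pos then H - 3 * c else 2 * H - c)"

text \<open>The end slices are known to be nonempty, so the other three positions are put there:
  \<open>j\<close> of them have \<open>a = H\<close> and the rest have \<open>a = 0\<close>.\<close>

lemma pair_at_offset:
  assumes "p dvd a + b + j * H - offset" "j \<in> {0, 1, 2, 3}"
  shows "A a + A (H - b) \<le> P"
proof -
  obtain o2 o3 o4 where o: "o2 \<in> {0, H}" "o3 \<in> {0, H}" "o4 \<in> {0, H}" "o2 + o3 + o4 = j * H"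
  proof -
    consider "j = 0" | "j = 1" | "j = 2" | "j = 3" using assms(2) by auto
    then show ?thesis
      by cases (rule that[of 0 0 0] that[of H 0 0] that[of H H 0] that[of H H H]; simp)+
  qed
  have ne: "S (c + o2) \<noteq> {}" "S (c + o3) \<noteq> {}" "S (c + o4) \<noteq> {}" "S (c + H - o4) \<noteq> {}"
    using o ends by auto
  show ?thesis
  proof (cases pos)
    case True
    have "(c + a) + (c + o2) + (c + o3) + sg pos (c + o4) - (c + (H - b)) = a + b + j * H - offset"
      unfolding offset_def using o(4) True by (simp add: sg_def)
    then have "p dvd (c + a) + (c + o2) + (c + o3) + sg pos (c + o4) - (c + (H - b))"
      using assms(1) by (simp only:)
    then show ?thesis using ne by (intro sz_pair)
  next
    case False
    have "(c + a) + (c + o2) + (c + o3) + sg pos (c + H - o4) - (c + (H - b)) = a + b + j * H - offset"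
      unfolding offset_def using o(4) False by (simp add: sg_def)
    then have "p dvd (c + a) + (c + o2) + (c + o3) + sg pos (c + H - o4) - (c + (H - b))"
      using assms(1) by (simp only:)
    then show ?thesis using ne by (intro sz_pair)
  qed
qed

lemma mass': "(\<Sum>i\<in>{0..H}. A i) \<ge> m * P"
  using mass by (simp add: sz_def)

lemma H_ge: "H \<ge> m - 1"
proof -
  have "(\<Sum>i\<in>{0..H}. A i) \<le> (\<Sum>i\<in>{0..H}. P)" by (intro sum_mono sz_le)
  then have "P * m \<le> P * (H + 1)" using mass' H_bounds by (simp add: algebra_simps)
  then show ?thesis using P_pos by simp
qed

lemma sum_reverse: "(\<Sum>i\<in>{0..T}. F (T - i)) = (\<Sum>i\<in>{0..T::int}. (F i :: int))"
  by (rule sum.reindex_bij_witness[of _ "\<lambda>i. T - i" "\<lambda>i. T - i"]) auto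

text \<open>\<open>F\<close> stands for the positions occupied by one column. If it meets both sides
  of the middle \<open>{H - T..T}\<close>, the diameter bound puts it together with the whole middle
  into m + 3 consecutive places; otherwise it leaves the middle on one side only, where there are
  \<open>H - T\<close> places.\<close>

lemma few_outside:
  assumes F: "F \<subseteq> {0..H}" "\<And>i j. i \<in> F \<Longrightarrow> j \<in> F \<Longrightarrow> i \<le> j \<Longrightarrow> j - i \<le> m + 2"
    and T: "T \<le> H" "H \<le> 2 * T"
  shows "int (card (F - {H - T..T})) \<le> max (H - T) (m + 2 - 2 * T + H)"
proof -
  have fF: "finite F" using F(1) finite_subset by blast
  show ?thesis
  proof (cases "(\<exists>i\<in>F. i < H - T) \<and> (\<exists>j\<in>F. j > T)")
    case True
    then obtain i j where ij: "i \<in> F" "i < H - T" "j \<in> F" "j > T" by auto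
    define a where "a = Min F"
    have "F \<noteq> {}" using ij by auto
    then have a: "a \<in> F" "\<And>x. x \<in> F \<Longrightarrow> a \<le> x" using fF Min_in[of F] by (auto simp: a_def)
    have win: "F \<subseteq> {a..a + m + 2}" using a F(2)[OF a(1)] by fastforce
    have sub: "{H - T..T} \<subseteq> {a..a + m + 2}" using a(2)[OF ij(1)] win ij by auto
    have "card (F - {H - T..T}) \<le> card ({a..a + m + 2} - {H - T..T})"
      using win by (intro card_mono) auto
    also have "\<dots> = card {a..a + m + 2} - card {H - T..T}" using sub by (intro card_Diff_subset) auto
    finally have "int (card (F - {H - T..T})) \<le> (m + 3) - (2 * T - H + 1)"
      using T m_ge card_mono[OF _ sub] by (simp add: of_nat_diff)
    then show ?thesis by linarith
  next
    case False
    then consider "\<forall>i\<in>F. i \<ge> H - T" | "\<forall>j\<in>F. j \<le> T" by force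
    then have "int (card (F - {H - T..T})) \<le> H - T"
    proof cases
      case 1
      then have "card (F - {H - T..T}) \<le> card {T<..H}" using F(1) by (intro card_mono) auto
      then show ?thesis using T by simp
    next
      case 2
      then have "card (F - {H - T..T}) \<le> card {0..<H - T}" using F(1) by (intro card_mono) auto
      then show ?thesis using T by simp
    qed
    then show ?thesis by linarith
  qed
qed

text \<open>Summing the pair inequality along \<open>a + b = T\<close> bounds the first
  \<open>T + 1\<close> and the last \<open>T + 1\<close> slices together by
  \<open>(T + 1) * P\<close>. If these ranges are disjoint, the slices in between add at most
  \<open>(H - 2 * T - 1) * P\<close>, too little for the mass. If they overlap, the middle is
  counted twice and a column has few positions outside it.\<close>

lemma no_antidiagonal:
  assumes T: "H - m + 1 \<le> T" "T \<le> H" and pair: "\<And>a. 0 \<le> a \<Longrightarrow> a \<le> T \<Longrightarrow> A a + A (H - (T - a)) \<le> P"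
  shows False
proof -
  have T0: "T \<ge> 0" using T H_ge by linarith
  have le: "(\<Sum>i\<in>{0..T}. A i) + (\<Sum>i\<in>{0..T}. A (H - i)) \<le> (T + 1) * P"
  proof -
    have "(\<Sum>i\<in>{0..T}. A i + A (H - (T - i))) \<le> (\<Sum>i\<in>{0..T}. P)" using pair by (intro sum_mono) auto
    then show ?thesis using T0 sum_reverse[of "\<lambda>i. A (H - i)" T] by (simp add: sum.distrib)
  qed
  have top: "(\<Sum>i\<in>{0..T}. A (H - i)) = (\<Sum>i\<in>{H - T..H}. A i)"
    by (rule sum.reindex_bij_witness[of _ "\<lambda>i. H - i" "\<lambda>i. H - i"]) auto
  show False
  proof (cases "2 * T < H")
    case True
    have "{0..H} = {0..T} \<union> ({T<..<H - T} \<union> {H - T..H})" using True T T0 by auto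
    then have "(\<Sum>i\<in>{0..H}. A i) = (\<Sum>i\<in>{0..T}. A i) + ((\<Sum>i\<in>{T<..<H - T}. A i) + (\<Sum>i\<in>{H - T..H}. A i))"
      using True T T0 by (simp only:) (subst sum.union_disjoint; (subst sum.union_disjoint)?; auto)+
    moreover have "(\<Sum>i\<in>{T<..<H - T}. A i) \<le> (\<Sum>i\<in>{T<..<H - T}. P)" by (intro sum_mono sz_le)
    moreover have "(\<Sum>i\<in>{T<..<H - T}. P) = (H - 2 * T - 1) * P" using True by simp
    ultimately have "m * P \<le> (T + 1) * P + (H - 2 * T - 1) * P" using mass' le top by linarith
    then have "P * m \<le> P * (H - T)" by (simp add: algebra_simps)
    then have "m \<le> H - T" using P_pos by simp
    then show False using T by simp
  next
    case False
    \<comment> \<open>Count by columns: a column has at most \<open>K\<close> positions outside the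
      overlap, so its contributions to the two ranges add up to at least twice its size minus
      \<open>K\<close>.\<close>
    define F where "F w = {i \<in> {0..H}. w \<in> S (c + i)}" for w
    define K where "K = max (H - T) (m + 2 - 2 * T + H)"
    have F_le: "2 * int (card (F w)) - K \<le> int (card (F w \<inter> {0..T})) + int (card (F w \<inter> {H - T..H}))" for w
    proof -
      have fF: "finite (F w)" by (rule finite_subset[of _ "{0..H}"]) (auto simp: F_def)
      have "int (card (F w - {H - T..T})) \<le> K" unfolding K_def
        using diameter T False by (intro few_outside) (auto simp: F_def)
      moreover have "card (F w) = card (F w - {H - T..T}) + card (F w \<inter> {H - T..T})"
        using card_Int_Diff[OF fF, of "{H - T..T}"] by simp
      moreover have "card (F w \<inter> {0..T}) + card (F w \<inter> {H - T..H}) = card (F w) + card (F w \<inter> {H - T..T})"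
      proof -
        have "(F w \<inter> {0..T}) \<union> (F w \<inter> {H - T..H}) = F w" using T False by (auto simp: F_def)
        moreover have "(F w \<inter> {0..T}) \<inter> (F w \<inter> {H - T..H}) = F w \<inter> {H - T..T}" using T False by (auto simp: F_def)
        ultimately show ?thesis using card_Un_Int[of "F w \<inter> {0..T}" "F w \<inter> {H - T..H}"] fF by simp
      qed
      ultimately show ?thesis by linarith
    qed
    have sum_F: "(\<Sum>w\<in>W. int (card (F w \<inter> I))) = (\<Sum>i\<in>I. A i)" if "I \<subseteq> {0..H}" for I
    proof -
      have fI: "finite I" using that finite_subset by blast
      have "int (card (F w \<inter> I)) = (\<Sum>i\<in>I. of_bool (w \<in> S (c + i)))" for w
      proof -
        have "F w \<inter> I = {i \<in> I. w \<in> S (c + i)}" using that by (auto simp: F_def)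
        then show ?thesis using fI by (simp add: Int_def)
      qed
      then show ?thesis unfolding sz_def by (simp add: sum.swap[of _ I])
    qed
    have "(\<Sum>w\<in>W. 2 * int (card (F w)) - K) \<le> (\<Sum>w\<in>W. int (card (F w \<inter> {0..T})) + int (card (F w \<inter> {H - T..H})))"
      by (intro sum_mono F_le)
    also have "\<dots> \<le> (T + 1) * P" using sum_F[of "{0..T}"] sum_F[of "{H - T..H}"] T False T0 le top
      by (simp add: sum.distrib)
    finally have "(\<Sum>w\<in>W. 2 * int (card (F w)) - K) \<le> (T + 1) * P" .
    moreover have "(\<Sum>w\<in>W. int (card (F w))) = (\<Sum>i\<in>{0..H}. A i)"
    proof -
      have "F w \<inter> {0..H} = F w" for w by (auto simp: F_def)
      then show ?thesis using sum_F[of "{0..H}"] by simp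
    qed
    ultimately have "2 * (m * P) - P * K \<le> (T + 1) * P"
      using mass' by (simp add: sum_subtractf sum_distrib_left[symmetric])
    then have "P * (2 * m - K) \<le> P * (T + 1)" by (simp add: algebra_simps)
    then have "2 * m - K \<le> T + 1" using P_pos by simp
    \<comment> \<open>If \<open>K = H - T\<close> this says 2m <= H + 1; otherwise it says m <= H -
      T + 3, which is at most H / 2 + 3. Both fail for H <= m + 11 and m >= 21.\<close>
    then show False using T False H_bounds m_ge unfolding K_def by linarith
  qed
qed

text \<open>Placing \<open>j\<close> of the remaining three elements at \<open>H\<close> subtracts
  \<open>j * H\<close> from \<open>\<tau>\<close> and brings it within m - 1 of \<open>H\<close>.
  Reversing both coordinates exchanges \<open>T\<close> with \<open>2 * H - T\<close>, so that
  \<open>no_antidiagonal\<close> applies on either side of \<open>H\<close>.\<close>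

lemma no_offset:
  assumes "H - m + 1 \<le> \<tau>" "\<tau> \<le> 4 * H + m - 1"
  shows "\<not> p dvd \<tau> - offset"
proof
  assume dv: "p dvd \<tau> - offset"
  obtain j where j: "j \<in> {0, 1, 2, 3}" "H - m + 1 \<le> \<tau> - j * H" "\<tau> - j * H \<le> H + m - 1"
  proof -
    consider "\<tau> \<le> H + m - 1" | "H + m - 1 < \<tau>" "\<tau> \<le> 2 * H + m - 1"
      | "2 * H + m - 1 < \<tau>" "\<tau> \<le> 3 * H + m - 1" | "3 * H + m - 1 < \<tau>" by linarith
    then show ?thesis
    proof cases
      case 1 then show ?thesis using that[of 0] assms by simp
    next
      case 2 then show ?thesis using that[of 1] H_bounds m_ge by simp
    next
      case 3 then show ?thesis using that[of 2] H_bounds m_ge by simp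
    next
      case 4 then show ?thesis using that[of 3] H_bounds m_ge assms by simp
    qed
  qed
  define T where "T = \<tau> - j * H"
  have pair: "A a + A (H - b) \<le> P" if "a + b = T" for a b
  proof (rule pair_at_offset[OF _ j(1)])
    have "a + b + j * H = \<tau>" using that by (simp add: T_def)
    then show "p dvd a + b + j * H - offset" using dv by simp
  qed
  show False
  proof (cases "T \<le> H")
    case True
    show ?thesis
    proof (rule no_antidiagonal[of T])
      show "A a + A (H - (T - a)) \<le> P" for a by (rule pair) simp
    qed (use True j in \<open>auto simp: T_def\<close>)
  next
    case False
    show ?thesis
    proof (rule no_antidiagonal[of "2 * H - T"])
      show "A a + A (H - (2 * H - T - a)) \<le> P" for a
        using pair[of "T - H + a" "H - a"] by (simp add: algebra_simps)
    qed (use False j in \<open>auto simp: T_def\<close>)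
  qed
qed

text \<open>The offset has a representative \<open>\<tau>\<close> among the \<open>p\<close>
  integers that start at H - m + 1. By \<open>no_offset\<close> it is at least 4H + m, but it is at
  most H + 4m + 3; hence H <= m + 1, and \<open>d\<close> lists the values left.\<close>

lemma offset_cases:
  obtains "H = m - 1" "\<exists>d\<in>{1..7}. p dvd offset - (5 * m - 5 + d)"
  | "H = m" "\<exists>d\<in>{0..3}. p dvd offset - (5 * m + d)"
  | "H = m + 1" "p dvd offset - 1"
proof -
  define L where "L = H - m + 1"
  define \<tau> where "\<tau> = L + (offset - L) mod p"
  have \<tau>: "L \<le> \<tau>" "\<tau> < L + p" using p_pos by (auto simp: \<tau>_def)
  have dv: "p dvd \<tau> - offset"
    by (rule dvd_lincomb[OF dvd_mod_diff[of p "offset - L"] dvd_0_right, of _ 1 0 0]) (simp add: \<tau>_def)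
  then have dv': "p dvd offset - \<tau>" using dvd_minus_iff[of p "\<tau> - offset"] by simp
  have gt: "\<tau> > 4 * H + m - 1" using no_offset[of \<tau>] \<tau> dv unfolding L_def by linarith
  then have "H \<le> m + 1" using \<tau> p_eq unfolding L_def by linarith
  then consider "H = m - 1" | "H = m" | "H = m + 1" using H_ge by linarith
  then show ?thesis
  proof cases
    case 1
    have "\<exists>d\<in>{1..7}. p dvd offset - (5 * m - 5 + d)"
      using gt \<tau> dv' 1 p_eq unfolding L_def by (intro bexI[of _ "\<tau> - (5 * m - 5)"]) auto
    then show ?thesis using that 1 by blast
  next
    case 2
    have "\<exists>d\<in>{0..3}. p dvd offset - (5 * m + d)"
      using gt \<tau> dv' 2 p_eq unfolding L_def by (intro bexI[of _ "\<tau> - 5 * m"]) auto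
    then show ?thesis using that 2 by blast
  next
    case 3
    then have "\<tau> = 5 * m + 4" using gt \<tau> p_eq unfolding L_def by linarith
    then have "p dvd (offset - \<tau>) + p * 1" using dv' by simp
    moreover have "(offset - \<tau>) + p * 1 = offset - 1" using \<open>\<tau> = 5 * m + 4\<close> p_eq by simp
    ultimately have "p dvd offset - 1" by (simp only:)
    then show ?thesis using that(3) 3 by blast
  qed
qed

end

section \<open>Subgroups of the base and the structure of extremal windows\<close>

lemma funpow_plus_add: "((+) (x :: 'a :: comm_monoid_add) ^^ (i + j)) 0 = ((+) x ^^ i) 0 + ((+) x ^^ j) 0"
  by (induction i) (simp_all add: add.assoc)

lemma funpow_plus_mult: "((+) (x :: 'a :: comm_monoid_add) ^^ (i * j)) 0 = ((+) (((+) x ^^ i) 0) ^^ j) 0"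
  by (induction j) (simp_all add: funpow_plus_add)

context slices
begin

text \<open>A subgroup of the quotient, encoded as its full preimage in the type; slices are full
  preimages as well.\<close>

definition sub :: "'w set \<Rightarrow> bool" where
  "sub V \<longleftrightarrow> 0 \<in> V \<and> (\<forall>x\<in>V. \<forall>y\<in>V. x - y \<in> V) \<and> (\<forall>x. red x \<in> V \<longleftrightarrow> x \<in> V)"

lemma sub_diff: "sub V \<Longrightarrow> x \<in> V \<Longrightarrow> y \<in> V \<Longrightarrow> x - y \<in> V"
  and sub_uminus: "sub V \<Longrightarrow> x \<in> V \<Longrightarrow> - x \<in> V"
  and sub_add: "sub V \<Longrightarrow> x \<in> V \<Longrightarrow> y \<in> V \<Longrightarrow> x + y \<in> V"
proof -
  show d: "sub V \<Longrightarrow> x \<in> V \<Longrightarrow> y \<in> V \<Longrightarrow> x - y \<in> V" for x y by (simp add: sub_def)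
  show u: "sub V \<Longrightarrow> x \<in> V \<Longrightarrow> - x \<in> V" for x using d[of 0 x] by (simp add: sub_def)
  show "sub V \<Longrightarrow> x \<in> V \<Longrightarrow> y \<in> V \<Longrightarrow> x + y \<in> V" using d[of x "- y"] u[of y] by simp
qed

lemma sub_funpow: "sub V \<Longrightarrow> x \<in> V \<Longrightarrow> ((+) x ^^ j) 0 \<in> V"
  by (induction j) (auto simp: sub_def intro: sub_add)

text \<open>The quotient by \<open>V\<close> is killed by \<open>p\<close>, hence has no
  \<open>n\<close>-torsion for \<open>n\<close> coprime to \<open>p\<close>. Multiples are iterates
  of addition because the type is only a group.\<close>

lemma sub_divide:
  assumes V: "sub V" and x: "((+) x ^^ n) 0 \<in> V" and n: "coprime n (nat p)"
  shows "x \<in> V"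
proof -
  have "nat p \<noteq> 1" using p_gt_1 by simp
  then obtain a b where ab: "n * a = nat p * b + 1" using coprime_bezout_strong[OF n] by auto
  have "((+) x ^^ nat p) 0 \<in> V" using V torsion[of x] unfolding sub_def by metis
  then have 1: "((+) x ^^ (nat p * b)) 0 \<in> V" using sub_funpow[OF V] by (simp add: funpow_plus_mult)
  have "((+) x ^^ (n * a)) 0 \<in> V" using sub_funpow[OF V x] by (simp add: funpow_plus_mult)
  then have "((+) x ^^ (nat p * b)) 0 + ((+) x ^^ 1) 0 \<in> V" unfolding ab funpow_plus_add .
  then show ?thesis using sub_diff[OF V _ 1] by fastforce
qed

lemma coprime_small: "n \<in> {2, 3} \<Longrightarrow> coprime n (nat p)"
proof -
  assume n: "n \<in> {2, 3}"
  have pr: "prime (nat p)" using prime prime_int_nat_transfer by blast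
  have "n < nat p" "0 < n" using n p_eq m_ge by auto
  then have "\<not> nat p dvd n" by (rule nat_dvd_not_less[rotated])
  then have "coprime (nat p) n" by (rule prime_imp_coprime[OF pr])
  then show ?thesis by (simp only: coprime_commute)
qed

text \<open>The equality case of disjointness: a translate of \<open>S y\<close> that misses
  \<open>S x\<close> and is large enough has to be its complement.\<close>

lemma sz_subset_eq:
  assumes "\<And>v. v \<in> S x \<Longrightarrow> v + k \<notin> S y" "sz x + sz y \<ge> P"
  shows "v \<in> S x \<longleftrightarrow> v + k \<notin> S y"
proof (rule ccontr)
  assume neq: "\<not> ?thesis"
  then have v: "v \<notin> S x" "v + k \<notin> S y" using assms(1) by auto
  have le: "of_bool (w \<in> S x) + of_bool (w + k \<in> S y) \<le> (1::int)" for w using assms(1) by auto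
  have "(\<Sum>w\<in>W. of_bool (w \<in> S x) + of_bool (w + k \<in> S y)) < (\<Sum>w\<in>W. (1::int))"
    using finite_range le v S_red[of v x] S_add_red[of v k y]
    by (intro sum_strict_mono_ex1) (auto intro!: bexI[of _ "red v"])
  then show False using sz_shift[of k y] assms(2) by (simp add: sum.distrib sz_def[symmetric])
qed

text \<open>By the size condition \<open>S y\<close> is the complement of \<open>S x + w + l\<close>
  for every \<open>w\<close> in \<open>S x\<close>. So the translates of \<open>S x\<close> by its
  own elements all coincide, which makes \<open>S x\<close> a coset of its stabiliser.\<close>

lemma coset:
  assumes free2: "\<forall>v\<in>S x. \<forall>w\<in>S x. v + w + l \<notin> S y"
    and size: "sz x + sz y \<ge> P" and u: "u \<in> S x"
  defines "V \<equiv> {v. v + u \<in> S x}"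
  shows "sub V" "S x = {v. v - u \<in> V}" "S y = {v. v - (u + u + l) \<notin> V}"
proof -
  have eq: "v \<in> S x \<longleftrightarrow> v + (w + l) \<notin> S y" if "w \<in> S x" for v w
  proof (rule sz_subset_eq[OF _ size])
    show "v + (w + l) \<notin> S y" if v: "v \<in> S x" for v
      using bspec[OF bspec[OF free2 v] \<open>w \<in> S x\<close>] by (simp add: add.assoc)
  qed
  have trans: "v - w + u \<in> S x \<longleftrightarrow> v \<in> S x" if "w \<in> S x" for v w
    using eq[OF that, of "v - w + u"] eq[OF u, of v] by (simp add: algebra_simps)
  show "sub V" unfolding sub_def
  proof (intro conjI ballI allI)
    show "0 \<in> V" using u by (simp add: V_def)
    fix a b assume "a \<in> V" "b \<in> V"
    then show "a - b \<in> V" using trans[of "b + u" "a + u"] by (simp add: V_def algebra_simps)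
  next
    fix a show "red a \<in> V \<longleftrightarrow> a \<in> V" by (simp add: V_def S_add_red)
  qed
  show "S x = {v. v - u \<in> V}" by (simp add: V_def)
  have "v \<in> S y \<longleftrightarrow> v - (u + u + l) \<notin> V" for v
    using eq[OF u, of "v - (u + l)"] by (simp add: V_def algebra_simps)
  then show "S y = {v. v - (u + u + l) \<notin> V}" by blast
qed

text \<open>The slices in \<open>I\<close> have to carry at least \<open>(m - k) * P\<close>, and
  there are at most \<open>m - k\<close> of them, so none can have a gap.\<close>

lemma all_full:
  assumes "I \<subseteq> {0..H}" "(\<Sum>i\<in>{0..H} - I. A i) \<le> k * P" "int (card I) + k \<le> m" "i \<in> I"
  shows "S (c + i) = UNIV"
proof -
  have fI: "finite I" using assms(1) finite_subset by blast
  have "(\<Sum>i\<in>{0..H}. A i) = (\<Sum>i\<in>{0..H} - I. A i) + (\<Sum>i\<in>I. A i)"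
    using assms(1) by (intro sum.subset_diff) auto
  then have "m * P \<le> k * P + (\<Sum>i\<in>I. A i)" using mass' assms(2) by linarith
  moreover have "(\<Sum>j\<in>I. A j) = A i + (\<Sum>j\<in>I - {i}. A j)" using fI assms(4) by (rule sum.remove)
  moreover have "(\<Sum>j\<in>I - {i}. A j) \<le> (\<Sum>j\<in>I - {i}. P)" by (intro sum_mono sz_le)
  moreover have "(\<Sum>j\<in>I - {i}. P) = (int (card I) - 1) * P"
  proof -
    have "card I \<ge> 1" using assms(4) fI by (metis One_nat_def Suc_leI card_gt_0_iff empty_iff)
    then show ?thesis using assms(4) by (simp add: of_nat_diff)
  qed
  moreover have "(int (card I) + k) * P \<le> m * P" using assms(3) P_pos by (intro mult_right_mono) auto
  ultimately have "A i \<ge> P" by (simp add: algebra_simps)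
  then show ?thesis by (rule sz_full)
qed

lemma shortest: "H = m - 1 \<Longrightarrow> i \<in> {0..m - 1} \<Longrightarrow> S (c + i) = UNIV"
  using all_full[of "{0..m - 1}" 0 i] m_ge by simp

lemma dvd_offset_cong: "p dvd offset - x \<Longrightarrow> z = a * x + p * b - a * offset \<Longrightarrow> p dvd z"
  by (rule dvd_lincomb[of p "offset - x" 0 z "- a" 0 b]) (simp_all add: algebra_simps)

lemma middle_pair:
  assumes "H = m" "p dvd offset - 5 * m"
  shows "A 0 + A m \<le> P"
proof -
  have "A m + A (H - m) \<le> P"
  proof (rule pair_at_offset[of _ _ 3])
    show "p dvd m + m + 3 * H - offset"
      by (rule dvd_offset_cong[OF assms(2), of _ 1 0]) (simp add: assms(1))
  qed simp
  then show ?thesis using assms(1) by simp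
qed

lemma longest_pairs:
  assumes "H = m + 1" "p dvd offset - 1"
  shows "A 0 + A m \<le> P" "A 1 + A (m + 1) \<le> P"
proof -
  have "A 0 + A (H - 1) \<le> P" "A 1 + A (H - 0) \<le> P"
    by (rule pair_at_offset[of _ _ 0]; use dvd_offset_cong[OF assms(2), of "1 - offset" 1 0] in auto)+
  then show "A 0 + A m \<le> P" "A 1 + A (m + 1) \<le> P" using assms(1) by simp_all
qed

lemma interior_le: "a \<le> b + 1 \<Longrightarrow> (\<Sum>i\<in>{a..b}. A i) \<le> (b - a + 1) * P"
proof -
  assume "a \<le> b + 1"
  moreover have "(\<Sum>i\<in>{a..b}. A i) \<le> (\<Sum>i\<in>{a..b}. P)" by (intro sum_mono sz_le)
  ultimately show ?thesis by simp
qed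

lemma sum_middle: "H = m \<Longrightarrow> (\<Sum>i\<in>{0..H}. A i) = A 0 + A m + (\<Sum>i\<in>{1..m - 1}. A i)"
proof -
  assume "H = m"
  then have "{0..H} = insert 0 (insert m {1..m - 1})" using m_ge by auto
  then show ?thesis using m_ge by (simp add: add.assoc)
qed

lemma sum_longest:
  "H = m + 1 \<Longrightarrow> (\<Sum>i\<in>{0..H}. A i) = (A 0 + A m) + (A 1 + A (m + 1)) + (\<Sum>i\<in>{2..m - 1}. A i)"
proof -
  assume "H = m + 1"
  then have "{0..H} = insert 0 (insert 1 (insert m (insert (m + 1) {2..m - 1})))" using m_ge by auto
  then show ?thesis using m_ge by (simp add: add_ac)
qed

text \<open>Two slices tied by a pair inequality count as one full slice. Together with
  \<open>mass'\<close> this determines the size exactly, as the definitions of the types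
  require.\<close>

lemma total_le:
  assumes "H = m - 1 \<or> H = m \<and> p dvd offset - 5 * m \<or> H = m + 1 \<and> p dvd offset - 1"
  shows "(\<Sum>i\<in>{0..H}. A i) \<le> m * P"
  using assms
proof (elim disjE conjE)
  assume H: "H = m - 1"
  then show ?thesis using interior_le[of 0 "m - 1"] m_ge by simp
next
  assume H: "H = m" "p dvd offset - 5 * m"
  then show ?thesis using interior_le[of 1 "m - 1"] m_ge middle_pair[OF H] unfolding sum_middle[OF H(1)]
    by (simp add: algebra_simps)
next
  assume H: "H = m + 1" "p dvd offset - 1"
  then show ?thesis using interior_le[of 2 "m - 1"] m_ge longest_pairs[OF H] unfolding sum_longest[OF H(1)]
    by (simp add: algebra_simps)
qed

text \<open>With 5m = 5H all five numbers \<open>a\<close> equal \<open>H\<close>. If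
  \<open>pos\<close>, no four elements of the top slice add up to one of the bottom slice, and
  \<open>coset\<close> applies. Otherwise the bottom slice enters twice, which turns out to be
  impossible; hence \<open>pos\<close> among the conclusions.\<close>

lemma middle_structure:
  assumes H: "H = m" and off: "p dvd offset - 5 * m"
  obtains u V where "pos" "sub V" "V \<noteq> UNIV" "S (c + m) = {v. v - u \<in> V}" "S c = {v. v - (u + u + u + u) \<notin> V}"
    "\<And>i. i \<in> {1..m - 1} \<Longrightarrow> S (c + i) = UNIV"
proof -
  note pair = middle_pair[OF H off]
  have ge: "sz (c + m) + sz c \<ge> P"
    using mass' interior_le[of 1 "m - 1"] m_ge unfolding sum_middle[OF H] by (simp add: algebra_simps)
  have full: "S (c + i) = UNIV" if "i \<in> {1..m - 1}" for i
  proof (rule all_full[of "{1..m - 1}" 1])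
    have "{0..H} - {1..m - 1} = {0, m}" using H m_ge by auto
    then show "(\<Sum>i\<in>{0..H} - {1..m - 1}. A i) \<le> 1 * P" using pair m_ge by simp
  qed (use that H m_ge in auto)
  obtain u where u: "u \<in> S (c + m)" using ends H by auto
  obtain z where z: "z \<in> S c" using ends by auto
  define V where "V = {v. v + u \<in> S (c + m)}"
  show ?thesis
  proof (cases pos)
    case True
    have "\<forall>v\<in>S (c + m). \<forall>w\<in>S (c + m). v + w + (u + u) \<notin> S c"
    proof (intro ballI)
      fix v w assume vw: "v \<in> S (c + m)" "w \<in> S (c + m)"
      have "p dvd (c + m) + (c + m) + (c + m) + sg pos (c + m) - c"
        using True H by (intro dvd_offset_cong[OF off, of _ 1 0]) (unfold offset_def, simp add: sg_def)
      from free[OF this vw u u] show "v + w + (u + u) \<notin> S c" using True by (simp add: sg_def add.assoc)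
    qed
    note cos = coset[OF this ge u, folded V_def]
    show ?thesis
    proof (rule that[of V u])
      show "S c = {v. v - (u + u + u + u) \<notin> V}" using cos(3) by (simp add: add.assoc)
      then show "V \<noteq> UNIV" using z by auto
    qed (use True cos full in auto)
  next
    case False
    have cong: "p dvd (c + m) + (c + m) + (c + m) + sg pos c - c"
      using False H by (intro dvd_offset_cong[OF off, of _ 1 0]) (unfold offset_def, simp add: sg_def)
    have fr: "\<forall>v\<in>S (c + m). \<forall>w\<in>S (c + m). v + w + (u - y) \<notin> S c" if y: "y \<in> S c" for y
    proof (intro ballI)
      fix v w assume vw: "v \<in> S (c + m)" "w \<in> S (c + m)"
      show "v + w + (u - y) \<notin> S c" using free[OF cong vw u y] False by (simp add: sg_def algebra_simps)
    qed
    have V: "sub V" using coset(1)[OF fr[OF z] ge u] by (simp add: V_def)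
    have Sc: "S c = {v. v - (u + u + (u - y)) \<notin> V}" if "y \<in> S c" for y
      using coset(3)[OF fr[OF that] ge u] by (simp add: V_def)
    \<comment> \<open>The formula \<open>Sc\<close> holds for every \<open>y\<close> in
      \<open>S c\<close>, so \<open>S c\<close> lies in one coset of \<open>V\<close> and is at the
      same time the complement of one. Thus \<open>V\<close> would have index 2, which the odd
      exponent \<open>p\<close> excludes.\<close>
    define a where "a = z - (u + u + (u - z))"
    have "a \<notin> V" using z Sc[OF z] by (simp add: a_def)
    have or: "y \<in> V \<or> y - a \<in> V" for y
    proof (rule ccontr)
      assume n: "\<not> ?thesis"
      define w where "w = y + (u + u + (u - z))"
      have "w \<in> S c" unfolding Sc[OF z] using n by (simp add: w_def)
      have "u + u + (u - w) \<notin> S c" using Sc[OF \<open>w \<in> S c\<close>] V by (simp add: sub_def)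
      then have "(u + u + (u - w)) - (u + u + (u - z)) \<in> V" using Sc[OF z] by blast
      then have "- (z - w) \<in> V" using sub_uminus[OF V] by fastforce
      moreover have "- (z - w) = y - a" by (simp add: w_def a_def algebra_simps)
      ultimately show False using n by simp
    qed
    have "((+) a ^^ 2) 0 \<in> V"
    proof -
      have "a + a \<in> V" using or[of "a + a"] \<open>a \<notin> V\<close> by simp
      then show ?thesis by (simp add: numeral_2_eq_2)
    qed
    then have "a \<in> V" using sub_divide[OF V _ coprime_small] by blast
    then show ?thesis using \<open>a \<notin> V\<close> by simp
  qed
qed

text \<open>Five numbers \<open>a\<close> add up to 1 if one is 1 and the rest are 0, but also,
  modulo \<open>p\<close>, if one is \<open>m\<close> and the rest are \<open>H = m + 1\<close>. In
  each of the pairs at 0, m and at m + 1, 1 the end slice is a coset and the inner one the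
  complement of a coset; the relations between the pairs show that both belong to the same
  \<open>V\<close>, with opposite representatives \<open>u\<close> and \<open>- u\<close>.\<close>

lemma longest_structure:
  assumes H: "H = m + 1" and off: "p dvd offset - 1"
  obtains u V where "sub V" "S c = {v. v - u \<in> V}" "S (c + m + 1) = {v. v + u \<in> V}"
    "S (c + m) = {v. v - (u + u + u + u) \<notin> V}" "S (c + 1) = {v. v + (u + u + u + u) \<notin> V}"
    "\<And>i. i \<in> {2..m - 1} \<Longrightarrow> S (c + i) = UNIV"
proof -
  note pairs = longest_pairs[OF H off]
  have "A 0 + A 1 + A m + A (m + 1) \<ge> 2 * P"
    using mass' interior_le[of 2 "m - 1"] m_ge unfolding sum_longest[OF H] by (simp add: algebra_simps)
  then have ge: "sz c + sz (c + m) \<ge> P" "sz (c + m + 1) + sz (c + 1) \<ge> P"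
    using pairs by (simp_all add: add.assoc)
  have full: "S (c + i) = UNIV" if "i \<in> {2..m - 1}" for i
  proof (rule all_full[of "{2..m - 1}" 2])
    have "{0..H} - {2..m - 1} = {0, 1, m, m + 1}" using H m_ge by auto
    then show "(\<Sum>i\<in>{0..H} - {2..m - 1}. A i) \<le> 2 * P" using pairs m_ge by simp
  qed (use that H m_ge in auto)
  define e where "e = c + m + 1"
  obtain u where u: "u \<in> S c" using ends by auto
  obtain r where r: "r \<in> S e" using ends H by (auto simp: e_def add.assoc)
  \<comment> \<open>The places of the fourth summand for \<open>a = 0\<close> and for
    \<open>a = H\<close>; a negative sign exchanges the two ends.\<close>
  define x4 where "x4 = (if pos then c else e)"
  define y4 where "y4 = (if pos then e else c)"
  define z where "z = (if pos then u else r)"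
  define z' where "z' = (if pos then r else u)"
  have z: "z \<in> S x4" "z' \<in> S y4" using u r by (simp_all add: z_def z'_def x4_def y4_def)
  have c1: "p dvd c + c + c + sg pos x4 - (c + m)"
    using H by (intro dvd_offset_cong[OF off, of _ 1 0]) (unfold offset_def, simp add: sg_def x4_def e_def)
  have c2: "p dvd e + e + e + sg pos y4 - (c + 1)"
    using H p_eq by (intro dvd_offset_cong[OF off, of _ "1" 1]) (unfold offset_def, simp add: sg_def y4_def e_def)
  have c3: "p dvd (c + m) + e + e + sg pos y4 - c"
    using H p_eq by (intro dvd_offset_cong[OF off, of _ "1" 1]) (unfold offset_def, simp add: sg_def y4_def e_def)
  have c4: "p dvd (c + 1) + c + c + sg pos x4 - e"
    using H by (intro dvd_offset_cong[OF off, of _ 1 0]) (unfold offset_def, simp add: sg_def x4_def e_def)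
  have f1: "\<forall>v\<in>S c. \<forall>w\<in>S c. v + w + (u + sg pos z) \<notin> S (c + m)"
    using free[OF c1 _ _ u z(1)] by (auto simp: add.assoc)
  have f2: "\<forall>v\<in>S e. \<forall>w\<in>S e. v + w + (r + sg pos z') \<notin> S (c + 1)"
    using free[OF c2 _ _ r z(2)] by (auto simp: add.assoc)
  define V where "V = {v. v + u \<in> S c}"
  define V' where "V' = {v. v + r \<in> S e}"
  note V = coset[OF f1 ge(1) u, folded V_def]
  note V' = coset[OF f2 ge(2)[folded e_def] r, folded V'_def]
  \<comment> \<open>The relation \<open>c3\<close> would send this element of the base to
    \<open>u\<close>, which does lie in \<open>S c\<close>. So it is not in \<open>S (c + m)\<close>
    and must lie in the coset missing there.\<close>
  have k1: "(u - y - r - sg pos z') - (u + u + (u + sg pos z)) \<in> V" if "y \<in> S e" for y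
  proof -
    have "u - y - r - sg pos z' \<notin> S (c + m)"
      using free[OF c3 _ that r z(2), of "u - y - r - sg pos z'"] u by auto
    then show ?thesis unfolding V(3) mem_Collect_eq by blast
  qed
  have k2: "(r - y - u - sg pos z) - (r + r + (r + sg pos z')) \<in> V'" if "y \<in> S c" for y
  proof -
    have "r - y - u - sg pos z \<notin> S (c + 1)"
      using free[OF c4 _ that u z(1), of "r - y - u - sg pos z"] r by auto
    then show ?thesis unfolding V'(3) mem_Collect_eq by blast
  qed
  have VV: "V' = V"
  proof
    show "V' \<subseteq> V"
    proof
      fix x assume "x \<in> V'"
      then have "x + r \<in> S e" by (simp add: V'_def)
      from sub_diff[OF V(1) k1[OF r] k1[OF this]] show "x \<in> V" by (simp add: algebra_simps)
    qed
    show "V \<subseteq> V'"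
    proof
      fix x assume "x \<in> V"
      then have "x + u \<in> S c" by (simp add: V_def)
      from sub_diff[OF V'(1) k2[OF u] k2[OF this]] show "x \<in> V'" by (simp add: algebra_simps)
    qed
  qed
  \<comment> \<open>For \<open>y = r\<close>, \<open>k1\<close> puts -3 (u + r) into
    \<open>V\<close> if \<open>pos\<close>, and -(u + r) otherwise; 3 can be divided out because it
    is coprime to \<open>p\<close>.\<close>
  have ur: "u + r \<in> V"
  proof (cases pos)
    case True
    then have "- ((u - r - r - sg pos z') - (u + u + (u + sg pos z))) = ((+) (u + r) ^^ 3) 0"
      by (simp add: sg_def z_def z'_def numeral_3_eq_3 algebra_simps)
    then have "((+) (u + r) ^^ 3) 0 \<in> V" using sub_uminus[OF V(1) k1[OF r]] by simp
    then show ?thesis using sub_divide[OF V(1) _ coprime_small] by blast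
  next
    case False
    then have "- ((u - r - r - sg pos z') - (u + u + (u + sg pos z))) = u + r"
      by (simp add: sg_def z_def z'_def algebra_simps)
    then show ?thesis using sub_uminus[OF V(1) k1[OF r]] by simp
  qed
  have shift: "x \<in> V \<longleftrightarrow> y \<in> V" if "x - y \<in> V" for x y
    using sub_add[OF V(1) that, of y] sub_diff[OF V(1) _ that, of x] by auto
  have "u + r + (u + r) + (u + r) + (u + r) \<in> V" by (intro sub_add V(1) ur)
  note mults = this sub_uminus[OF V(1) this] sub_uminus[OF V(1) ur]
  show ?thesis
  proof (rule that[of V u])
    show "S (c + m + 1) = {v. v + u \<in> V}"
    proof -
      have "v - r \<in> V \<longleftrightarrow> v + u \<in> V" for v
        by (rule shift) (use mults in \<open>simp add: algebra_simps\<close>)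
      then show ?thesis using V'(2) VV by (simp add: e_def)
    qed
    show "S (c + m) = {v. v - (u + u + u + u) \<notin> V}"
    proof -
      have "v - (u + u + (u + sg pos z)) \<in> V \<longleftrightarrow> v - (u + u + u + u) \<in> V" for v
        by (rule shift) (use mults ur V(1) in \<open>auto simp add: z_def sg_def sub_def algebra_simps\<close>)
      then show ?thesis using V(3) by simp
    qed
    show "S (c + 1) = {v. v + (u + u + u + u) \<notin> V}"
    proof -
      have "v - (r + r + (r + sg pos z')) \<in> V \<longleftrightarrow> v + (u + u + u + u) \<in> V" for v
      proof (rule shift)
        have *: "- (u + r) + - (u + r) + - (u + r) \<in> V" by (intro sub_add V(1) mults(3))
        show "(v - (r + r + (r + sg pos z'))) - (v + (u + u + u + u)) \<in> V"
        proof (cases pos)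
          case True
          then have "(v - (r + r + (r + sg pos z'))) - (v + (u + u + u + u)) = - (u + r + (u + r) + (u + r) + (u + r))"
            by (simp add: z'_def sg_def algebra_simps)
          then show ?thesis using mults(2) by (simp only:)
        next
          case False
          then have "(v - (r + r + (r + sg pos z'))) - (v + (u + u + u + u)) = - (u + r) + - (u + r) + - (u + r)"
            by (simp add: z'_def sg_def algebra_simps)
          then show ?thesis using * by (simp only:)
        qed
      qed
      then show ?thesis using V'(3) VV by simp
    qed
  qed (use V full in auto)
qed

text \<open>Negation exchanges the ends of the window, so each of the five numbers \<open>a\<close>
  becomes \<open>H - a\<close> and their required sum becomes \<open>5 * H - offset\<close>.\<close>

lemma reflected: "slices p red m pos (\<lambda>x. {v. - v \<in> S (- x)}) (- (c + H)) H"
  and offset_reflected: "slices.offset pos (- (c + H)) H = 5 * H - offset"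
proof -
  have neg_cong: "p dvd - x - - y" if "p dvd x - y" for x y
    using that dvd_minus_iff[of p "x - y"] by simp
  show ref: "slices p red m pos (\<lambda>x. {v. - v \<in> S (- x)}) (- (c + H)) H"
  proof
    show "p = 5 * m + 3" "21 \<le> m" "0 \<le> H" "H \<le> m + 11" by (fact p_eq m_ge H_bounds)+
    show "red (((+) v ^^ nat p) 0) = red 0" for v by (fact torsion)
    show "red v \<in> {v. - v \<in> S (- x)} \<longleftrightarrow> v \<in> {v. - v \<in> S (- x)}" for v x
      using S_red[of "- red v" "- x"] S_red[of "- v" "- x"] red_cong_uminus[OF red_red, of v] by simp
    show "{v. - v \<in> S (- x)} = {v. - v \<in> S (- y)}" if "p dvd x - y" for x y
      using S_cong[OF neg_cong[OF that]] by simp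
    show "v1 + v2 + v3 + sg pos v4 \<notin> {v. - v \<in> S (- x5)}"
      if "p dvd x1 + x2 + x3 + sg pos x4 - x5" and v: "v1 \<in> {v. - v \<in> S (- x1)}" "v2 \<in> {v. - v \<in> S (- x2)}"
        "v3 \<in> {v. - v \<in> S (- x3)}" "v4 \<in> {v. - v \<in> S (- x4)}" for x1 x2 x3 x4 x5 v1 v2 v3 v4
    proof -
      have "p dvd (- x1) + (- x2) + (- x3) + sg pos (- x4) - (- x5)"
        using neg_cong[of "x1 + x2 + x3 + sg pos x4" x5] that(1) by (simp add: sg_uminus)
      from free[OF this, of "- v1" "- v2" "- v3" "- v4"] v show ?thesis by (simp add: sg_uminus)
    qed
    show "\<exists>k. x + k * p \<in> {- (c + H)..- (c + H) + H}" if ne: "{v. - v \<in> S (- x)} \<noteq> {}" for x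
    proof -
      obtain k where k: "- x + k * p \<in> {c..c + H}" using support[of "- x"] ne by blast
      then have "x + (- k) * p \<in> {- (c + H)..- (c + H) + H}" by auto
      then show ?thesis by blast
    qed
    have eq: "- (- (c + H) + i) = c + (H - i)" for i by simp
    have eq0: "- (- (c + H)) = c + H" by simp
    obtain v w where "v \<in> S (c + H)" "w \<in> S c" using ends by blast
    then have "- (- v) \<in> S (c + H)" "- (- w) \<in> S (c + (H - H))" by simp_all
    then show "{v. - v \<in> S (- (- (c + H)))} \<noteq> {}" "{v. - v \<in> S (- (- (c + H) + H))} \<noteq> {}"
      unfolding eq eq0 by blast+
    show "j - i \<le> m + 2" if "v \<in> {v. - v \<in> S (- (- (c + H) + i))}" "v \<in> {v. - v \<in> S (- (- (c + H) + j))}"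
      "0 \<le> i" "i \<le> j" "j \<le> H" for v i j
      using diameter[of "- v" "H - j" "H - i"] that unfolding eq by simp
    have "(\<Sum>w\<in>W. of_bool (- w \<in> S (c + (H - i)))) = A (H - i)" for i
      using sz_reflect[of 0 "c + (H - i)"] by simp
    then show "m * P \<le> (\<Sum>i\<in>{0..H}. \<Sum>w\<in>W. of_bool (w \<in> {v. - v \<in> S (- (- (c + H) + i))}))"
      using mass' sum_reverse[of "\<lambda>i. A i" H] unfolding eq mem_Collect_eq by simp
  qed
  show "slices.offset pos (- (c + H)) H = 5 * H - offset"
    unfolding slices.offset_def[OF ref] offset_def by simp
qed

end

section \<open>From columns to slices in a window\<close>

context modulus
begin

lemma N_support:
  assumes Z: "per Z" "\<And>x. x \<in> Z \<Longrightarrow> \<exists>k. x + k * p \<in> {a..a + h}" and h: "h < p"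
  shows "N Z = (\<Sum>i\<in>{0..h}. of_bool (a + i \<in> Z))"
proof -
  have "Z \<inter> {a..<a + p} = (\<lambda>i. a + i) ` {i \<in> {0..h}. a + i \<in> Z}"
  proof (intro Set.set_eqI iffI)
    fix x assume x: "x \<in> Z \<inter> {a..<a + p}"
    then obtain k where k: "x + k * p \<in> {a..a + h}" using Z(2) by blast
    then have "\<bar>k * p\<bar> < p" using x h by auto
    then have "k = 0" by (rule mult_p_small)
    then have "x \<in> {a..a + h}" using k by simp
    then show "x \<in> (\<lambda>i. a + i) ` {i \<in> {0..h}. a + i \<in> Z}"
      using x by (intro image_eqI[of _ _ "x - a"]) auto
  qed (use h in auto)
  then have "card (Z \<inter> {a..<a + p}) = card {i \<in> {0..h}. a + i \<in> Z}"
    by (simp add: card_image)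
  then show ?thesis using N_window[OF Z(1), of a] by (simp add: Int_def)
qed

end

context columns
begin

text \<open>After subtracting \<open>g\<close>, all occupied first coordinates are within m + 11 of
  each other modulo \<open>p\<close>, and \<open>hull\<close> supplies the window. As
  \<open>g\<close> is additive modulo \<open>p\<close>, the forbidden equation survives the
  shear.\<close>

theorem exists_slices:
  obtains g c H where "\<And>u. g (red u) = g u" "\<And>u v. p dvd g (u + v) - g u - g v"
    "slices p red m pos (\<lambda>x. {v. x + g v \<in> B v}) c H"
proof -
  obtain g where g_red: "\<And>u. g (red u) = g u" and g_add: "\<And>u v. p dvd g (u + v) - g u - g v"
    and g_near: "\<And>v w t t'. t \<in> B v \<Longrightarrow> t' \<in> B w \<Longrightarrow> near (m + 11) ((t' - g w) - (t - g v))"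
    using linear_displacement by blast
  define S where "S x = {v. x + g v \<in> B v}" for x
  have S_cong: "S x = S y" if "p dvd x - y" for x y
  proof -
    have "x + g v \<in> B v \<longleftrightarrow> y + g v \<in> B v" for v
      using that by (intro periodic_cong[OF per_B]) simp
    then show ?thesis by (simp add: S_def)
  qed
  define Y where "Y = {x. S x \<noteq> {}}"
  have "per Y"
  proof (rule periodicI)
    fix x k assume "x \<in> Y"
    then show "x + k * p \<in> Y" using S_cong[of "x + k * p" x] by (simp add: Y_def)
  qed
  moreover obtain t0 where "t0 \<in> B 0" using B0_nonempty by auto
  then have "t0 - g 0 \<in> Y" by (auto simp: Y_def S_def intro!: exI[of _ 0])
  then have "Y \<noteq> {}" by auto
  moreover have "3 * (m + 11) < p" using p_eq m_ge by simp
  moreover have "near (m + 11) (x - y)" if xy: "x \<in> Y" "y \<in> Y" for x y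
  proof -
    obtain v w where "x + g v \<in> B v" "y + g w \<in> B w" using xy by (auto simp: Y_def S_def)
    then show ?thesis using g_near[of "y + g w" w "x + g v" v] by simp
  qed
  ultimately obtain a b where ab: "a \<in> Y" "b \<in> Y" "a \<le> b" "b - a \<le> m + 11" "\<And>x. x \<in> Y \<Longrightarrow> \<exists>k. x + k * p \<in> {a..b}"
    using hull[of Y "m + 11"] by metis
  have g_sg: "p dvd g (sg pos v) - sg pos (g v)" for v
  proof (cases pos)
    case True
    then show ?thesis by (simp add: sg_def)
  next
    case False
    have 0: "p dvd - g 0" using g_add[of 0 0] by simp
    have "p dvd g (- v + v) - g (- v) - g v" by (rule g_add)
    then have "p dvd g (- v) + g v"
      by (rule dvd_lincomb[OF _ 0, of _ _ "-1" "-1" 0]) simp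
    then show ?thesis using False by (simp add: sg_def)
  qed
  have "slices p red m pos S a (b - a)"
  proof
    show "p = 5 * m + 3" "m \<ge> 21" by (fact p_eq m_ge)+
    show "red (((+) v ^^ nat p) 0) = red 0" for v by (fact torsion)
    show "red v \<in> S x \<longleftrightarrow> v \<in> S x" for v x by (simp add: S_def g_red B_red)
    show "S x = S y" if "p dvd x - y" for x y by (rule S_cong[OF that])
    show "v1 + v2 + v3 + sg pos v4 \<notin> S x5"
      if x: "p dvd x1 + x2 + x3 + sg pos x4 - x5" and v: "v1 \<in> S x1" "v2 \<in> S x2" "v3 \<in> S x3" "v4 \<in> S x4"
      for x1 x2 x3 x4 x5 v1 v2 v3 v4
    proof
      define v5 where "v5 = v1 + v2 + v3 + sg pos v4"
      define s where "s = (x1 + g v1) + (x2 + g v2) + (x3 + g v3) + sg pos (x4 + g v4)"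
      assume "v1 + v2 + v3 + sg pos v4 \<in> S x5"
      then have v5: "x5 + g v5 \<in> B v5" by (simp add: S_def v5_def)
      have d1: "p dvd g v5 - (g (v1 + v2 + v3)) - g (sg pos v4)" unfolding v5_def by (rule g_add)
      have d2: "p dvd g (v1 + v2 + v3) - g (v1 + v2) - g v3" by (rule g_add)
      have d3: "p dvd g (v1 + v2) - g v1 - g v2" by (rule g_add)
      have d4: "p dvd g (sg pos v4) - sg pos (g v4)" by (rule g_sg)
      \<comment> \<open>Subtracting the four additivity defects of \<open>g\<close> turns the
        relation between the sheared coordinates into the one between the original
        coordinates.\<close>
      have "p dvd (x1 + x2 + x3 + sg pos x4 - x5) - ((g v5 - (g (v1 + v2 + v3)) - g (sg pos v4))
          + (g (v1 + v2 + v3) - g (v1 + v2) - g v3) + (g (v1 + v2) - g v1 - g v2) + (g (sg pos v4) - sg pos (g v4)))"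
        by (rule dvd_diff[OF x dvd_add[OF dvd_add[OF dvd_add[OF d1 d2] d3] d4]])
      also have "\<dots> = s - (x5 + g v5)" by (simp add: s_def sg_add)
      finally have "s \<in> B v5" using periodic_cong[OF per_B] v5 by blast
      then show False using free[of "x1 + g v1" v1 "x2 + g v2" v2 "x3 + g v3" v3 "x4 + g v4" v4 s] v
        by (simp add: s_def S_def v5_def)
    qed
    show "\<exists>k. x + k * p \<in> {a..a + (b - a)}" if "S x \<noteq> {}" for x using ab(5)[of x] that by (simp add: Y_def)
    show "S a \<noteq> {}" "S (a + (b - a)) \<noteq> {}" using ab by (simp_all add: Y_def)
    show "0 \<le> b - a" "b - a \<le> m + 11" using ab by simp_all
    show "j - i \<le> m + 2" if v: "v \<in> S (a + i)" "v \<in> S (a + j)" and ij: "0 \<le> i" "i \<le> j" "j \<le> b - a" for v i j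
    proof -
      have "near (m + 2) ((a + j + g v) - (a + i + g v))" using v by (intro column_diameter[of _ v]) (simp_all add: S_def)
      then have "near (m + 2) (j - i)" by simp
      then have "\<bar>j - i\<bar> \<le> m + 2" using ij ab(4) p_eq m_ge by (intro near_small) auto
      then show ?thesis by simp
    qed
    have col: "(\<Sum>i\<in>{0..b - a}. of_bool (w \<in> S (a + i))) = N (B w)" for w
    proof -
      define Z where "Z = {x. x + g w \<in> B w}"
      have perZ: "per Z" unfolding Z_def by (intro periodic_shift per_B)
      have Z: "x \<in> Z \<longleftrightarrow> w \<in> S x" for x by (simp add: Z_def S_def)
      have "\<exists>k. x + k * p \<in> {a..a + (b - a)}" if "x \<in> Z" for x
        using ab(5)[of x] that Z by (auto simp: Y_def)
      then have "N Z = (\<Sum>i\<in>{0..b - a}. of_bool (a + i \<in> Z))"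
        using ab(4) p_eq m_ge by (intro N_support perZ) auto
      moreover have "N Z = N (B w)" unfolding Z_def by (rule N_shift[OF per_B])
      ultimately show ?thesis by (simp add: Z)
    qed
    have "(\<Sum>i\<in>{0..b - a}. \<Sum>w\<in>W. of_bool (w \<in> S (a + i))) = (\<Sum>w\<in>W. N (B w))"
      by (subst sum.swap) (simp only: col)
    then show "m * P \<le> (\<Sum>i\<in>{0..b - a}. \<Sum>w\<in>W. of_bool (w \<in> S (a + i)))" using mass by simp
  qed
  then show ?thesis using that[of g a "b - a"] g_red g_add unfolding S_def by blast
qed

end

subsection \<open>Vectors over the prime field\<close>

text \<open>Vectors are arbitrary integer functions, for which the additive laws hold exactly;
  \<open>rd\<close> picks the element of \<open>Fp_space\<close> that such a function stands for,
  with the default value outside \<open>{..<k}\<close>.\<close>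

definition rd :: "nat \<Rightarrow> nat \<Rightarrow> (nat \<Rightarrow> int) \<Rightarrow> nat \<Rightarrow> int" where
  "rd p k x = (\<lambda>i\<in>{..<k}. x i mod int p)"

abbreviation cons :: "int \<Rightarrow> (nat \<Rightarrow> int) \<Rightarrow> nat \<Rightarrow> int" where
  "cons t v \<equiv> case_nat t v"

lemma rd_eq_iff: "rd p k x = rd p k y \<longleftrightarrow> (\<forall>i<k. int p dvd x i - y i)"
  by (auto simp: rd_def fun_eq_iff restrict_def mod_eq_dvd_iff)

lemma rd_add: "rd p k (rd p k a + b) = rd p k (a + b)"
  by (auto simp: rd_def fun_eq_iff restrict_def mod_add_left_eq)

lemma carrier_Fp_space: "p > 0 \<Longrightarrow> carrier (Fp_space p k) = ({..<k} \<rightarrow>\<^sub>E {0..<int p})"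
  by (simp add: Fp_space_def carrier_integer_mod_group)

lemma rd_carrier: "p > 0 \<Longrightarrow> rd p k x \<in> carrier (Fp_space p k)"
  by (auto simp: carrier_Fp_space rd_def)

lemma rd_id: "p > 0 \<Longrightarrow> x \<in> carrier (Fp_space p k) \<Longrightarrow> rd p k x = x"
  by (rule ext) (auto simp: carrier_Fp_space rd_def PiE_iff extensional_def restrict_def)

lemma range_rd: "p > 0 \<Longrightarrow> range (rd p k) = carrier (Fp_space p k)"
  using rd_carrier rd_id by (auto simp: image_iff) metis

lemma finite_Fp_space: "p > 0 \<Longrightarrow> finite (carrier (Fp_space p k))"
  by (simp add: carrier_Fp_space finite_PiE)

lemma card_Fp_space: "p > 0 \<Longrightarrow> card (carrier (Fp_space p k)) = p ^ k"
  by (simp add: carrier_Fp_space card_PiE)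

lemma mult_Fp_space: "x \<otimes>\<^bsub>Fp_space p k\<^esub> y = rd p k (x + y)"
  by (simp add: Fp_space_def rd_def)

lemma one_Fp_space: "\<one>\<^bsub>Fp_space p k\<^esub> = rd p k 0"
  by (simp add: Fp_space_def rd_def)

lemma group_Fp_space: "group (Fp_space p k)"
  unfolding Fp_space_def by (rule product_group) (rule group_integer_mod_group)

lemma comm_group_Fp_space: "comm_group (Fp_space p k)"
  by (rule group.group_comm_groupI[OF group_Fp_space]) (simp add: mult_Fp_space add.commute)

lemma quotient_map_rd: "p > 0 \<Longrightarrow> quotient_map (rd p k)"
  by unfold_locales (simp_all add: range_rd finite_Fp_space rd_add)

lemma funpow_plus_fun: "((+) (v :: nat \<Rightarrow> int) ^^ j) 0 = (\<lambda>i. int j * v i)"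
  by (induction j) (auto simp: fun_eq_iff algebra_simps)

lemma rd_torsion: "rd p k (((+) v ^^ nat (int p)) 0) = rd p k 0"
  by (simp add: funpow_plus_fun rd_eq_iff)

lemma (in comm_monoid) sumset_fold_Suc:
  assumes "y \<in> sumset_fold G h X" "x \<in> X" "X \<subseteq> carrier G"
  shows "x \<otimes> y \<in> sumset_fold G (Suc h) X"
proof -
  obtain f where f: "f \<in> {1..h} \<rightarrow> X" "y = finprod G f {1..h}" using assms(1) by (auto simp: sumset_fold_def)
  define f' where "f' = f(Suc h := x)"
  have "finprod G f' {1..h} = finprod G f {1..h}"
    using f assms(3) by (intro finprod_cong') (auto simp: f'_def)
  moreover have "{1..Suc h} = insert (Suc h) {1..h}" by auto
  moreover have "finprod G f' (insert (Suc h) {1..h}) = f' (Suc h) \<otimes> finprod G f' {1..h}"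
    using f assms by (intro finprod_insert) (auto simp: f'_def)
  ultimately have "finprod G f' {1..Suc h} = x \<otimes> y" using f by (simp add: f'_def)
  moreover have "f' \<in> {1..Suc h} \<rightarrow> X" using f assms by (auto simp: f'_def)
  ultimately show ?thesis unfolding sumset_fold_def by (intro CollectI exI[of _ f'] conjI) (simp_all only:)
qed

lemma (in comm_monoid) sumset_fold_1:
  assumes "x \<in> X" "X \<subseteq> carrier G"
  shows "x \<in> sumset_fold G 1 X"
proof -
  have "\<one> \<in> sumset_fold G 0 X" by (auto simp: sumset_fold_def)
  then have "x \<otimes> \<one> \<in> sumset_fold G (Suc 0) X" using assms by (intro sumset_fold_Suc)
  then show ?thesis using assms by auto
qed

lemma (in comm_monoid) sumset_fold_2:
  assumes "X \<subseteq> carrier G"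
  shows "sumset_fold G 2 X = {x \<otimes> y | x y. x \<in> X \<and> y \<in> X}"
proof
  show "{x \<otimes> y | x y. x \<in> X \<and> y \<in> X} \<subseteq> sumset_fold G 2 X"
    using sumset_fold_Suc[OF sumset_fold_1] assms by (auto simp: numeral_2_eq_2)
  show "sumset_fold G 2 X \<subseteq> {x \<otimes> y | x y. x \<in> X \<and> y \<in> X}"
  proof
    fix z assume "z \<in> sumset_fold G 2 X"
    then obtain f where f: "f \<in> {1..2::nat} \<rightarrow> X" "z = finprod G f {1..2}" by (auto simp: sumset_fold_def)
    have "{1..2::nat} = insert 1 (insert 2 {})" by auto
    then have "z = f 1 \<otimes> f 2" using f assms by (simp add: Pi_iff subset_iff)
    moreover have "f 1 \<in> X" "f 2 \<in> X" using f by auto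
    ultimately show "z \<in> {x \<otimes> y | x y. x \<in> X \<and> y \<in> X}" by blast
  qed
qed

text \<open>For (3, 2) the equation \<open>x1 + x2 + x3 = x4 + y\<close> is solved for
  \<open>y\<close>, which gives both pairs a common form up to one sign.\<close>

lemma sum_freeD:
  assumes p: "p > 0" and A: "sum_free (Fp_space p n) k l A" and kl: "(k, l) = (4, 1) \<or> (k, l) = (3, 2)"
    and x: "rd p n x1 \<in> A" "rd p n x2 \<in> A" "rd p n x3 \<in> A" "rd p n x4 \<in> A"
  shows "rd p n (x1 + x2 + x3 + sg (k = 4) x4) \<notin> A"
proof
  let ?G = "Fp_space p n"
  interpret comm_group ?G by (rule comm_group_Fp_space)
  have sub: "A \<subseteq> carrier ?G" and disj: "sumset_fold ?G k A \<inter> sumset_fold ?G l A = {}"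
    using A by (auto simp: sum_free_def)
  have mult: "rd p n a \<otimes>\<^bsub>?G\<^esub> rd p n b = rd p n (a + b)" for a b
    using rd_add[of p n a "rd p n b"] rd_add[of p n b a] by (simp add: mult_Fp_space add.commute)
  assume y: "rd p n (x1 + x2 + x3 + sg (k = 4) x4) \<in> A"
  show False
  proof (cases "k = 4")
    case True
    then have l: "l = 1" using kl by auto
    have k: "k = Suc (Suc (Suc 1))" using True by simp
    have "rd p n (x1 + (x2 + (x3 + x4))) \<in> sumset_fold ?G k A"
      unfolding mult[symmetric] k by (intro sumset_fold_Suc sumset_fold_1 sub x)
    moreover have "rd p n (x1 + x2 + x3 + sg (k = 4) x4) \<in> sumset_fold ?G l A"
      unfolding l by (rule sumset_fold_1[OF y sub])
    moreover have "x1 + x2 + x3 + sg (k = 4) x4 = x1 + (x2 + (x3 + x4))"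
      using True by (simp add: sg_def add.assoc)
    ultimately show False using disj by (metis IntI empty_iff)
  next
    case False
    then have k: "k = Suc (Suc 1)" and l: "l = Suc 1" using kl by auto
    have "rd p n (x1 + (x2 + x3)) \<in> sumset_fold ?G k A"
      unfolding mult[symmetric] k by (intro sumset_fold_Suc sumset_fold_1 sub x)
    moreover have "rd p n (x4 + (x1 + x2 + x3 + sg (k = 4) x4)) \<in> sumset_fold ?G l A"
      using sumset_fold_Suc[OF sumset_fold_1[OF y sub] x(4) sub] unfolding mult l .
    moreover have "x4 + (x1 + x2 + x3 + sg (k = 4) x4) = x1 + (x2 + x3)"
      using False by (simp add: sg_def algebra_simps)
    ultimately show False using disj by (metis IntI empty_iff)
  qed
qed

subsection \<open>The covering property\<close>

text \<open>The supremum need not be attained; the factor 5 leaves room for this. If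
  \<open>t * m <= 4\<close> for all feasible \<open>t\<close>, then \<open>T_fun (1 / 5)\<close> is
  at least m / 4, and 5m / 4 exceeds \<open>m\<close>. This includes the case that nothing is
  feasible, where \<open>T_fun\<close> is infinite.\<close>

lemma exists_feasible:
  assumes "of_nat m \<ge> max (5 * T_fun (1 / 5)) 21"
  shows "m \<ge> 21" "\<exists>t. feasible (1 / 5) t \<and> t * real m > 4"
proof -
  have "ennreal (real m) \<ge> ennreal 21"
    using assms by (simp add: ennreal_of_nat_eq_real_of_nat)
  then show m: "m \<ge> 21" by (simp add: ennreal_le_iff)
  show "\<exists>t. feasible (1 / 5) t \<and> t * real m > 4"
  proof (rule ccontr)
    assume "\<not> ?thesis"
    then have le: "t * real m \<le> 4" if "feasible (1 / 5) t" for t using that by force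
    have "tau_sup (1 / 5) \<le> ennreal (4 / real m)" unfolding tau_sup_def
    proof (rule SUP_least)
      fix t assume "t \<in> {t. feasible (1 / 5) t}"
      then have "t \<le> 4 / real m" using le m by (simp add: field_simps)
      then show "ennreal t \<le> ennreal (4 / real m)" by (rule ennreal_leI)
    qed
    then obtain r where r: "tau_sup (1 / 5) = ennreal r" "0 \<le> r" "r \<le> 4 / real m"
      using m by (cases "tau_sup (1 / 5)") (auto simp: ennreal_le_iff top_unique)
    have "ennreal (real m / 4) \<le> T_fun (1 / 5)"
    proof (cases "r = 0")
      case True
      then show ?thesis using r by (simp add: T_fun_def)
    next
      case False
      then have "T_fun (1 / 5) = ennreal (1 / r)"
        using r divide_ennreal[of 1 r] by (simp add: T_fun_def)
      moreover have "real m / 4 \<le> 1 / r" using r False m by (simp add: field_simps)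
      ultimately show ?thesis by (simp add: ennreal_leI)
    qed
    then have "5 * ennreal (real m / 4) \<le> 5 * T_fun (1 / 5)" by (rule mult_left_mono) simp
    also have "\<dots> \<le> of_nat m" using assms by simp
    finally have "5 * ennreal (real m / 4) \<le> ennreal (real m)"
      by (simp add: ennreal_of_nat_eq_real_of_nat)
    moreover have "5 * ennreal (real m / 4) = ennreal (5 * (real m / 4))" by (subst ennreal_mult') simp_all
    ultimately have "ennreal (5 * (real m / 4)) \<le> ennreal (real m)" by (simp only:)
    then show False using m by (simp add: ennreal_le_iff)
  qed
qed

text \<open>A doubling of at most 2m + 1 is below (2 + t) m - 3 because t m > 4, and the covering
  progression has at most (2m + 1) + 1 - m = m + 2 terms.\<close>

lemma (in modulus) small_doubling_in_AP:
  assumes q: "p = int q" and p: "p = 5 * int m + 3" and m: "m \<ge> 1"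
    and t: "feasible (1 / 5) t" "t * real m > 4"
    and X: "per X" "N X = int m" "N (X + X) \<le> 2 * int m + 1"
  shows "\<exists>d a. \<not> p dvd d \<and> X \<subseteq> {x. \<exists>i\<in>{0..<int m + 2}. p dvd x - (a + i * d)}"
proof -
  let ?G = "integer_mod_group q"
  have q0: "q > 0" using p_pos q by simp
  have pq: "prime q" using prime q by simp
  interpret comm_group ?G by (rule abelian_integer_mod_group)
  define X0 where "X0 = X \<inter> {0..<p}"
  have car: "carrier ?G = {0..<p}" using q0 q by (simp add: carrier_integer_mod_group)
  have X0: "X0 \<subseteq> carrier ?G" by (auto simp: X0_def car)
  have card0: "card X0 = m" using X(2) by (simp add: rcard_def X0_def)
  have "sumset_fold ?G 2 X0 \<subseteq> (X + X) \<inter> {0..<p}"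
  proof
    fix z assume "z \<in> sumset_fold ?G 2 X0"
    then obtain x y where "x \<in> X0" "y \<in> X0" "z = (x + y) mod p"
      using q by (auto simp: sumset_fold_2[OF X0])
    then show "z \<in> (X + X) \<inter> {0..<p}"
      using periodic_mod[OF periodic_plus1[OF X(1)]] p_pos by (auto simp: X0_def intro: set_plus_intro)
  qed
  then have "card (sumset_fold ?G 2 X0) \<le> card ((X + X) \<inter> {0..<p})" by (intro card_mono) auto
  then have card2: "card (sumset_fold ?G 2 X0) \<le> 2 * m + 1" using X(3) by (simp add: rcard_def)
  have "covering_property q X0"
  proof -
    have "real (card X0) \<le> 1 / 5 * real q" using card0 p q by simp
    moreover have "real (card (sumset_fold ?G 2 X0)) \<le> (2 + t) * real (card X0) - 3"
      using card2 card0 t(2) by (simp add: algebra_simps)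
    ultimately show ?thesis using t(1) X0 pq unfolding feasible_def by blast
  qed
  then obtain a d where ad: "d \<in> {1..<p}" "X0 \<subseteq> arith_prog q a d (card (sumset_fold ?G 2 X0) + 1 - card X0)"
    using q unfolding covering_property_def by blast
  have "X \<subseteq> {x. \<exists>i\<in>{0..<int m + 2}. p dvd x - (a + i * d)}"
  proof
    fix x assume "x \<in> X"
    then have "x mod p \<in> X0" using periodic_mod[OF X(1)] p_pos by (simp add: X0_def)
    then obtain i where i: "i < card (sumset_fold ?G 2 X0) + 1 - card X0" "x mod p = (a + int i * d) mod p"
      using ad(2) q by (auto simp: arith_prog_def)
    have "p dvd x - (a + int i * d)" using i(2) by (simp only: mod_eq_dvd_iff)
    moreover have "int i \<in> {0..<int m + 2}" using i(1) card2 card0 by auto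
    ultimately show "x \<in> {x. \<exists>i\<in>{0..<int m + 2}. p dvd x - (a + i * d)}" by blast
  qed
  moreover have "\<not> p dvd d" using ad(1) by (auto dest: zdvd_imp_le)
  ultimately show ?thesis by blast
qed

subsection \<open>Automorphisms and coordinates\<close>

text \<open>\<open>\<Phi>\<close> acts on integer vectors and induces an automorphism of \<open>F_p^n\<close>.\<close>

definition lift_aut :: "nat \<Rightarrow> nat \<Rightarrow> ((nat \<Rightarrow> int) \<Rightarrow> nat \<Rightarrow> int) \<Rightarrow> bool" where
  "lift_aut p n \<Phi> \<longleftrightarrow> (\<forall>x y. rd p n (\<Phi> (x + y)) = rd p n (\<Phi> x + \<Phi> y)) \<and>
     (\<forall>x y. rd p n (\<Phi> x) = rd p n (\<Phi> y) \<longleftrightarrow> rd p n x = rd p n y)"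

lemma lift_aut_cong: "lift_aut p n \<Phi> \<Longrightarrow> rd p n x = rd p n y \<Longrightarrow> rd p n (\<Phi> x) = rd p n (\<Phi> y)"
  by (simp add: lift_aut_def)

lemma lift_aut_comp: "lift_aut p n \<Phi> \<Longrightarrow> lift_aut p n \<Psi> \<Longrightarrow> lift_aut p n (\<lambda>x. \<Phi> (\<Psi> x))"
  unfolding lift_aut_def by metis

lemma lift_aut_bij:
  assumes p: "p > 0" and \<Phi>: "lift_aut p n \<Phi>"
  shows "bij_betw (\<lambda>x. rd p n (\<Phi> x)) (carrier (Fp_space p n)) (carrier (Fp_space p n))"
proof -
  let ?C = "carrier (Fp_space p n)"
  have "inj_on (\<lambda>x. rd p n (\<Phi> x)) ?C"
    using \<Phi> rd_id[OF p] by (intro inj_onI) (metis lift_aut_def)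
  moreover have "(\<lambda>x. rd p n (\<Phi> x)) ` ?C \<subseteq> ?C" using rd_carrier[OF p] by auto
  ultimately show ?thesis using endo_inj_surj[OF finite_Fp_space[OF p]] by (auto simp: bij_betw_def)
qed

lemma lift_aut_iso:
  assumes p: "p > 0" and \<Phi>: "lift_aut p n \<Phi>" and sub: "A \<subseteq> carrier (Fp_space p n)" "T \<subseteq> carrier (Fp_space p n)"
    and T: "\<And>x. rd p n x \<in> T \<longleftrightarrow> rd p n (\<Phi> x) \<in> A"
  shows "isomorphic_in (Fp_space p n) A T"
proof -
  let ?G = "Fp_space p n"
  interpret group ?G by (rule group_Fp_space)
  define f where "f x = rd p n (\<Phi> x)" for x
  have bij: "bij_betw f (carrier ?G) (carrier ?G)" unfolding f_def by (rule lift_aut_bij[OF p \<Phi>])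
  have "f \<in> hom ?G ?G"
  proof (rule homI)
    fix x y assume "x \<in> carrier ?G" "y \<in> carrier ?G"
    show "f x \<in> carrier ?G" by (simp add: f_def rd_carrier[OF p])
    have "f (x \<otimes>\<^bsub>?G\<^esub> y) = rd p n (\<Phi> (x + y))"
      unfolding f_def mult_Fp_space using rd_add[of p n "x + y" 0] by (intro lift_aut_cong[OF \<Phi>]) simp
    also have "\<dots> = rd p n (\<Phi> x + \<Phi> y)" using \<Phi> by (simp add: lift_aut_def)
    also have "\<dots> = f x \<otimes>\<^bsub>?G\<^esub> f y"
      using rd_add[of p n "\<Phi> x" "f y"] rd_add[of p n "\<Phi> y" "\<Phi> x"] by (simp add: mult_Fp_space f_def add.commute)
    finally show "f (x \<otimes>\<^bsub>?G\<^esub> y) = f x \<otimes>\<^bsub>?G\<^esub> f y" .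
  qed
  then have iso: "f \<in> iso ?G ?G" using bij by (simp add: iso_def)
  have mem: "x \<in> T \<longleftrightarrow> f x \<in> A" if "x \<in> carrier ?G" for x
    using T[of x] rd_id[OF p that] by (simp add: f_def)
  \<comment> \<open>\<open>T\<close> is the preimage of \<open>A\<close> under \<open>f\<close>, so
    the inverse is the automorphism to use.\<close>
  have "inv_into (carrier ?G) f ` A = T"
  proof (intro Set.set_eqI iffI)
    fix t assume "t \<in> inv_into (carrier ?G) f ` A"
    then obtain a where a: "a \<in> A" "t = inv_into (carrier ?G) f a" by auto
    then have "a \<in> f ` carrier ?G" using bij sub(1) by (auto simp: bij_betw_def)
    then have "t \<in> carrier ?G" "f t = a" unfolding a(2) by (rule inv_into_into, rule f_inv_into_f)
    then show "t \<in> T" using a mem by simp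
  next
    fix t assume "t \<in> T"
    then have "f t \<in> A" "t = inv_into (carrier ?G) f (f t)" using mem sub(2) bij
      by (auto simp: bij_betw_def subset_iff)
    then show "t \<in> inv_into (carrier ?G) f ` A" by blast
  qed
  then show ?thesis using iso_set_sym[OF iso] by (auto simp: isomorphic_in_def)
qed

lemma cons_collapse: "cons (x 0) (\<lambda>i. x (Suc i)) = x"
  by (auto simp: fun_eq_iff split: nat.split)

lemma rd_cons_eq_iff:
  assumes "n \<ge> 1"
  shows "rd p n (cons t v) = rd p n (cons t' v') \<longleftrightarrow> int p dvd t - t' \<and> rd p (n - 1) v = rd p (n - 1) v'"
proof -
  have "(\<forall>i<n. Q i) \<longleftrightarrow> Q 0 \<and> (\<forall>j<n - 1. Q (Suc j))" for Q
    using assms by (cases n) (auto simp: less_Suc_eq_0_disj)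
  then show ?thesis by (simp add: rd_eq_iff)
qed

lemma lift_autI:
  assumes n: "n \<ge> 1"
    and add: "\<And>x y. rd p n (\<Phi> (x + y)) = rd p n (\<Phi> x + \<Phi> y)"
    and iff: "\<And>t v t' v'. rd p n (\<Phi> (cons t v)) = rd p n (\<Phi> (cons t' v')) \<longleftrightarrow> int p dvd t - t' \<and> rd p (n - 1) v = rd p (n - 1) v'"
  shows "lift_aut p n \<Phi>"
  unfolding lift_aut_def
proof (intro conjI allI)
  fix x y
  show "rd p n (\<Phi> (x + y)) = rd p n (\<Phi> x + \<Phi> y)" by (rule add)
  show "rd p n (\<Phi> x) = rd p n (\<Phi> y) \<longleftrightarrow> rd p n x = rd p n y"
    using iff[of "x 0" "\<lambda>i. x (Suc i)" "y 0" "\<lambda>i. y (Suc i)"]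
      rd_cons_eq_iff[OF n, of p "x 0" "\<lambda>i. x (Suc i)" "y 0" "\<lambda>i. y (Suc i)"] unfolding cons_collapse by simp
qed

lemma lift_aut_shear:
  assumes n: "n \<ge> 1" and g: "\<And>u. g (rd p (n - 1) u) = g u" "\<And>u v. int p dvd g (u + v) - g u - g v"
  shows "lift_aut p n (\<lambda>x. cons (x 0 + g (\<lambda>i. x (Suc i))) (\<lambda>i. x (Suc i)))"
proof (rule lift_autI[OF n])
  fix x y :: "nat \<Rightarrow> int"
  have "(\<lambda>i. (x + y) (Suc i)) = (\<lambda>i. x (Suc i)) + (\<lambda>i. y (Suc i))" by (simp add: fun_eq_iff)
  then show "rd p n (cons ((x + y) 0 + g (\<lambda>i. (x + y) (Suc i))) (\<lambda>i. (x + y) (Suc i)))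
    = rd p n (cons (x 0 + g (\<lambda>i. x (Suc i))) (\<lambda>i. x (Suc i)) + cons (y 0 + g (\<lambda>i. y (Suc i))) (\<lambda>i. y (Suc i)))"
    using g(2)[of "\<lambda>i. x (Suc i)" "\<lambda>i. y (Suc i)"]
    by (auto simp: rd_eq_iff algebra_simps split: nat.split)
next
  fix t v t' v'
  have "g v = g v'" if "rd p (n - 1) v = rd p (n - 1) v'" using g(1)[of v] g(1)[of v'] that by simp
  then show "rd p n (cons (cons t v 0 + g (\<lambda>i. cons t v (Suc i))) (\<lambda>i. cons t v (Suc i)))
    = rd p n (cons (cons t' v' 0 + g (\<lambda>i. cons t' v' (Suc i))) (\<lambda>i. cons t' v' (Suc i)))
    \<longleftrightarrow> int p dvd t - t' \<and> rd p (n - 1) v = rd p (n - 1) v'"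
    by (auto simp: rd_cons_eq_iff[OF n])
qed

text \<open>The shear in the other direction: the first coordinate stays, and the slice at
  \<open>t\<close> is translated by \<open>t * w\<close>.\<close>

lemma lift_aut_shear_tail:
  assumes n: "n \<ge> 1"
  shows "lift_aut p n (\<lambda>x. cons (x 0) (\<lambda>i. x (Suc i) + x 0 * w i))"
proof (rule lift_autI[OF n])
  fix x y :: "nat \<Rightarrow> int"
  show "rd p n (cons ((x + y) 0) (\<lambda>i. (x + y) (Suc i) + (x + y) 0 * w i))
    = rd p n (cons (x 0) (\<lambda>i. x (Suc i) + x 0 * w i) + cons (y 0) (\<lambda>i. y (Suc i) + y 0 * w i))"
    by (auto simp: rd_eq_iff algebra_simps split: nat.split)
next
  fix t t' :: int and v v' :: "nat \<Rightarrow> int"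
  have "rd p (n - 1) (\<lambda>i. v i + t * w i) = rd p (n - 1) (\<lambda>i. v' i + t' * w i) \<longleftrightarrow> rd p (n - 1) v = rd p (n - 1) v'"
    if "int p dvd t - t'"
  proof -
    have "int p dvd (v i + t * w i) - (v' i + t' * w i) \<longleftrightarrow> int p dvd v i - v' i" for i
    proof -
      have "(v i + t * w i) - (v' i + t' * w i) = (v i - v' i) + (t - t') * w i" by (simp add: algebra_simps)
      then show ?thesis using that by (metis dvd_add_left_iff dvd_mult2)
    qed
    then show ?thesis by (simp add: rd_eq_iff)
  qed
  then show "rd p n (cons (cons t v 0) (\<lambda>i. cons t v (Suc i) + cons t v 0 * w i))
    = rd p n (cons (cons t' v' 0) (\<lambda>i. cons t' v' (Suc i) + cons t' v' 0 * w i))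
    \<longleftrightarrow> int p dvd t - t' \<and> rd p (n - 1) v = rd p (n - 1) v'"
    by (auto simp: rd_cons_eq_iff[OF n])
qed

lemma lift_aut_uminus: "lift_aut p n uminus"
proof -
  have "int p dvd - a - - b \<longleftrightarrow> int p dvd a - b" for a b :: int
    using dvd_minus_iff[of "int p" "a - b"] by (simp add: algebra_simps)
  then show ?thesis by (simp add: lift_aut_def rd_eq_iff)
qed

text \<open>The linear map with first unit vector sent to \<open>d\<close> and, if \<open>i0\<close>
  is not 0, the unit vector at \<open>i0\<close> sent to the first one; the others are fixed. Its
  determinant is \<open>d i0\<close> up to sign.\<close>

definition direction_map :: "(nat \<Rightarrow> int) \<Rightarrow> nat \<Rightarrow> (nat \<Rightarrow> int) \<Rightarrow> nat \<Rightarrow> int" where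
  "direction_map d i0 x = (\<lambda>j. x 0 * d j + (if j = i0 then 0 else if j = 0 then x i0 else x j))"

lemma lift_aut_direction_map:
  assumes p: "prime p" and i0: "i0 < n" "\<not> int p dvd d i0"
  shows "lift_aut p n (direction_map d i0)"
  unfolding lift_aut_def
proof (intro conjI allI)
  fix x y
  show "rd p n (direction_map d i0 (x + y)) = rd p n (direction_map d i0 x + direction_map d i0 y)"
    by (rule arg_cong[of _ _ "rd p n"]) (auto simp: direction_map_def fun_eq_iff algebra_simps)
  have diff: "direction_map d i0 x j - direction_map d i0 y j
      = (x 0 - y 0) * d j + (if j = i0 then 0 else if j = 0 then x i0 - y i0 else x j - y j)" for j
    by (simp add: direction_map_def algebra_simps)
  show "rd p n (direction_map d i0 x) = rd p n (direction_map d i0 y) \<longleftrightarrow> rd p n x = rd p n y"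
  proof
    assume "rd p n x = rd p n y"
    then have "int p dvd x j - y j" if "j < n" for j using that by (simp add: rd_eq_iff)
    then have "int p dvd (x 0 - y 0) * d j + (if j = i0 then 0 else if j = 0 then x i0 - y i0 else x j - y j)"
      if "j < n" for j using that i0(1) by (intro dvd_add dvd_mult2) auto
    then show "rd p n (direction_map d i0 x) = rd p n (direction_map d i0 y)" by (simp add: rd_eq_iff diff)
  next
    assume "rd p n (direction_map d i0 x) = rd p n (direction_map d i0 y)"
    then have *: "int p dvd (x 0 - y 0) * d j + (if j = i0 then 0 else if j = 0 then x i0 - y i0 else x j - y j)"
      if "j < n" for j using that by (simp add: rd_eq_iff diff)
    have "int p dvd (x 0 - y 0) * d i0" using *[OF i0(1)] by simp
    then have 0: "int p dvd x 0 - y 0" using i0(2) p by (simp add: prime_dvd_mult_iff)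
    have "int p dvd x j - y j" if "j < n" for j
    proof (cases "j = 0")
      case False
      show ?thesis
      proof (cases "j = i0")
        case True
        then show ?thesis using *[of 0] 0 that False by (auto simp: dvd_add_right_iff)
      next
        case ne: False
        then show ?thesis using *[OF that] 0 False by (auto simp: dvd_add_right_iff)
      qed
    qed (use 0 in simp)
    then show "rd p n x = rd p n y" by (simp add: rd_eq_iff)
  qed
qed

lemma direction_map_line: "direction_map d i0 (cons t 0) = (\<lambda>j. t * d j)"
  by (auto simp: direction_map_def fun_eq_iff split: nat.split)

text \<open>Averages \<open>|A|\<close> over the lines through the origin, which is not in \<open>A\<close>.\<close>

lemma exists_popular_line:
  assumes p: "prime p" and m: "1 \<le> m" "m < p" and A: "A \<subseteq> carrier (Fp_space p n)" "rd p n 0 \<notin> A"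
    and n: "n \<ge> 1" and card: "card A \<ge> m * p ^ (n - 1)"
  obtains d where "rd p n d \<noteq> rd p n 0" "card {t \<in> {0..<int p}. rd p n (\<lambda>j. t * d j) \<in> A} \<ge> m"
proof -
  have p0: "p > 0" using p by (simp add: prime_gt_0_nat)
  define C where "C = carrier (Fp_space p n)"
  define D where "D = C - {rd p n 0}"
  have fC: "finite C" using finite_Fp_space[OF p0] by (simp add: C_def)
  have z: "rd p n 0 \<in> C" using rd_carrier[OF p0] by (simp add: C_def)
  have cD: "card D = p ^ n - 1" using card_Fp_space[OF p0] z fC by (simp add: D_def C_def)
  define R where "R d = {t \<in> {1..<int p}. rd p n (\<lambda>j. t * d j) \<in> A}" for d
  \<comment> \<open>For fixed \<open>t\<close>, multiplication by \<open>t\<close> permutes the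
    nonzero vectors, so each element of \<open>A\<close> is hit exactly once.\<close>
  have inner: "card {d \<in> D. rd p n (\<lambda>j. t * d j) \<in> A} = card A" if t: "t \<in> {1..<int p}" for t
  proof -
    interpret modulus "int p" using p by unfold_locales simp
    have nt: "\<not> int p dvd t" using t by (auto dest: zdvd_imp_le)
    then obtain e where e: "int p dvd t * e - 1" using unit_inverse by blast
    then have e': "int p dvd e * t - 1" by (simp add: mult.commute)
    have mod: "rd p n (\<lambda>j. a * rd p n x j) = rd p n (\<lambda>j. a * x j)" for a x
      by (auto simp: rd_def fun_eq_iff restrict_def mod_mult_right_eq)
    have te: "rd p n (\<lambda>j. t * (e * x j)) = rd p n x" "rd p n (\<lambda>j. e * (t * x j)) = rd p n x" for x
      using dvd_diff_mult[OF e] dvd_diff_mult[OF e'] by (simp_all add: rd_eq_iff)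
    have "bij_betw (\<lambda>d. rd p n (\<lambda>j. t * d j)) {d \<in> D. rd p n (\<lambda>j. t * d j) \<in> A} A"
    proof (rule bij_betw_byWitness[where f' = "\<lambda>a. rd p n (\<lambda>j. e * a j)"])
      show "\<forall>d\<in>{d \<in> D. rd p n (\<lambda>j. t * d j) \<in> A}. rd p n (\<lambda>j. e * rd p n (\<lambda>j. t * d j) j) = d"
        using rd_id[OF p0] by (auto simp: mod te D_def C_def)
      show "\<forall>a\<in>A. rd p n (\<lambda>j. t * rd p n (\<lambda>j. e * a j) j) = a"
        using rd_id[OF p0] A by (auto simp: mod te)
      show "(\<lambda>d. rd p n (\<lambda>j. t * d j)) ` {d \<in> D. rd p n (\<lambda>j. t * d j) \<in> A} \<subseteq> A" by auto
      show "(\<lambda>a. rd p n (\<lambda>j. e * a j)) ` A \<subseteq> {d \<in> D. rd p n (\<lambda>j. t * d j) \<in> A}"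
      proof
        fix d assume "d \<in> (\<lambda>a. rd p n (\<lambda>j. e * a j)) ` A"
        then obtain a where a: "a \<in> A" "d = rd p n (\<lambda>j. e * a j)" by auto
        have td: "rd p n (\<lambda>j. t * d j) = a" using a A rd_id[OF p0] by (auto simp: mod te)
        have "d \<noteq> rd p n 0"
        proof
          assume "d = rd p n 0"
          then have "a = rd p n 0" using mod[of t 0] td by (simp add: zero_fun_def)
          then show False using A(2) a(1) by simp
        qed
        then show "d \<in> {d \<in> D. rd p n (\<lambda>j. t * d j) \<in> A}"
          using a td rd_carrier[OF p0] by (simp add: D_def C_def)
      qed
    qed
    then show ?thesis by (rule bij_betw_same_card)
  qed
  have "(\<Sum>d\<in>D. card (R d)) = (\<Sum>d\<in>D. \<Sum>t\<in>{1..<int p}. of_bool (rd p n (\<lambda>j. t * d j) \<in> A))"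
    by (simp add: R_def Int_def)
  also have "\<dots> = (\<Sum>t\<in>{1..<int p}. card {d \<in> D. rd p n (\<lambda>j. t * d j) \<in> A})"
    using fC by (subst sum.swap) (simp add: D_def Int_def)
  also have "\<dots> = (p - 1) * card A" using inner p0 by (simp add: nat_diff_distrib)
  finally have total: "(\<Sum>d\<in>D. card (R d)) = (p - 1) * card A" .
  have "\<exists>d\<in>D. card (R d) \<ge> m"
  proof (rule ccontr)
    assume "\<not> ?thesis"
    then have "(\<Sum>d\<in>D. card (R d)) \<le> (\<Sum>d\<in>D. m - 1)" by (intro sum_mono) force
    then have le: "(p - 1) * card A \<le> (p ^ n - 1) * (m - 1)" using total cD by simp
    \<comment> \<open>Without a popular line, (p - 1) m X <= (p X - 1) (m - 1), that is p X + m <= m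
      X + 1, contrary to m < p.\<close>
    define X where "X = p ^ (n - 1)"
    have "p ^ Suc (n - 1) = p * X" by (simp add: X_def)
    then have X: "X \<ge> 1" "p ^ n = p * X" using p0 n by (simp_all add: X_def)
    have "(p - 1) * (m * X) \<le> (p * X - 1) * (m - 1)"
      using order_trans[OF mult_le_mono2[OF card[folded X_def]] le[unfolded X(2)]] .
    then have "(int p - 1) * (int m * int X) \<le> (int p * int X - 1) * (int m - 1)"
    proof -
      have "int ((p - 1) * (m * X)) \<le> int ((p * X - 1) * (m - 1))"
        using \<open>(p - 1) * (m * X) \<le> (p * X - 1) * (m - 1)\<close> by (simp only: of_nat_le_iff)
      moreover have "p * X \<ge> 1" using p0 X by simp
      ultimately show ?thesis using p0 m by (simp add: of_nat_diff)
    qed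
    then have "int p * int X + int m \<le> int m * int X + 1" by (simp add: algebra_simps)
    moreover have "(int m + 1) * int X \<le> int p * int X" using m by (intro mult_right_mono) auto
    ultimately show False using X m by (simp add: algebra_simps)
  qed
  then obtain d where d: "d \<in> D" "card (R d) \<ge> m" by auto
  have "card (R d) \<le> card {t \<in> {0..<int p}. rd p n (\<lambda>j. t * d j) \<in> A}"
    by (intro card_mono finite_subset[of "{t \<in> {0..<int p}. rd p n (\<lambda>j. t * d j) \<in> A}" "{0..<int p}"]) (auto simp: R_def)
  then show ?thesis using that[of d] d rd_id[OF p0] by (auto simp: D_def C_def)
qed

lemma lift_aut_zero:
  assumes "lift_aut p n \<Phi>"
  shows "rd p n (\<Phi> 0) = rd p n 0"
proof -
  have "rd p n (\<Phi> (0 + 0)) = rd p n (\<Phi> 0 + \<Phi> 0)" using assms unfolding lift_aut_def by blast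
  then show ?thesis by (auto simp: rd_eq_iff)
qed

lemma lift_aut_sg:
  assumes "lift_aut p n \<Phi>"
  shows "rd p n (\<Phi> (x + sg b y)) = rd p n (\<Phi> x + sg b (\<Phi> y))"
proof (cases b)
  case True
  then show ?thesis using assms by (simp add: sg_def lift_aut_def)
next
  case False
  have 1: "rd p n (\<Phi> (y + - y)) = rd p n (\<Phi> y + \<Phi> (- y))" using assms unfolding lift_aut_def by blast
  then have 2: "rd p n (\<Phi> y + \<Phi> (- y)) = rd p n 0" using lift_aut_zero[OF assms] by simp
  have "rd p n (\<Phi> (x + - y)) = rd p n (\<Phi> x + \<Phi> (- y))" using assms unfolding lift_aut_def by blast
  also have "\<dots> = rd p n (\<Phi> x + - \<Phi> y)" using 2 by (simp add: rd_eq_iff add.commute)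
  finally show ?thesis using False by (simp add: sg_def)
qed

lemma lift_aut_signed_sum:
  assumes "lift_aut p n \<Phi>"
  shows "rd p n (\<Phi> (x1 + x2 + x3 + sg b x4)) = rd p n (\<Phi> x1 + \<Phi> x2 + \<Phi> x3 + sg b (\<Phi> x4))"
proof -
  have add: "rd p n (\<Phi> (x + y)) = rd p n (\<Phi> x + \<Phi> y)" for x y using assms unfolding lift_aut_def by blast
  have cong: "rd p n (u + w) = rd p n (u' + w)" if "rd p n u = rd p n u'" for u u' w
    using that rd_add[of p n u w] rd_add[of p n u' w] by simp
  show ?thesis using lift_aut_sg[OF assms] cong[OF add] cong[OF cong[OF add]] by (simp add: add)
qed

text \<open>\<open>S\<close> lists the slices of \<open>A\<close> in some linear coordinate system.
  Up to isomorphism it does not matter which one, so \<open>\<Phi>\<close> is hidden and later steps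
  change it freely.\<close>

definition models :: "nat \<Rightarrow> nat \<Rightarrow> (nat \<Rightarrow> int) set \<Rightarrow> (int \<Rightarrow> (nat \<Rightarrow> int) set) \<Rightarrow> bool" where
  "models p n A S \<longleftrightarrow> (\<exists>\<Phi>. lift_aut p n \<Phi> \<and> (\<forall>t v. v \<in> S t \<longleftrightarrow> rd p n (\<Phi> (cons t v)) \<in> A))"

lemma models_reflect:
  assumes "models p n A S"
  shows "models p n A (\<lambda>x. {v. - v \<in> S (- x)})"
proof -
  obtain \<Phi> where \<Phi>: "lift_aut p n \<Phi>" "\<And>t v. v \<in> S t \<longleftrightarrow> rd p n (\<Phi> (cons t v)) \<in> A"
    using assms by (auto simp: models_def)
  have "cons (- t) (- v) = - cons t v" for t v by (auto simp: fun_eq_iff split: nat.split)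
  then have "\<forall>t v. v \<in> {v. - v \<in> S (- t)} \<longleftrightarrow> rd p n (\<Phi> (- cons t v)) \<in> A" using \<Phi>(2) by simp
  then show ?thesis unfolding models_def using lift_aut_comp[OF \<Phi>(1) lift_aut_uminus] by blast
qed

lemma models_shear:
  assumes "n \<ge> 1" "models p n A S"
  shows "models p n A (\<lambda>x. {v. v + (\<lambda>i. x * w i) \<in> S x})"
proof -
  obtain \<Phi> where \<Phi>: "lift_aut p n \<Phi>" "\<And>t v. v \<in> S t \<longleftrightarrow> rd p n (\<Phi> (cons t v)) \<in> A"
    using assms by (auto simp: models_def)
  define \<Psi> :: "(nat \<Rightarrow> int) \<Rightarrow> nat \<Rightarrow> int" where "\<Psi> x = cons (x 0) (\<lambda>i. x (Suc i) + x 0 * w i)" for x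
  have "lift_aut p n \<Psi>" unfolding \<Psi>_def by (rule lift_aut_shear_tail[OF assms(1)])
  moreover have "\<Psi> (cons t v) = cons t (v + (\<lambda>i. t * w i))" for t v by (simp add: \<Psi>_def plus_fun_def)
  then have "\<forall>t v. v \<in> {v. v + (\<lambda>i. t * w i) \<in> S t} \<longleftrightarrow> rd p n (\<Phi> (\<Psi> (cons t v))) \<in> A" using \<Phi>(2) by simp
  ultimately show ?thesis unfolding models_def using lift_aut_comp[OF \<Phi>(1)] by blast
qed

lemma models_iso:
  assumes "p > 0" "models p n A S" "A \<subseteq> carrier (Fp_space p n)" "T \<subseteq> carrier (Fp_space p n)"
    and T: "\<And>t v. rd p n (cons t v) \<in> T \<longleftrightarrow> v \<in> S t"
  shows "isomorphic_in (Fp_space p n) A T"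
proof -
  obtain \<Phi> where \<Phi>: "lift_aut p n \<Phi>" "\<And>t v. v \<in> S t \<longleftrightarrow> rd p n (\<Phi> (cons t v)) \<in> A"
    using assms(2) by (auto simp: models_def)
  show ?thesis
  proof (rule lift_aut_iso[OF assms(1) \<Phi>(1) assms(3,4)])
    fix x show "rd p n x \<in> T \<longleftrightarrow> rd p n (\<Phi> x) \<in> A"
      using T[of "x 0" "\<lambda>i. x (Suc i)"] \<Phi>(2)[of "\<lambda>i. x (Suc i)" "x 0"] unfolding cons_collapse by simp
  qed
qed

lemma cons_signed_sum:
  "cons t1 v1 + cons t2 v2 + cons t3 v3 + sg b (cons t4 v4) = cons (t1 + t2 + t3 + sg b t4) (v1 + v2 + v3 + sg b v4)"
  by (auto simp: fun_eq_iff sg_def split: nat.split)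

lemma card_columns:
  assumes p: "p > 0" and n: "n \<ge> 1" and \<Phi>: "lift_aut p n \<Phi>" and A: "A \<subseteq> carrier (Fp_space p n)"
  shows "(\<Sum>v\<in>carrier (Fp_space p (n - 1)). card ({t. rd p n (\<Phi> (cons t v)) \<in> A} \<inter> {0..<int p})) = card A"
proof -
  define W where "W = carrier (Fp_space p (n - 1))"
  define R where "R v = {t. rd p n (\<Phi> (cons t v)) \<in> A} \<inter> {0..<int p}" for v
  have "bij_betw (\<lambda>(v, t). rd p n (\<Phi> (cons t v))) (Sigma W R) A"
    unfolding bij_betw_def
  proof
    show "inj_on (\<lambda>(v, t). rd p n (\<Phi> (cons t v))) (Sigma W R)"
    proof (rule inj_onI, clarify)
      fix v t v' t' assume vt: "v \<in> W" "t \<in> R v" "v' \<in> W" "t' \<in> R v'"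
        and "rd p n (\<Phi> (cons t v)) = rd p n (\<Phi> (cons t' v'))"
      then have "rd p n (cons t v) = rd p n (cons t' v')" using \<Phi> by (simp add: lift_aut_def)
      then have eq: "int p dvd t - t'" "rd p (n - 1) v = rd p (n - 1) v'" using rd_cons_eq_iff[OF n] by auto
      have "t mod int p = t' mod int p" using eq(1) by (simp only: mod_eq_dvd_iff)
      then have "t = t'" using vt by (simp add: R_def)
      then show "v = v' \<and> t = t'" using eq(2) vt rd_id[OF p] by (simp add: W_def)
    qed
    show "(\<lambda>(v, t). rd p n (\<Phi> (cons t v))) ` Sigma W R = A"
    proof (intro Set.set_eqI iffI)
      fix a assume a: "a \<in> A"
      then obtain x where x: "a = rd p n (\<Phi> x)"
        using lift_aut_bij[OF p \<Phi>] A unfolding bij_betw_def by blast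
      define t where "t = x 0 mod int p"
      define v where "v = rd p (n - 1) (\<lambda>i. x (Suc i))"
      have "rd p n (cons t v) = rd p n (cons (x 0) (\<lambda>i. x (Suc i)))"
        using rd_add[of p "n - 1" "\<lambda>i. x (Suc i)" 0] by (simp add: rd_cons_eq_iff[OF n] t_def v_def dvd_mod_diff)
      then have "rd p n (\<Phi> (cons t v)) = a" using lift_aut_cong[OF \<Phi>] unfolding x cons_collapse by blast
      moreover have "v \<in> W" "t \<in> R v" using calculation a p rd_carrier[OF p] by (simp_all add: v_def W_def R_def t_def)
      ultimately show "a \<in> (\<lambda>(v, t). rd p n (\<Phi> (cons t v))) ` Sigma W R" by (auto intro!: image_eqI[of _ _ "(v, t)"])
    qed (auto simp: R_def)
  qed
  then have "card (Sigma W R) = card A" by (rule bij_betw_same_card)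
  moreover have "card (Sigma W R) = (\<Sum>v\<in>W. card (R v))"
    using finite_Fp_space[OF p] by (intro card_SigmaI) (auto simp: W_def R_def)
  ultimately show ?thesis by (simp add: W_def R_def)
qed

lemma exists_model:
  assumes p: "prime p" "p = 5 * m + 3" and T: "of_nat m \<ge> max (5 * T_fun (1 / 5)) 21" and n: "n \<ge> 1"
    and kl: "(k, l) = (4, 1) \<or> (k, l) = (3, 2)" and A: "sum_free (Fp_space p n) k l A"
    and card: "card A \<ge> m * p ^ (n - 1)"
  shows "\<exists>S c H. models p n A S \<and> slices (int p) (rd p (n - 1)) (int m) (k = 4) S c H"
proof -
  obtain \<tau> where \<tau>: "feasible (1 / 5) \<tau>" "\<tau> * real m > 4" and m: "m \<ge> 21" using exists_feasible[OF T] by blast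
  have p0: "p > 0" using p by simp
  interpret modulus "int p" using p(1) by unfold_locales simp
  have sub: "A \<subseteq> carrier (Fp_space p n)" using A by (simp add: sum_free_def)
  note free = sum_freeD[OF p0 A kl]
  have zero: "rd p n 0 \<notin> A" using free[of 0 0 0 0] by (auto simp: sg_0)
  obtain d where d: "rd p n d \<noteq> rd p n 0" "card {t \<in> {0..<int p}. rd p n (\<lambda>j. t * d j) \<in> A} \<ge> m"
    using exists_popular_line[OF p(1) _ _ sub zero n card] m p by auto
  obtain i0 where i0: "i0 < n" "\<not> int p dvd d i0" using d(1) by (auto simp: rd_eq_iff)
  define X where "X = {t. rd p n (\<lambda>j. t * d j) \<in> A}"
  have perX: "per X"
  proof (rule periodicI)
    fix t k assume "t \<in> X"
    moreover have "rd p n (\<lambda>j. (t + k * int p) * d j) = rd p n (\<lambda>j. t * d j)"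
      by (simp add: rd_eq_iff algebra_simps)
    ultimately show "t + k * int p \<in> X" by (simp add: X_def)
  qed
  have NX: "N X \<ge> int m" using d(2) by (simp add: rcard_def X_def Int_def conj_commute)
  have freeX: "x1 + x2 + x3 + sg (k = 4) x4 \<noteq> x5" if x: "x1 \<in> X" "x2 \<in> X" "x3 \<in> X" "x4 \<in> X" "x5 \<in> X" for x1 x2 x3 x4 x5
  proof
    assume "x1 + x2 + x3 + sg (k = 4) x4 = x5"
    then have "(\<lambda>j. x1 * d j) + (\<lambda>j. x2 * d j) + (\<lambda>j. x3 * d j) + sg (k = 4) (\<lambda>j. x4 * d j) = (\<lambda>j. x5 * d j)"
      by (auto simp: fun_eq_iff sg_def algebra_simps)
    then show False using free[of "\<lambda>j. x1 * d j" "\<lambda>j. x2 * d j" "\<lambda>j. x3 * d j" "\<lambda>j. x4 * d j"] x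
      by (simp add: X_def)
  qed
  have "\<exists>\<delta> a. \<not> int p dvd \<delta> \<and> X \<subseteq> {x. \<exists>i\<in>{0..<int m + 2}. int p dvd x - (a + i * \<delta>)}"
  proof (rule sum_free_line_in_AP[OF _ _ perX NX freeX])
    show "\<exists>\<delta> a. \<not> int p dvd \<delta> \<and> X \<subseteq> {x. \<exists>i\<in>{0..<int m + 2}. int p dvd x - (a + i * \<delta>)}"
      if "N X = int m" "N (X + X) \<le> 2 * int m + 1"
      using that m p perX \<tau> by (intro small_doubling_in_AP[of p m \<tau>]) auto
  qed (use p m in auto)
  then obtain \<delta> a where \<delta>: "\<not> int p dvd \<delta>" and Xsub: "X \<subseteq> {x. \<exists>i\<in>{0..<int m + 2}. int p dvd x - (a + i * \<delta>)}"
    by blast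
  obtain e where e: "int p dvd \<delta> * e - 1" using unit_inverse[OF \<delta>] by blast
  have e': "int p dvd e * \<delta> - 1" using e by (simp add: mult.commute)
  \<comment> \<open>The direction \<open>\<delta> * d\<close> makes the progression of difference
    \<open>\<delta>\<close> an interval; with \<open>e\<close> inverse to \<open>\<delta>\<close> it
    starts at \<open>e * a\<close>.\<close>
  define \<Phi> where "\<Phi> = direction_map (\<lambda>j. \<delta> * d j) i0"
  have \<Phi>: "lift_aut p n \<Phi>" unfolding \<Phi>_def
    using \<delta> i0 prime by (intro lift_aut_direction_map[OF p(1) i0(1)]) (simp add: prime_dvd_mult_iff)
  define B where "B v = {t. rd p n (\<Phi> (cons t v)) \<in> A}" for v
  have B_cong: "t \<in> B v \<longleftrightarrow> t' \<in> B v'" if "int p dvd t - t'" "rd p (n - 1) v = rd p (n - 1) v'" for t t' v v'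
    using that lift_aut_cong[OF \<Phi>, of "cons t v" "cons t' v'"] rd_cons_eq_iff[OF n] by (simp add: B_def)
  have B0: "B 0 = {t. \<delta> * t \<in> X}"
    unfolding B_def \<Phi>_def X_def direction_map_line by (simp add: algebra_simps)
  have W: "range (rd p (n - 1)) = carrier (Fp_space p (n - 1))" by (rule range_rd[OF p0])
  interpret quotient_map "rd p (n - 1)" by (rule quotient_map_rd[OF p0])
  have "columns (int p) (rd p (n - 1)) (int m) (k = 4) B (e * a)"
  proof
    show "int p = 5 * int m + 3" "21 \<le> int m" using p m by simp_all
    show "rd p (n - 1) (((+) v ^^ nat (int p)) 0) = rd p (n - 1) 0" for v by (rule rd_torsion)
    show "B (rd p (n - 1) v) = B v" for v
      by (intro Set.set_eqI B_cong red_red) simp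
    show "per (B v)" for v
    proof (rule periodicI)
      fix t k assume "t \<in> B v"
      then show "t + k * int p \<in> B v" using B_cong[of "t + k * int p" t v v] by simp
    qed
    show "t1 + t2 + t3 + sg (k = 4) t4 \<noteq> t5"
      if t: "t1 \<in> B v1" "t2 \<in> B v2" "t3 \<in> B v3" "t4 \<in> B v4" "t5 \<in> B (v1 + v2 + v3 + sg (k = 4) v4)"
      for t1 v1 t2 v2 t3 v3 t4 v4 t5
    proof
      assume "t1 + t2 + t3 + sg (k = 4) t4 = t5"
      then have "rd p n (\<Phi> (cons t1 v1 + cons t2 v2 + cons t3 v3 + sg (k = 4) (cons t4 v4))) \<in> A"
        using t(5) unfolding cons_signed_sum B_def by simp
      then show False unfolding lift_aut_signed_sum[OF \<Phi>] using free t(1-4) by (simp add: B_def)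
    qed
    have "(\<Sum>v\<in>range (rd p (n - 1)). N (B v)) = int (card A)"
      using card_columns[OF p0 n \<Phi> sub] unfolding W B_def rcard_def of_nat_sum[symmetric] by simp
    moreover have "int (card (range (rd p (n - 1)))) = int p ^ (n - 1)" unfolding W by (simp add: card_Fp_space[OF p0])
    moreover have "int m * int p ^ (n - 1) \<le> int (card A)" using card by (simp flip: of_nat_power of_nat_mult)
    ultimately show "int m * int (card (range (rd p (n - 1)))) \<le> (\<Sum>v\<in>range (rd p (n - 1)). N (B v))" by simp
    show "int m \<le> N (B 0)" unfolding B0 using N_dilate[OF perX \<delta>] NX by simp
    show "B 0 \<subseteq> {x. \<exists>i\<in>{0..<int m + 2}. int p dvd x - (e * a + i)}"
    proof
      fix t assume "t \<in> B 0"
      then obtain i where i: "i \<in> {0..<int m + 2}" "int p dvd \<delta> * t - (a + i * \<delta>)" using Xsub B0 by blast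
      have "int p dvd t - (e * a + i)"
        by (rule dvd_lincomb[OF i(2) e', of _ e "i - t" 0]) (simp add: algebra_simps)
      then show "t \<in> {x. \<exists>i\<in>{0..<int m + 2}. int p dvd x - (e * a + i)}" using i(1) by blast
    qed
  qed
  then obtain g c H where g: "\<And>u. g (rd p (n - 1) u) = g u" "\<And>u v. int p dvd g (u + v) - g u - g v"
    and sl: "slices (int p) (rd p (n - 1)) (int m) (k = 4) (\<lambda>x. {v. x + g v \<in> B v}) c H"
    using columns.exists_slices by blast
  have "models p n A (\<lambda>x. {v. x + g v \<in> B v})"
    unfolding models_def
  proof (intro exI conjI allI)
    show "lift_aut p n (\<lambda>x. \<Phi> (cons (x 0 + g (\<lambda>i. x (Suc i))) (\<lambda>i. x (Suc i))))"
      by (rule lift_aut_comp[OF \<Phi> lift_aut_shear[OF n g]])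
  qed (simp add: B_def)
  then show ?thesis using sl by blast
qed

subsection \<open>Classification\<close>

lemma (in slices) in_slice_iff:
  assumes "p dvd c - c0"
  shows "v \<in> S t \<longleftrightarrow> (\<exists>i\<in>{0..H}. p dvd t - (c0 + i) \<and> v \<in> S (c0 + i))"
proof
  assume v: "v \<in> S t"
  then obtain k where k: "t + k * p \<in> {c..c + H}" using support[of t] by blast
  have dv: "p dvd t - (c0 + (t + k * p - c))"
    by (rule dvd_lincomb[OF assms dvd_0_right, of _ 1 0 "- k"]) (simp add: algebra_simps)
  have "v \<in> S (c0 + (t + k * p - c))" using v S_cong[OF dv] by simp
  with dv show "\<exists>i\<in>{0..H}. p dvd t - (c0 + i) \<and> v \<in> S (c0 + i)"
    using k by (intro bexI[of _ "t + k * p - c"]) auto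
qed (use S_cong in auto)

lemma (in slices) S_shift_base: "p dvd c - c0 \<Longrightarrow> S (c0 + i) = S (c + i)"
  using S_cong[of "c + i" "c0 + i"] by simp

lemma (in slices) offset_alt:
  assumes "k' = (if pos then 4 else 3)" "l' = (if pos then 1 else 2)"
  shows "offset = l' * H - (k' - l') * c"
  unfolding offset_def using assms by simp

lemma (in modulus) same_index:
  assumes "p dvd t - (c + i)" "p dvd t - (c + j)" "0 \<le> i" "i < p" "0 \<le> j" "j < p"
  shows "i = j"
proof -
  have "p dvd i - j" by (rule dvd_lincomb[OF assms(1,2), of _ "-1" 1 0]) simp
  moreover have "\<bar>i - j\<bar> < p" using assms by auto
  ultimately show ?thesis using dvd_imp_le_int[of "i - j" p] p_pos by auto
qed

lemma (in modulus) cyc_interval_iff: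
  assumes p: "p = int q" and t: "p dvd t - (c + i)" "0 \<le> i" "i < p" and ab: "0 \<le> \<alpha>" "\<alpha> \<le> \<beta>" "\<beta> < p"
  shows "t mod p \<in> cyc_interval q (c + \<alpha>) (c + \<beta>) \<longleftrightarrow> \<alpha> \<le> i \<and> i \<le> \<beta>"
proof -
  have len: "(c + \<beta> - (c + \<alpha>)) mod p = \<beta> - \<alpha>" using ab by simp
  show ?thesis
  proof
    assume "t mod p \<in> cyc_interval q (c + \<alpha>) (c + \<beta>)"
    then obtain j where j: "0 \<le> j" "j \<le> \<beta> - \<alpha>" "t mod p = (c + \<alpha> + j) mod p"
      using len p by (auto simp: cyc_interval_def)
    have "p dvd t - (c + (\<alpha> + j))" using j(3) by (simp add: mod_eq_dvd_iff add.assoc)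
    then have "i = \<alpha> + j" using t ab j by (intro same_index[of t c]) auto
    then show "\<alpha> \<le> i \<and> i \<le> \<beta>" using j by simp
  next
    assume i: "\<alpha> \<le> i \<and> i \<le> \<beta>"
    have "t mod p = (c + \<alpha> + (i - \<alpha>)) mod p" using t(1) by (simp add: mod_eq_dvd_iff)
    then show "t mod p \<in> cyc_interval q (c + \<alpha>) (c + \<beta>)"
      unfolding cyc_interval_def using i len p by (intro image_eqI[of _ _ "i - \<alpha>"]) auto
  qed
qed

lemma (in modulus) residue_iff:
  assumes t: "p dvd t - (c + i)" "0 \<le> i" "i < p" and a: "0 \<le> \<alpha>" "\<alpha> < p"
  shows "t mod p = (c + \<alpha>) mod p \<longleftrightarrow> i = \<alpha>"
proof
  assume "t mod p = (c + \<alpha>) mod p"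
  then have "p dvd t - (c + \<alpha>)" by (simp add: mod_eq_dvd_iff)
  then show "i = \<alpha>" using t a by (intro same_index[of t c])
qed (use t in \<open>simp add: mod_eq_dvd_iff\<close>)

lemma rd_cons_in_Fp_prod:
  assumes "p > 0" "n \<ge> 1"
  shows "rd p n (cons t v) \<in> Fp_prod p n X Y \<longleftrightarrow> t mod int p \<in> X \<and> rd p (n - 1) v \<in> Y"
proof -
  have "(\<lambda>i\<in>{..<n - 1}. rd p n (cons t v) (Suc i)) = rd p (n - 1) v"
    using assms by (auto simp: rd_def fun_eq_iff restrict_def)
  moreover have "rd p n (cons t v) 0 = t mod int p" using assms by (simp add: rd_def)
  ultimately show ?thesis using rd_carrier[OF assms(1)] by (simp add: Fp_prod_def)
qed

lemma Fp_prod_subset: "Fp_prod p n X Y \<subseteq> carrier (Fp_space p n)"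
  by (auto simp: Fp_prod_def)

lemma Fp_quot_mult:
  assumes "prime p" "\<not> int p dvd v"
  shows "int p dvd Fp_quot p u v * v - u"
proof -
  have "coprime (int p) v" using assms by (intro prime_imp_coprime) simp_all
  then have "[v * modular_inverse (int p) v = 1] (mod int p)"
    by (intro cong_modular_inverse1) (simp add: coprime_commute)
  then have 1: "int p dvd v * modular_inverse (int p) v - 1" by (simp add: cong_iff_dvd_diff)
  show ?thesis unfolding Fp_quot_def
    by (rule dvd_lincomb[OF dvd_mod_diff[of "int p" "u * modular_inverse (int p) v"] 1, of _ v u 0])
      (simp add: algebra_simps)
qed

lemma Fp_quot_eq:
  assumes "prime p" "\<not> int p dvd v" "int p dvd x * v - u"
  shows "Fp_quot p u v = x mod int p"
proof -
  have "int p dvd (Fp_quot p u v - x) * v"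
    by (rule dvd_lincomb[OF Fp_quot_mult[OF assms(1,2), of u] assms(3), of _ 1 "-1" 0]) (simp add: algebra_simps)
  then have "int p dvd Fp_quot p u v - x" using assms(1,2) prime_dvd_mult_iff[of "int p"] by simp
  then have "Fp_quot p u v mod int p = x mod int p" by (simp only: mod_eq_dvd_iff)
  then show ?thesis by (simp add: Fp_quot_def)
qed

section \<open>Matching the extremal windows with the types\<close>

locale model = slices "int p" "rd p (n - 1)" "int m" "k = 4" S c H
  for p n m k l :: nat and S c H +
  fixes A :: "(nat \<Rightarrow> int) set"
  assumes p5: "p = 5 * m + 3" and n: "n \<ge> 1" and kl: "(k, l) = (4, 1) \<or> (k, l) = (3, 2)"
    and sub_A: "A \<subseteq> carrier (Fp_space p n)" and models: "models p n A S"
    and large: "card A \<ge> m * p ^ (n - 1)" and nontrivial: "\<not> trivial_set p m n k l A"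
begin

abbreviation "q \<equiv> int p"

lemma p0: "p > 0" using p5 by simp

lemma prime_p: "prime p" using prime by simp

lemma m21: "m \<ge> 21" using m_ge by simp

lemma W: "range (rd p (n - 1)) = carrier (Fp_space p (n - 1))" by (rule range_rd[OF p0])

lemma P_eq: "P = int (p ^ (n - 1))"
  unfolding W by (simp add: card_Fp_space[OF p0])

lemma unit_small: "0 < x \<Longrightarrow> x < q \<Longrightarrow> \<not> q dvd x"
  by (auto dest: zdvd_imp_le)

lemma unit_kl: "\<not> q dvd int k - int l" "\<not> q dvd int l - int k"
proof -
  show 1: "\<not> q dvd int k - int l" using kl p5 m21 by (intro unit_small) auto
  then show "\<not> q dvd int l - int k" using dvd_minus_iff[of q "int k - int l"] by simp
qed

lemma offset_kl: "offset = int l * H - (int k - int l) * c"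
  using kl by (intro offset_alt) auto

lemma card_A_le:
  assumes "H = int m - 1 \<or> H = int m \<and> q dvd offset - 5 * int m \<or> H = int m + 1 \<and> q dvd offset - 1"
  shows "card A = m * p ^ (n - 1)"
proof -
  obtain \<Phi> where \<Phi>: "lift_aut p n \<Phi>" "\<And>t v. v \<in> S t \<longleftrightarrow> rd p n (\<Phi> (cons t v)) \<in> A"
    using models by (auto simp: models_def)
  have "N {t. rd p n (\<Phi> (cons t v)) \<in> A} = (\<Sum>i\<in>{0..H}. of_bool (v \<in> S (c + i)))" for v
  proof -
    have eq: "{t. rd p n (\<Phi> (cons t v)) \<in> A} = {t. v \<in> S t}" using \<Phi>(2) by simp
    have "N {t. v \<in> S t} = (\<Sum>i\<in>{0..H}. of_bool (c + i \<in> {t. v \<in> S t}))"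
    proof (rule N_support)
      show "per {t. v \<in> S t}"
      proof (rule periodicI)
        fix x k assume "x \<in> {t. v \<in> S t}"
        then show "x + k * q \<in> {t. v \<in> S t}" using S_cong[of "x + k * q" x] by simp
      qed
      show "\<exists>k. x + k * q \<in> {c..c + H}" if "x \<in> {t. v \<in> S t}" for x using support[of x] that by auto
      show "H < q" using H_bounds m21 p5 by simp
    qed
    then show ?thesis unfolding eq by simp
  qed
  then have "(\<Sum>v\<in>carrier (Fp_space p (n - 1)). N {t. rd p n (\<Phi> (cons t v)) \<in> A})
      = (\<Sum>v\<in>carrier (Fp_space p (n - 1)). \<Sum>i\<in>{0..H}. of_bool (v \<in> S (c + i)))" by simp
  also have "\<dots> = (\<Sum>i\<in>{0..H}. sz (c + i))" unfolding sz_def W by (rule sum.swap)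
  also have "\<dots> \<le> int m * P" by (rule total_le) (use assms in simp)
  finally have "(\<Sum>v\<in>carrier (Fp_space p (n - 1)). N {t. rd p n (\<Phi> (cons t v)) \<in> A}) \<le> int m * P" .
  moreover have "(\<Sum>v\<in>carrier (Fp_space p (n - 1)). N {t. rd p n (\<Phi> (cons t v)) \<in> A}) = int (card A)"
    using card_columns[OF p0 n \<Phi>(1) sub_A] unfolding rcard_def of_nat_sum[symmetric] by simp
  ultimately have "int (card A) \<le> int m * int (p ^ (n - 1))" unfolding P_eq by simp
  then have "card A \<le> m * p ^ (n - 1)" by (simp only: of_nat_mult[symmetric] of_nat_le_iff)
  then show ?thesis using large by simp
qed

lemma H_lt: "H < q" "0 \<le> H"
  using H_bounds m21 p5 by simp_all

text \<open>To recognise \<open>A\<close> it suffices to compare slices at the positions of one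
  period. The start \<open>c\<close> may be replaced by a congruent \<open>c0\<close>, and the shear
  \<open>w\<close> translates the slice at position \<open>c0 + i\<close> by a multiple of
  \<open>w\<close>.\<close>

lemma iso_window:
  assumes c0: "q dvd c - c0" and T: "T \<subseteq> carrier (Fp_space p n)"
    and mem: "\<And>t v i. q dvd t - (c0 + i) \<Longrightarrow> 0 \<le> i \<Longrightarrow> i < q \<Longrightarrow>
      rd p n (cons t v) \<in> T \<longleftrightarrow> i \<le> H \<and> v + (\<lambda>j. (c0 + i) * w j) \<in> S (c + i)"
  shows "isomorphic_in (Fp_space p n) A T"
proof (rule models_iso[OF p0 models_shear[OF n models, of w] sub_A T])
  fix t v
  define i where "i = (t - c0) mod q"
  have i: "0 \<le> i" "i < q" using p0 by (simp_all add: i_def)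
  have ti: "q dvd t - (c0 + i)"
    using dvd_minus_iff[of q "i - (t - c0)"] dvd_mod_diff[of q "t - c0"] by (simp add: i_def algebra_simps)
  have "q dvd t * w j - (c0 + i) * w j" for j
    using ti by (rule dvd_lincomb[OF _ dvd_0_right, of _ _ _ "w j" 0 0]) (simp add: algebra_simps)
  then have "rd p (n - 1) (v + (\<lambda>j. t * w j)) = rd p (n - 1) (v + (\<lambda>j. (c0 + i) * w j))"
    by (simp add: rd_eq_iff)
  then have shift: "v + (\<lambda>j. t * w j) \<in> S x \<longleftrightarrow> v + (\<lambda>j. (c0 + i) * w j) \<in> S x" for x
    using S_red[of "v + (\<lambda>j. t * w j)"] S_red[of "v + (\<lambda>j. (c0 + i) * w j)"] by simp
  have "v + (\<lambda>j. t * w j) \<in> S t \<longleftrightarrow> i \<le> H \<and> v + (\<lambda>j. (c0 + i) * w j) \<in> S (c + i)"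
  proof
    assume "v + (\<lambda>j. t * w j) \<in> S t"
    then obtain h where h: "h \<in> {0..H}" "q dvd t - (c0 + h)" "v + (\<lambda>j. t * w j) \<in> S (c0 + h)"
      unfolding in_slice_iff[OF c0, of _ t] by blast
    then have "h = i" using ti i H_lt by (intro same_index[of t c0]) auto
    then show "i \<le> H \<and> v + (\<lambda>j. (c0 + i) * w j) \<in> S (c + i)" using h shift S_shift_base[OF c0] by simp
  next
    assume "i \<le> H \<and> v + (\<lambda>j. (c0 + i) * w j) \<in> S (c + i)"
    then show "v + (\<lambda>j. t * w j) \<in> S t"
      unfolding in_slice_iff[OF c0, of _ t] S_shift_base[OF c0] using shift ti i by (intro bexI[of _ i]) auto
  qed
  then show "rd p n (cons t v) \<in> T \<longleftrightarrow> v \<in> {v. v + (\<lambda>j. t * w j) \<in> S t}" using mem[OF ti i] by simp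
qed

text \<open>The congruence would identify \<open>c'\<close> with the start of the extremal cuboid,
  which spans m + 1 places from there; the window of \<open>A\<close> would fit in and
  \<open>A\<close> would be trivial.\<close>

lemma not_in_extremal:
  assumes "c' \<le> c" "c + H \<le> c' + int m"
  shows "\<not> q dvd (int k - int l) * c' + (int k * int m + 1)"
proof
  assume dv: "q dvd (int k - int l) * c' + (int k * int m + 1)"
  define a0 where "a0 = Fp_quot p (- (int k * int m + 1)) (int k - int l)"
  have a0: "a0 = c' mod q" unfolding a0_def
    using dv by (intro Fp_quot_eq[OF prime_p unit_kl(1)]) (simp add: algebra_simps)
  define T where "T = {x \<in> carrier (Fp_space p n). (\<lambda>i. x (Suc i)) \<in> S (x 0)}"
  have T: "rd p n (cons t v) \<in> T \<longleftrightarrow> v \<in> S t" for t v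
  proof -
    have "rd p (n - 1) (\<lambda>i. rd p n (cons t v) (Suc i)) = rd p (n - 1) v"
      using n by (auto simp: rd_def fun_eq_iff restrict_def)
    then have "(\<lambda>i. rd p n (cons t v) (Suc i)) \<in> S x \<longleftrightarrow> v \<in> S x" for x
      using S_red[of "\<lambda>i. rd p n (cons t v) (Suc i)" x] S_red[of v x] by simp
    moreover have "rd p n (cons t v) 0 = t mod q" using n by (simp add: rd_def)
    moreover have "S (t mod q) = S t" by (rule S_cong[OF dvd_mod_diff])
    ultimately show ?thesis using rd_carrier[OF p0] by (simp add: T_def)
  qed
  have "isomorphic_in (Fp_space p n) A T"
    by (rule models_iso[OF p0 models sub_A _ T]) (auto simp: T_def)
  moreover have "T \<subseteq> extremal_cuboid p m n k l"
  proof
    fix x assume x: "x \<in> T"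
    then have xC: "x \<in> carrier (Fp_space p n)" by (simp add: T_def)
    have eq: "x = rd p n (cons (x 0) (\<lambda>i. x (Suc i)))" unfolding cons_collapse using rd_id[OF p0 xC] by simp
    have "(\<lambda>i. x (Suc i)) \<in> S (x 0)" using x by (simp add: T_def)
    moreover have "q dvd c - c" by simp
    ultimately obtain i where i: "i \<in> {0..H}" "q dvd x 0 - (c + i)" using in_slice_iff[of c] by blast
    have "q dvd x 0 - (a0 + (c + i - c'))"
      by (rule dvd_lincomb[OF i(2) dvd_mod_diff[of q c'], of _ 1 "-1" 0]) (simp add: a0)
    then have "x 0 mod q \<in> cyc_interval p (a0 + 0) (a0 + int m) \<longleftrightarrow> 0 \<le> c + i - c' \<and> c + i - c' \<le> int m"
      using i assms m21 p5 by (intro cyc_interval_iff) auto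
    then have "x 0 mod q \<in> cyc_interval p a0 (a0 + int m)" using i assms by simp
    then show "x \<in> extremal_cuboid p m n k l"
      unfolding extremal_cuboid_def Let_def a0_def[symmetric]
      by (subst eq, subst rd_cons_in_Fp_prod[OF p0 n]) (simp add: rd_carrier[OF p0])
  qed
  ultimately show False using nontrivial unfolding trivial_set_def by blast
qed

text \<open>All slices are full. Since k + l = 5, \<open>offset\<close> minus 5 (m - 1) is congruent
  to \<open>l a - k (a + m - 1)\<close>, so \<open>d\<close> is the number whose range defines type
  1.\<close>

lemma type1I:
  assumes H: "H = int m - 1" and d: "q dvd offset - (5 * int m - 5 + d)"
    and d_range: "d \<in> {1..int l} \<or> 1 + l + 2 \<le> k \<and> d \<in> {1 + int l + 2..int k}"
  shows "type1 p m n k l A"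
proof -
  define a where "a = c mod q"
  have ca: "q dvd c - a" using dvd_minus_iff[of q "c mod q - c"] dvd_mod_diff[of q c] by (simp add: a_def)
  have a: "a \<in> {0..<q}" using p0 by (simp add: a_def)
  have full: "S (c + i) = UNIV" if "i \<in> {0..int m - 1}" for i using shortest[OF H that] .
  define T where "T = Fp_prod p n (cyc_interval p a (a + int m - 1)) (carrier (Fp_space p (n - 1)))"
  have iso: "isomorphic_in (Fp_space p n) A T"
  proof (rule iso_window[OF ca, where w = "\<lambda>_. 0"])
    show "T \<subseteq> carrier (Fp_space p n)" unfolding T_def by (rule Fp_prod_subset)
    show "rd p n (cons t v) \<in> T \<longleftrightarrow> i \<le> H \<and> v + (\<lambda>j. (a + i) * 0) \<in> S (c + i)"
      if t: "q dvd t - (a + i)" "0 \<le> i" "i < q" for t v i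
    proof -
      have "t mod q \<in> cyc_interval p (a + 0) (a + (int m - 1)) \<longleftrightarrow> 0 \<le> i \<and> i \<le> int m - 1"
        using t m21 p5 by (intro cyc_interval_iff) auto
      then show ?thesis unfolding T_def rd_cons_in_Fp_prod[OF p0 n]
        using t H full[of i] by (auto simp: rd_carrier[OF p0] add_diff_eq)
    qed
  qed
  define e where "e = (int l * a - int k * (a + int m - 1)) mod q"
  have "q dvd int l * (int m - 1) - (int k - int l) * c - (5 * int m - 5 + d)"
    using d unfolding offset_kl unfolding H .
  then have "q dvd (int l * a - int k * (a + int m - 1)) - d"
    by (rule dvd_lincomb[OF _ ca, of _ _ 1 "int k - int l" 0]) (use kl in \<open>auto simp: algebra_simps\<close>)
  then have "e = d mod q" unfolding e_def by (simp only: mod_eq_dvd_iff)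
  then have e: "e = d" using d_range kl p5 m21 by auto
  have "e \<in> cyc_interval p 1 (int l) \<or> 1 + l + 2 \<le> k \<and> e \<in> cyc_interval p (1 + int l + 2) (int k)"
  proof -
    have *: "d \<in> cyc_interval p x y" if "d \<in> {x..y}" "0 \<le> x" "y < q" for x y
    proof -
      have "(y - x) mod q = y - x" using that by simp
      then show ?thesis unfolding cyc_interval_def using that by (intro image_eqI[of _ _ "d - x"]) auto
    qed
    show ?thesis using d_range *[of 1 "int l"] *[of "1 + int l + 2" "int k"] kl p5 m21 unfolding e by auto
  qed
  then show ?thesis unfolding type1_def Let_def
    using sub_A card_A_le H iso[unfolded T_def] a unfolding e_def by blast
qed


text \<open>Scalar multiples are iterated sums, so a subgroup is a subspace. A proper one needs a
  nontrivial base, whence \<open>n >= 2\<close>.\<close>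

lemma subspace_carrier:
  assumes V: "sub V" "V \<noteq> UNIV"
  shows "n \<ge> 2" "proper_subspace p (n - 1) (V \<inter> carrier (Fp_space p (n - 1)))"
    and "\<And>v. rd p (n - 1) v \<in> V \<inter> carrier (Fp_space p (n - 1)) \<longleftrightarrow> v \<in> V"
proof -
  let ?G = "Fp_space p (n - 1)"
  have red_V: "rd p (n - 1) x \<in> V \<longleftrightarrow> x \<in> V" for x using V(1) unfolding sub_def by blast
  show mem: "rd p (n - 1) v \<in> V \<inter> carrier ?G \<longleftrightarrow> v \<in> V" for v
    using red_V rd_carrier[OF p0] by simp
  have zero: "0 \<in> V" using V(1) unfolding sub_def by blast
  obtain y where y: "y \<notin> V" using V(2) by blast
  show "n \<ge> 2"
  proof (rule ccontr)
    assume "\<not> n \<ge> 2"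
    then have "rd p (n - 1) y = rd p (n - 1) 0" by (simp add: rd_eq_iff)
    then show False using red_V[of y] red_V[of 0] y zero by simp
  qed
  have "subgroup (V \<inter> carrier ?G) ?G"
  proof (rule group.subgroupI[OF group_Fp_space])
    have "rd p (n - 1) 0 \<in> V \<inter> carrier ?G" using mem[of 0] zero by simp
    then show "V \<inter> carrier ?G \<noteq> {}" by blast
    fix x assume x: "x \<in> V \<inter> carrier ?G"
    have "rd p (n - 1) (- x) \<otimes>\<^bsub>?G\<^esub> x = \<one>\<^bsub>?G\<^esub>"
      by (simp add: mult_Fp_space one_Fp_space rd_add)
    then have "inv\<^bsub>?G\<^esub> x = rd p (n - 1) (- x)"
      using x by (intro group.inv_equality[OF group_Fp_space]) (simp_all add: rd_carrier[OF p0])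
    then show "inv\<^bsub>?G\<^esub> x \<in> V \<inter> carrier ?G" using mem sub_uminus[OF V(1)] x by simp
    fix y assume y: "y \<in> V \<inter> carrier ?G"
    show "x \<otimes>\<^bsub>?G\<^esub> y \<in> V \<inter> carrier ?G"
      unfolding mult_Fp_space using mem sub_add[OF V(1)] x y by simp
  qed simp
  moreover have "(\<lambda>i\<in>{..<n - 1}. e * v i mod q) \<in> V \<inter> carrier ?G" if "e \<in> {0..<q}" "v \<in> V \<inter> carrier ?G" for e v
  proof -
    have "(\<lambda>i. e * v i) \<in> V"
      using sub_funpow[OF V(1), of v "nat e"] that by (simp add: funpow_plus_fun)
    then show ?thesis using mem[of "\<lambda>i. e * v i"] by (simp add: rd_def)
  qed
  ultimately have "Fp_subspace p (n - 1) (V \<inter> carrier ?G)" by (simp add: Fp_subspace_def)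
  moreover have "V \<inter> carrier ?G \<noteq> carrier ?G" using mem[of y] y rd_carrier[OF p0] by auto
  ultimately show "proper_subspace p (n - 1) (V \<inter> carrier ?G)" by (simp add: proper_subspace_def)
qed

lemma mem_shift:
  assumes V: "sub V" and e: "q dvd e" and y: "\<And>j. y j = v j + e * u j"
  shows "y \<in> V \<longleftrightarrow> v \<in> V"
proof -
  have "q dvd y j - v j" for j using e y by simp
  then have "rd p (n - 1) y = rd p (n - 1) v" by (simp add: rd_eq_iff)
  moreover have "rd p (n - 1) x \<in> V \<longleftrightarrow> x \<in> V" for x using V unfolding sub_def by blast
  ultimately show ?thesis by metis
qed

text \<open>One shear has to move the coset of \<open>u\<close> at position a + m and that of 4u at
  position \<open>a\<close> to \<open>V\<close>. This is possible because 4m + 3a vanishes modulo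
  \<open>p\<close>, so \<open>a\<close> is four times a + m; \<open>f\<close> inverts a + m.\<close>

lemma type2I:
  assumes H: "H = int m" and off: "q dvd offset - 5 * int m"
  shows "type2 p m n k l A"
proof -
  obtain u V where k4: "k = 4" and V: "sub V" "V \<noteq> UNIV"
    and top: "S (c + int m) = {v. v - u \<in> V}" and bot: "S c = {v. v - (u + u + u + u) \<notin> V}"
    and full: "\<And>i. i \<in> {1..int m - 1} \<Longrightarrow> S (c + i) = UNIV"
    using middle_structure[OF H off] by metis
  have l: "l = 1" using kl k4 by simp
  have off': "q dvd int m - 3 * c - 5 * int m" using off unfolding offset_kl unfolding H by (simp add: k4 l)
  define a where "a = Fp_quot p (int m * int k) (int l - int k)"
  have a: "a = c mod q" unfolding a_def
    by (rule Fp_quot_eq[OF prime_p unit_kl(2)])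
      (rule dvd_lincomb[OF off' dvd_0_right, of _ 1 0 0], simp add: k4 l)
  have ca: "q dvd c - a" using dvd_minus_iff[of q "c mod q - c"] dvd_mod_diff[of q c] by (simp add: a)
  have "\<not> q dvd a + int m"
  proof
    assume "q dvd a + int m"
    then have "q dvd a - c + (c + int m)" by simp
    then have "q dvd c + int m" using ca dvd_add[of q "c - a" "a + int m"] \<open>q dvd a + int m\<close> by simp
    then have "q dvd int m" by (rule dvd_lincomb[OF off', of _ _ "-1" "-3" 0]) simp
    then show False using unit_small[of "int m"] m21 p5 by simp
  qed
  then obtain f where f: "q dvd (a + int m) * f - 1" using unit_inverse by blast
  have f4: "q dvd a * f - 4"
  proof -
    have "q dvd 4 * int m + 3 * a"
      by (rule dvd_lincomb[OF off' ca, of _ "-1" "-3" 0]) simp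
    then show ?thesis
      by (rule dvd_lincomb[OF _ f, of _ _ "- f" 4 0]) (simp add: algebra_simps)
  qed
  let ?W = "carrier (Fp_space p (n - 1))"
  let ?V = "V \<inter> ?W"
  note V0 = subspace_carrier[OF V]
  define T where "T = Fp_prod p n {a} (?W - ?V) \<union> Fp_prod p n (cyc_interval p (a + 1) (a + int m - 1)) ?W
    \<union> Fp_prod p n {(a + int m) mod q} ?V"
  have "isomorphic_in (Fp_space p n) A T"
  proof (rule iso_window[OF ca, where w = "\<lambda>j. f * u j"])
    show "T \<subseteq> carrier (Fp_space p n)" unfolding T_def using Fp_prod_subset by blast
    fix t v i assume t: "q dvd t - (a + i)" "0 \<le> i" "i < q"
    have "t mod q = (a + 0) mod q \<longleftrightarrow> i = 0" "t mod q = (a + int m) mod q \<longleftrightarrow> i = int m"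
      using m21 p5 by (intro residue_iff[OF t]; simp)+
    moreover have "t mod q \<in> cyc_interval p (a + 1) (a + (int m - 1)) \<longleftrightarrow> 1 \<le> i \<and> i \<le> int m - 1"
      using t m21 p5 by (intro cyc_interval_iff) auto
    ultimately have T: "rd p n (cons t v) \<in> T \<longleftrightarrow>
        i = 0 \<and> v \<notin> V \<or> 1 \<le> i \<and> i \<le> int m - 1 \<or> i = int m \<and> v \<in> V"
      unfolding T_def Un_iff rd_cons_in_Fp_prod[OF p0 n] using V0(3)[of v] rd_carrier[OF p0]
      by (simp add: a add_diff_eq)
    have topV: "v + (\<lambda>j. (a + int m) * (f * u j)) - u \<in> V \<longleftrightarrow> v \<in> V"
      by (rule mem_shift[OF V(1) f, of _ _ u]) (simp add: algebra_simps)
    have botV: "v + (\<lambda>j. a * (f * u j)) - (u + u + u + u) \<in> V \<longleftrightarrow> v \<in> V"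
      by (rule mem_shift[OF V(1) f4, of _ _ u]) (simp add: algebra_simps)
    consider "i = 0" | "i \<in> {1..int m - 1}" | "i = int m" | "i > int m" using t by fastforce
    then show "rd p n (cons t v) \<in> T \<longleftrightarrow> i \<le> H \<and> v + (\<lambda>j. (a + i) * (f * u j)) \<in> S (c + i)"
    proof cases
      case 1
      show ?thesis unfolding T H unfolding 1 add_0_right bot mem_Collect_eq botV using m21 by simp
    next
      case 2
      then show ?thesis unfolding T H using full by simp
    next
      case 3
      show ?thesis unfolding T H 3 top mem_Collect_eq topV using m21 by simp
    next
      case 4
      then show ?thesis unfolding T H by simp
    qed
  qed
  then show ?thesis unfolding type2_def Let_def T_def a_def[symmetric]
    using sub_A card_A_le H off V0 l by blast
qed

text \<open>For both pairs the offset 1 forces \<open>c\<close> to be congruent to 2m + 1. Modulo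
  \<open>p\<close> the positions 1, m and m + 1 of the window are -4, 4 and -1 times
  \<open>c0\<close>, just as the representatives are -4u, 4u and -u; so a single shear removes all
  of them. Then \<open>V = UNIV\<close> gives type 3 and a proper \<open>V\<close> type 4.\<close>

lemma longest_case:
  assumes H: "H = int m + 1" and off: "q dvd offset - 1"
  shows "type3 p m n k l A \<or> type4 p m n A"
proof -
  obtain u V where V: "sub V"
    and ends: "S c = {v. v - u \<in> V}" "S (c + int m + 1) = {v. v + u \<in> V}"
      "S (c + int m) = {v. v - (u + u + u + u) \<notin> V}" "S (c + 1) = {v. v + (u + u + u + u) \<notin> V}"
    and full: "\<And>i. i \<in> {2..int m - 1} \<Longrightarrow> S (c + i) = UNIV"
    using longest_structure[OF H off] by metis
  define c0 where "c0 = 2 * int m + 1"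
  have c0: "q dvd c - c0"
  proof -
    have "q dvd int l * (int m + 1) - (int k - int l) * c - 1" using off unfolding offset_kl unfolding H .
    then have "q dvd (int k - int l) * (c - c0)"
      by (rule dvd_lincomb[OF _ dvd_0_right, of _ _ _ "-1" 0 "if k = 4 then - 1 else 0"])
        (use kl in \<open>auto simp: c0_def p5\<close>)
    then show ?thesis using unit_kl(1) prime by (simp add: prime_dvd_mult_iff)
  qed
  have "\<not> q dvd c0" using m21 p5 by (intro unit_small) (simp_all add: c0_def)
  then obtain f where f: "q dvd c0 * f - 1" using unit_inverse by blast
  have "q dvd (c0 + 1) * f + 4"
    by (rule dvd_lincomb[OF f dvd_0_right, of _ "-4" 0 "2 * f"]) (simp add: c0_def p5 algebra_simps)
  moreover have "q dvd (c0 + int m) * f - 4"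
    by (rule dvd_lincomb[OF f dvd_0_right, of _ 4 0 "- f"]) (simp add: c0_def p5 algebra_simps)
  moreover have "q dvd (c0 + int m + 1) * f + 1"
    by (rule dvd_lincomb[OF f dvd_0_right, of _ "-1" 0 f]) (simp add: c0_def p5 algebra_simps)
  ultimately have f': "q dvd (c0 + 1) * f + 4" "q dvd (c0 + int m) * f - 4" "q dvd (c0 + int m + 1) * f + 1"
    by this+
  have iso: "isomorphic_in (Fp_space p n) A T"
    if sub_T: "T \<subseteq> carrier (Fp_space p n)"
      and T: "\<And>t v i. q dvd t - (c0 + i) \<Longrightarrow> 0 \<le> i \<Longrightarrow> i < q \<Longrightarrow> rd p n (cons t v) \<in> T \<longleftrightarrow>
        (i = 0 \<or> i = int m + 1) \<and> v \<in> V \<or> (i = 1 \<or> i = int m) \<and> v \<notin> V \<or> 2 \<le> i \<and> i \<le> int m - 1" for T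
  proof (rule iso_window[OF c0 sub_T, where w = "\<lambda>j. f * u j"])
    fix t v i assume t: "q dvd t - (c0 + i)" "0 \<le> i" "i < q"
    have 0: "v + (\<lambda>j. c0 * (f * u j)) - u \<in> V \<longleftrightarrow> v \<in> V"
      by (rule mem_shift[OF V f, of _ _ u]) (simp add: algebra_simps)
    have 1: "v + (\<lambda>j. (c0 + 1) * (f * u j)) + (u + u + u + u) \<in> V \<longleftrightarrow> v \<in> V"
      by (rule mem_shift[OF V f'(1), of _ _ u]) (simp add: algebra_simps)
    have 2: "v + (\<lambda>j. (c0 + int m) * (f * u j)) - (u + u + u + u) \<in> V \<longleftrightarrow> v \<in> V"
      by (rule mem_shift[OF V f'(2), of _ _ u]) (simp add: algebra_simps)
    have 3: "v + (\<lambda>j. (c0 + (int m + 1)) * (f * u j)) + u \<in> V \<longleftrightarrow> v \<in> V"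
      by (rule mem_shift[OF V f'(3), of _ _ u]) (simp add: algebra_simps)
    have last: "S (c + (int m + 1)) = {v. v + u \<in> V}" using ends(2) by (simp only: add.assoc)
    consider "i = 0" | "i = 1" | "i \<in> {2..int m - 1}" | "i = int m" | "i = int m + 1" | "i > int m + 1"
      using t by fastforce
    then show "rd p n (cons t v) \<in> T \<longleftrightarrow> i \<le> H \<and> v + (\<lambda>j. (c0 + i) * (f * u j)) \<in> S (c + i)"
    proof cases
      case i: 1
      show ?thesis unfolding T[OF t] H unfolding i add_0_right ends(1) mem_Collect_eq 0 using m21 by simp
    next
      case i: 2
      show ?thesis unfolding T[OF t] H unfolding i ends(4) mem_Collect_eq 1 using m21 by simp
    next
      case 3
      then show ?thesis unfolding T[OF t] H using full m21 by simp
    next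
      case i: 4
      show ?thesis unfolding T[OF t] H unfolding i ends(3) mem_Collect_eq 2 using m21 by simp
    next
      case i: 5
      show ?thesis unfolding T[OF t] H unfolding i last mem_Collect_eq 3 using m21 by simp
    next
      case 6
      then show ?thesis unfolding T[OF t] H by simp
    qed
  qed
  have res: "t mod q = (c0 + 0) mod q \<longleftrightarrow> i = 0" "t mod q = (c0 + 1) mod q \<longleftrightarrow> i = 1"
    "t mod q = (c0 + int m) mod q \<longleftrightarrow> i = int m" "t mod q = (c0 + (int m + 1)) mod q \<longleftrightarrow> i = int m + 1"
    "t mod q \<in> cyc_interval p (c0 + 2) (c0 + (int m - 1)) \<longleftrightarrow> 2 \<le> i \<and> i \<le> int m - 1"
    "t mod q \<in> cyc_interval p (c0 + 0) (c0 + (int m + 1)) \<longleftrightarrow> 0 \<le> i \<and> i \<le> int m + 1"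
    if t: "q dvd t - (c0 + i)" "0 \<le> i" "i < q" for t i
    using m21 p5 by (intro residue_iff[OF t] cyc_interval_iff[OF refl t]; simp)+
  show ?thesis
  proof (cases "V = UNIV")
    case True
    define a where "a = Fp_quot p (int l * int m + int k - 1) (int k - int l)"
    have "(c0 + 1) * (int k - int l) - (int l * int m + int k - 1) = q * (if k = 4 then 1 else 0)"
      using kl by (auto simp: c0_def p5)
    then have "q dvd (c0 + 1) * (int k - int l) - (int l * int m + int k - 1)" by (rule dvdI)
    then have "a = (c0 + 1) mod q" unfolding a_def by (rule Fp_quot_eq[OF prime_p unit_kl(1)])
    then have a: "a = c0 + 1" using m21 p5 by (simp add: c0_def)
    define T where "T = Fp_prod p n (cyc_interval p (a - 1) (a + int m) - {a, (a + int m - 1) mod q})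
      (carrier (Fp_space p (n - 1)))"
    have "isomorphic_in (Fp_space p n) A T"
    proof (rule iso)
      show "T \<subseteq> carrier (Fp_space p n)" unfolding T_def by (rule Fp_prod_subset)
      fix t v i assume t: "q dvd t - (c0 + i)" "0 \<le> i" "i < q"
      have a_mod: "(c0 + 1) mod q = a" using m21 p5 by (simp add: a c0_def)
      have shift: "a - 1 = c0 + 0" "a + int m = c0 + (int m + 1)" "a + int m - 1 = c0 + int m" by (simp_all add: a)
      have "t mod q \<in> cyc_interval p (a - 1) (a + int m) - {a, (a + int m - 1) mod q} \<longleftrightarrow>
          (0 \<le> i \<and> i \<le> int m + 1) \<and> \<not> (i = 1 \<or> i = int m)"
        unfolding Diff_iff insert_iff shift(1,2) shift(3) using res[OF t] a_mod by simp
      then show "rd p n (cons t v) \<in> T \<longleftrightarrow>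
        (i = 0 \<or> i = int m + 1) \<and> v \<in> V \<or> (i = 1 \<or> i = int m) \<and> v \<notin> V \<or> 2 \<le> i \<and> i \<le> int m - 1"
        unfolding T_def rd_cons_in_Fp_prod[OF p0 n] using t(2) m21 by (auto simp: True rd_carrier[OF p0])
    qed
    then have "type3 p m n k l A" unfolding type3_def Let_def T_def a_def[symmetric]
      using sub_A card_A_le H off by blast
    then show ?thesis ..
  next
    case False
    let ?W = "carrier (Fp_space p (n - 1))"
    let ?V = "V \<inter> ?W"
    note V0 = subspace_carrier[OF V False]
    define T where "T = Fp_prod p n {2 * int m + 1, 3 * int m + 2} ?V
      \<union> Fp_prod p n {2 * int m + 2, 3 * int m + 1} (?W - ?V)
      \<union> Fp_prod p n (cyc_interval p (2 * int m + 3) (3 * int m)) ?W"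
    have "isomorphic_in (Fp_space p n) A T"
    proof (rule iso)
      show "T \<subseteq> carrier (Fp_space p n)" unfolding T_def using Fp_prod_subset by blast
      fix t v i assume t: "q dvd t - (c0 + i)" "0 \<le> i" "i < q"
      have eqs: "2 * int m + 1 = (c0 + 0) mod q" "2 * int m + 2 = (c0 + 1) mod q"
        "3 * int m + 1 = (c0 + int m) mod q" "3 * int m + 2 = (c0 + (int m + 1)) mod q"
        "2 * int m + 3 = c0 + 2" "3 * int m = c0 + (int m - 1)"
        using m21 p5 by (simp_all add: c0_def)
      have sets: "t mod q \<in> {2 * int m + 1, 3 * int m + 2} \<longleftrightarrow> i = 0 \<or> i = int m + 1"
        "t mod q \<in> {2 * int m + 2, 3 * int m + 1} \<longleftrightarrow> i = 1 \<or> i = int m"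
        "t mod q \<in> cyc_interval p (2 * int m + 3) (3 * int m) \<longleftrightarrow> 2 \<le> i \<and> i \<le> int m - 1"
        unfolding insert_iff empty_iff eqs(1,2,3,4) unfolding eqs(5,6) res[OF t] by simp_all
      show "rd p n (cons t v) \<in> T \<longleftrightarrow>
        (i = 0 \<or> i = int m + 1) \<and> v \<in> V \<or> (i = 1 \<or> i = int m) \<and> v \<notin> V \<or> 2 \<le> i \<and> i \<le> int m - 1"
        unfolding T_def Un_iff rd_cons_in_Fp_prod[OF p0 n] sets using V0(3)[of v] rd_carrier[OF p0] by simp
    qed
    then have "type4 p m n A" unfolding type4_def Let_def T_def
      using sub_A card_A_le H off V0 by blast
    then show ?thesis ..
  qed
qed

text \<open>These are the offsets of windows inside the extremal interval of m + 1 places: for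
  \<open>H = m - 1\<close> the window starts at its first or second place, for \<open>H = m\<close>
  at its first.\<close>

lemma not_trivial_offset:
  shows "H = int m - 1 \<Longrightarrow> \<not> q dvd offset - (5 * int m + 1 - int l)"
    and "H = int m - 1 \<Longrightarrow> \<not> q dvd offset - (5 * int m + 1 - int k)"
    and "H = int m \<Longrightarrow> \<not> q dvd offset - (5 * int m + 1)"
proof -
  show "\<not> q dvd offset - (5 * int m + 1 - int l)" if H: "H = int m - 1"
  proof
    assume "q dvd offset - (5 * int m + 1 - int l)"
    then have "q dvd int l * (int m - 1) - (int k - int l) * c - (5 * int m + 1 - int l)" unfolding offset_kl unfolding H .
    then have "q dvd (int k - int l) * c + (int k * int m + 1)"
      by (rule dvd_lincomb[OF _ dvd_0_right, of _ _ _ "-1" 0 0]) (use kl in \<open>auto simp: algebra_simps\<close>)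
    then show False using not_in_extremal[of c] H by simp
  qed
  show "\<not> q dvd offset - (5 * int m + 1 - int k)" if H: "H = int m - 1"
  proof
    assume "q dvd offset - (5 * int m + 1 - int k)"
    then have "q dvd int l * (int m - 1) - (int k - int l) * c - (5 * int m + 1 - int k)" unfolding offset_kl unfolding H .
    then have "q dvd (int k - int l) * (c - 1) + (int k * int m + 1)"
      by (rule dvd_lincomb[OF _ dvd_0_right, of _ _ _ "-1" 0 0]) (use kl in \<open>auto simp: algebra_simps\<close>)
    then show False using not_in_extremal[of "c - 1"] H by simp
  qed
  show "\<not> q dvd offset - (5 * int m + 1)" if H: "H = int m"
  proof
    assume "q dvd offset - (5 * int m + 1)"
    then have "q dvd int l * int m - (int k - int l) * c - (5 * int m + 1)" unfolding offset_kl unfolding H .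
    then have "q dvd (int k - int l) * c + (int k * int m + 1)"
      by (rule dvd_lincomb[OF _ dvd_0_right, of _ _ _ "-1" 0 0]) (use kl in \<open>auto simp: algebra_simps\<close>)
    then show False using not_in_extremal[of c] H by simp
  qed
qed

text \<open>Nontriviality excludes 6 - l and 6 - k. What remains of the set is the range of type 1:
  1 and 4 for (4, 1), 1 and 2 for (3, 2). The entry \<open>2 * k - 3\<close>, which is 5 or 3, makes
  the set and its image under \<open>d\<close> to \<open>8 - d\<close> cover
  \<open>{1..7}\<close>.\<close>

lemma short_classified:
  assumes H: "H = int m - 1" and d: "q dvd offset - (5 * int m - 5 + d)"
    and d_cases: "d \<in> {1, 2, 4, 2 * int k - 3}"
  shows "normal_set p m n k l A"
proof -
  note not_trivial = not_trivial_offset(1,2)[OF H]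
  have "5 * int m - 5 + (6 - x) = 5 * int m + 1 - x" for x by simp
  then have "d \<noteq> 6 - int l" "d \<noteq> 6 - int k" using not_trivial d by metis+
  then have "d \<in> {1..int l} \<or> 1 + l + 2 \<le> k \<and> d \<in> {1 + int l + 2..int k}" using d_cases kl by auto
  then show ?thesis using type1I[OF H d] by (simp add: normal_set_def)
qed

lemma reflected_model: "model p n m k l (\<lambda>x. {v. - v \<in> S (- x)}) (- (c + H)) H A"
  unfolding model_def model_axioms_def
  using reflected p5 n kl sub_A models_reflect[OF models] large nontrivial by blast

theorem classification: "normal_set p m n k l A \<or> type3 p m n k l A \<or> type4 p m n A"
proof -
  interpret r: model p n m k l "\<lambda>x. {v. - v \<in> S (- x)}" "- (c + H)" H A by (rule reflected_model)
  have flip: "q dvd r.offset - y" if "q dvd offset - x" "y = 5 * H - x + q * j" for x y j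
    unfolding offset_reflected by (rule dvd_lincomb[OF that(1) dvd_0_right, of _ "-1" 0 "- j"]) (simp add: that(2))
  show ?thesis
  proof (cases rule: offset_cases)
    case 1
    then obtain d where d: "d \<in> {1..7}" "q dvd offset - (5 * int m - 5 + d)" by blast
    \<comment> \<open>As 5H = 5m - 5, reflection turns 5m - 5 + d into -d, which is 5m - 5 + (8 - d)
      modulo \<open>p\<close>.\<close>
    have d': "q dvd r.offset - (5 * int m - 5 + (8 - d))"
      by (rule flip[OF d(2), of _ 1]) (simp add: 1 p5)
    have "d = 1 \<or> d = 2 \<or> d = 3 \<or> d = 4 \<or> d = 5 \<or> d = 6 \<or> d = 7" using d(1) by auto
    then have "d \<in> {1, 2, 4, 2 * int k - 3} \<or> 8 - d \<in> {1, 2, 4, 2 * int k - 3}" using kl by auto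
    then show ?thesis using short_classified[OF 1(1) d(2)] r.short_classified[OF 1(1) d'] by blast
  next
    case 2
    then obtain d where d: "d \<in> {0..3}" "q dvd offset - (5 * int m + d)" by blast
    \<comment> \<open>Here \<open>d\<close> goes to \<open>3 - d\<close>, so 0 or 1 is reached: 0 is
      type 2 and 1 contradicts nontriviality.\<close>
    have d': "q dvd r.offset - (5 * int m + (3 - d))"
      by (rule flip[OF d(2), of _ 1]) (simp add: 2 p5)
    have "d = 0 \<or> d = 1 \<or> d = 2 \<or> d = 3" using d(1) by auto
    then show ?thesis
      using d(2) d' type2I[OF 2(1)] r.type2I[OF 2(1)] not_trivial_offset(3)[OF 2(1)] r.not_trivial_offset(3)[OF 2(1)]
      by (auto simp: normal_set_def)
  next
    case 3
    then show ?thesis using longest_case by blast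
  qed
qed

end

theorem theorem1p8:
  fixes p m n k l :: nat and A :: "(nat \<Rightarrow> int) set"
  assumes "prime p" and "p = 5 * m + 3"
    and "of_nat m \<ge> max (5 * T_fun (1 / 5)) 21"
    and "n \<ge> 1"
    and "(k, l) = (4, 1) \<or> (k, l) = (3, 2)"
    and "sum_free (Fp_space p n) k l A"
    and "\<not> trivial_set p m n k l A"
    and "card A \<ge> m * p ^ (n - 1)"
  shows "normal_set p m n k l A \<or> type3 p m n k l A \<or> type4 p m n A"
proof -
  obtain S c H where S: "models p n A S" "slices (int p) (rd p (n - 1)) (int m) (k = 4) S c H"
    using exists_model[OF assms(1-6,8)] by blast
  then interpret model p n m k l S c H A
    using assms by (simp add: model_def model_axioms_def sum_free_def)
  show ?thesis by (rule classification)
qed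

end
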